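(* Let $\mathfrak g=\mathfrak{osp}(1|2)$ over $K$, and let $\chi\in\mathfrak g_{\bar 0}^*$ be regular semisimple with $\chi(e)=\chi(f)=0$ (so $\chi(h)\ne0$). Then: (i) The algebra $U_\chi(\mathfrak g)$ is semisimple and isomorphic to the algebra $\bigoplus_\lambda M_{2p}(K)$, the sum being over the $p$ elements $\lambda\in K$ with $\lambda^p-\lambda=\chi(h)^p$. (ii) The algebra $U_\chi(\mathfrak g)$ has $p$ distinct isomorphism classes of irreducible modules, each represented by some $Z_\chi(\lambda)$ with $\lambda^p-\lambda=\chi(h)^p$. The modules $Z_\chi(\lambda)$ are of type $M$.
   Context: $K$ is an algebraically closed field of characteristic $p>2$. Modules are $\mathbb Z_2$-graded; isomorphisms may be even or odd. An irreducible module is of type $M$ if its endomorphism ring (even and odd endomorphisms) is one-dimensional, and of type $Q$ otherwise (then it is two-dimensional). $M_d(K)$ is the algebra of $d\times d$ matrices. $\mathfrak g=\mathfrak{osp}(1|2)$ has even basis $e,h,f$ and odd basis $E,F$ with $[h,e]=2e$, $[h,f]=-2f$, $[e,f]=h$, $[h,E]=E$, $[h,F]=-F$, $[e,E]=0$, $[e,F]=-E$, $[f,E]=-F$, $[f,F]=0$, $[E,E]=2e$, $[E,F]=h$, $[F,F]=-2f$; it is restricted via $e^{[p]}=f^{[p]}=0$, $h^{[p]}=h$. For $\chi\in\mathfrak g_{\bar 0}^*$, $U_\chi(\mathfrak g)=U(\mathfrak g)/\langle x^p-x^{[p]}-\chi(x)^p:x\in\mathfrak g_{\bar 0}\rangle$.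 Let $\mathfrak b=Ke+Kh+KE$. For $\chi$ with $\chi(e)=0$ and $\lambda\in K$ with $\lambda^p-\lambda=\chi(h)^p$, $K_\lambda$ is the one-dimensional $U_\chi(\mathfrak b)$-module on which $h$ acts by $\lambda$ and $e,E$ act by $0$, and the baby Verma module is $Z_\chi(\lambda)=U_\chi(\mathfrak g)\otimes_{U_\chi(\mathfrak b)}K_\lambda$. *)

theory Defs
  imports
    "Jordan_Normal_Form.Matrix"
    "HOL-Algebra.QuotRing"
    "HOL-Algebra.Free_Abelian_Groups"
    "HOL-Library.Z2"
    "HOL-Computational_Algebra.Polynomial"
    "HOL-Number_Theory.Residues"
begin

text \<open>
  Parities live in the two-element field \<^typ>\<open>bit\<close>. The same record serves for a superalgebra over
  a field (scalars \<open>'r\<close> = field, operations \<open>mult\<close> and \<open>one\<close> meaningful) and for a left supermodule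
  over a superalgebra (scalars \<open>'r\<close> = elements of the superalgebra, \<open>mult\<close> and \<open>one\<close> irrelevant).
  \<open>homog M i\<close> is the homogeneous component of parity \<open>i\<close>.
\<close>

record ('r, 'm) supermodule = "('r, 'm) module" +
  homog :: "bit \<Rightarrow> 'm set"

text \<open>
  Since a superalgebra \<open>A\<close> over a field contains the field in its even part, the vector space
  structure of an \<open>A\<close>-module is the one obtained through \<open>c \<mapsto> c \<odot> \<one>\<close>.
\<close>

locale supermodule = A?: ring A + V?: abelian_group V
  for A :: "('k, 'a, 'x) supermodule_scheme" and V :: "('a, 'm, 'y) supermodule_scheme" +
  assumes smult_closed:
      "\<lbrakk>a \<in> carrier A; v \<in> carrier V\<rbrakk> \<Longrightarrow> a \<odot>\<^bsub>V\<^esub> v \<in> carrier V"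
    and smult_l_distr:
      "\<lbrakk>a \<in> carrier A; b \<in> carrier A; v \<in> carrier V\<rbrakk> \<Longrightarrow>
        (a \<oplus>\<^bsub>A\<^esub> b) \<odot>\<^bsub>V\<^esub> v = a \<odot>\<^bsub>V\<^esub> v \<oplus>\<^bsub>V\<^esub> b \<odot>\<^bsub>V\<^esub> v"
    and smult_r_distr:
      "\<lbrakk>a \<in> carrier A; v \<in> carrier V; w \<in> carrier V\<rbrakk> \<Longrightarrow>
        a \<odot>\<^bsub>V\<^esub> (v \<oplus>\<^bsub>V\<^esub> w) = a \<odot>\<^bsub>V\<^esub> v \<oplus>\<^bsub>V\<^esub> a \<odot>\<^bsub>V\<^esub> w"
    and smult_assoc:
      "\<lbrakk>a \<in> carrier A; b \<in> carrier A; v \<in> carrier V\<rbrakk> \<Longrightarrow>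
        (a \<otimes>\<^bsub>A\<^esub> b) \<odot>\<^bsub>V\<^esub> v = a \<odot>\<^bsub>V\<^esub> (b \<odot>\<^bsub>V\<^esub> v)"
    and smult_one: "v \<in> carrier V \<Longrightarrow> \<one>\<^bsub>A\<^esub> \<odot>\<^bsub>V\<^esub> v = v"
    and homog_subgroup: "additive_subgroup (homog V i) V"
    and homog_decomp:
      "v \<in> carrier V \<Longrightarrow> \<exists>!v0. v0 \<in> homog V 0 \<and> (\<exists>v1\<in>homog V 1. v = v0 \<oplus>\<^bsub>V\<^esub> v1)"
    and homog_smult:
      "\<lbrakk>a \<in> homog A i; v \<in> homog V j\<rbrakk> \<Longrightarrow> a \<odot>\<^bsub>V\<^esub> v \<in> homog V (i + j)"

definition graded_subset :: "('r, 'm, 'y) supermodule_scheme \<Rightarrow> 'm set \<Rightarrow> bool" where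
  "graded_subset V N \<longleftrightarrow>
    (\<forall>v\<in>N. \<exists>v0\<in>N \<inter> homog V 0. \<exists>v1\<in>N \<inter> homog V 1. v = v0 \<oplus>\<^bsub>V\<^esub> v1)"

definition irreducible_supermodule ::
  "('k, 'a, 'x) supermodule_scheme \<Rightarrow> ('a, 'm, 'y) supermodule_scheme \<Rightarrow> bool" where
  "irreducible_supermodule A V \<longleftrightarrow> supermodule A V \<and> carrier V \<noteq> {\<zero>\<^bsub>V\<^esub>} \<and>
    (\<forall>N. submodule N A V \<and> graded_subset V N \<longrightarrow> N = {\<zero>\<^bsub>V\<^esub>} \<or> N = carrier V)"

text \<open>
  \<open>super_hom A V W i\<close> consists of the homomorphisms of parity \<open>i\<close>, with the usual sign rule
  \<open>f (a v) = (-1)^(i |a|) a (f v)\<close>.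
\<close>

definition super_hom ::
  "('k, 'a, 'x) supermodule_scheme \<Rightarrow> ('a, 'm, 'y) supermodule_scheme \<Rightarrow>
    ('a, 'n, 'z) supermodule_scheme \<Rightarrow> bit \<Rightarrow> ('m \<Rightarrow> 'n) set" where
  "super_hom A V W i = {f \<in> carrier V \<rightarrow> carrier W.
    (\<forall>v\<in>carrier V. \<forall>w\<in>carrier V. f (v \<oplus>\<^bsub>V\<^esub> w) = f v \<oplus>\<^bsub>W\<^esub> f w) \<and>
    (\<forall>j. \<forall>a\<in>homog A j. \<forall>v\<in>carrier V.
      f (a \<odot>\<^bsub>V\<^esub> v) = (if i = 1 \<and> j = 1 then \<ominus>\<^bsub>W\<^esub> (a \<odot>\<^bsub>W\<^esub> f v) else a \<odot>\<^bsub>W\<^esub> f v)) \<and>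
    (\<forall>j. \<forall>v\<in>homog V j. f v \<in> homog W (j + i))}"

definition super_isomorphic ::
  "('k, 'a, 'x) supermodule_scheme \<Rightarrow> ('a, 'm, 'y) supermodule_scheme \<Rightarrow>
    ('a, 'n, 'z) supermodule_scheme \<Rightarrow> bool" where
  "super_isomorphic A V W \<longleftrightarrow>
    (\<exists>i. \<exists>f\<in>super_hom A V W i. bij_betw f (carrier V) (carrier W))"

definition super_End ::
  "('k, 'a, 'x) supermodule_scheme \<Rightarrow> ('a, 'm, 'y) supermodule_scheme \<Rightarrow> ('k, 'm \<Rightarrow> 'm) module" where
  "super_End A V = \<lparr>
    carrier = {f \<in> extensional (carrier V).
      \<exists>f0\<in>super_hom A V V 0. \<exists>f1\<in>super_hom A V V 1. \<forall>v\<in>carrier V. f v = f0 v \<oplus>\<^bsub>V\<^esub> f1 v},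
    monoid.mult = (\<lambda>f g. \<lambda>v\<in>carrier V. f (g v)),
    one = (\<lambda>v\<in>carrier V. v),
    ring.zero = (\<lambda>v\<in>carrier V. \<zero>\<^bsub>V\<^esub>),
    add = (\<lambda>f g. \<lambda>v\<in>carrier V. f v \<oplus>\<^bsub>V\<^esub> g v),
    module.smult = (\<lambda>c f. \<lambda>v\<in>carrier V. (c \<odot>\<^bsub>A\<^esub> \<one>\<^bsub>A\<^esub>) \<odot>\<^bsub>V\<^esub> f v)\<rparr>"

definition has_dimension :: "('k, 'm, 'y) module_scheme \<Rightarrow> nat \<Rightarrow> bool" where
  "has_dimension V n \<longleftrightarrow> (\<exists>B. finite B \<and> card B = n \<and> B \<subseteq> carrier V \<and>
    (\<forall>v\<in>carrier V. \<exists>!c. c \<in> B \<rightarrow>\<^sub>E UNIV \<and> v = (\<Oplus>\<^bsub>V\<^esub>b\<in>B. c b \<odot>\<^bsub>V\<^esub> b)))"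

definition type_M ::
  "('k, 'a, 'x) supermodule_scheme \<Rightarrow> ('a, 'm, 'y) supermodule_scheme \<Rightarrow> bool" where
  "type_M A V \<longleftrightarrow> irreducible_supermodule A V \<and> has_dimension (super_End A V) 1"

definition regular_module :: "('k, 'a, 'x) supermodule_scheme \<Rightarrow> ('a, 'a) supermodule" where
  "regular_module A = \<lparr>carrier = carrier A, monoid.mult = monoid.mult A, one = one A, ring.zero = ring.zero A,
    add = add A, module.smult = monoid.mult A, homog = homog A\<rparr>"

definition semisimple_algebra :: "('k, 'a, 'x) supermodule_scheme \<Rightarrow> bool" where
  "semisimple_algebra A \<longleftrightarrow> ring A \<and>
    (\<forall>N. submodule N A (regular_module A) \<longrightarrow>
      (\<exists>N'. submodule N' A (regular_module A) \<and> N \<inter> N' = {\<zero>\<^bsub>A\<^esub>} \<and> N <+>\<^bsub>A\<^esub> N' = carrier A))"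

definition semisimple_superalgebra :: "('k, 'a, 'x) supermodule_scheme \<Rightarrow> bool" where
  "semisimple_superalgebra A \<longleftrightarrow> supermodule A (regular_module A) \<and>
    (\<forall>N. submodule N A (regular_module A) \<and> graded_subset A N \<longrightarrow>
      (\<exists>N'. submodule N' A (regular_module A) \<and> graded_subset A N' \<and>
        N \<inter> N' = {\<zero>\<^bsub>A\<^esub>} \<and> N <+>\<^bsub>A\<^esub> N' = carrier A))"

definition algebra_isomorphic :: "('k, 'a, 'x) module_scheme \<Rightarrow> ('k, 'b, 'y) module_scheme \<Rightarrow> bool" where
  "algebra_isomorphic A B \<longleftrightarrow>
    (\<exists>\<phi>\<in>ring_iso A B. \<forall>c. \<forall>a\<in>carrier A. \<phi> (c \<odot>\<^bsub>A\<^esub> a) = c \<odot>\<^bsub>B\<^esub> \<phi> a)"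

definition direct_sum_algebra :: "'i set \<Rightarrow> ('i \<Rightarrow> ('k, 'a) module) \<Rightarrow> ('k, 'i \<Rightarrow> 'a) module" where
  "direct_sum_algebra I A = \<lparr>
    carrier = (\<Pi>\<^sub>E i\<in>I. carrier (A i)),
    monoid.mult = (\<lambda>x y. \<lambda>i\<in>I. x i \<otimes>\<^bsub>A i\<^esub> y i),
    one = (\<lambda>i\<in>I. \<one>\<^bsub>A i\<^esub>),
    ring.zero = (\<lambda>i\<in>I. \<zero>\<^bsub>A i\<^esub>),
    add = (\<lambda>x y. \<lambda>i\<in>I. x i \<oplus>\<^bsub>A i\<^esub> y i),
    module.smult = (\<lambda>c x. \<lambda>i\<in>I. c \<odot>\<^bsub>A i\<^esub> x i)\<rparr>"

text \<open>
  For a homomorphism \<open>\<phi> : B \<rightarrow> A\<close> of superalgebras and a left \<open>B\<close>-supermodule \<open>M\<close>, this is the left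
  \<open>A\<close>-supermodule \<open>A \<otimes>\<^sub>B M\<close>: the free abelian group on \<open>A \<times> M\<close> modulo the biadditivity and
  \<open>B\<close>-balancedness relations. Bilinearity over the base field is part of \<open>B\<close>-balancedness.
\<close>

definition tensor_relations ::
  "('k, 'a, 'x) supermodule_scheme \<Rightarrow> ('k, 'b, 'y) supermodule_scheme \<Rightarrow> ('b \<Rightarrow> 'a) \<Rightarrow>
    ('b, 'm, 'z) supermodule_scheme \<Rightarrow> ('a \<times> 'm \<Rightarrow>\<^sub>0 int) set" where
  "tensor_relations A B \<phi> M =
    {frag_of (a \<oplus>\<^bsub>A\<^esub> a', m) - frag_of (a, m) - frag_of (a', m) | a a' m.
      a \<in> carrier A \<and> a' \<in> carrier A \<and> m \<in> carrier M} \<union>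
    {frag_of (a, m \<oplus>\<^bsub>M\<^esub> m') - frag_of (a, m) - frag_of (a, m') | a m m'.
      a \<in> carrier A \<and> m \<in> carrier M \<and> m' \<in> carrier M} \<union>
    {frag_of (a \<otimes>\<^bsub>A\<^esub> \<phi> b, m) - frag_of (a, b \<odot>\<^bsub>M\<^esub> m) | a b m.
      a \<in> carrier A \<and> b \<in> carrier B \<and> m \<in> carrier M}"

definition tensor_module ::
  "('k, 'a, 'x) supermodule_scheme \<Rightarrow> ('k, 'b, 'y) supermodule_scheme \<Rightarrow> ('b \<Rightarrow> 'a) \<Rightarrow>
    ('b, 'm, 'z) supermodule_scheme \<Rightarrow> ('a, ('a \<times> 'm \<Rightarrow>\<^sub>0 int) set) supermodule" where
  "tensor_module A B \<phi> M =
    (let G = free_Abelian_group (carrier A \<times> carrier M);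
         H = generate G (tensor_relations A B \<phi> M)
     in \<lparr>carrier = carrier (G Mod H), monoid.mult = undefined, one = undefined,
         ring.zero = one (G Mod H), add = monoid.mult (G Mod H),
         module.smult = (\<lambda>a X. \<Union>c\<in>X. H #>\<^bsub>G\<^esub> frag_extend (\<lambda>(a', m). frag_of (a \<otimes>\<^bsub>A\<^esub> a', m)) c),
         homog = (\<lambda>k. {H #>\<^bsub>G\<^esub> c | c.
           c \<in> generate G {frag_of (a, m) | a m. \<exists>i j. a \<in> homog A i \<and> m \<in> homog M j \<and> i + j = k}})\<rparr>)"

datatype osp_basis = e_b | h_b | f_b | E_b | F_b

instance osp_basis :: finite
proof
  have "x \<in> {e_b, h_b, f_b, E_b, F_b}" for x :: osp_basis
    by (cases x) auto
  then have "(UNIV :: osp_basis set) \<subseteq> {e_b, h_b, f_b, E_b, F_b}"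
    by blast
  then show "finite (UNIV :: osp_basis set)"
    by (rule finite_subset) simp
qed

lemma UNIV_osp_basis: "UNIV = {e_b, h_b, f_b, E_b, F_b}"
  using osp_basis.exhaust by blast

text \<open>Elements of the Lie superalgebra are given by their coordinates.\<close>

type_synonym 'k osp = "osp_basis \<Rightarrow> 'k"

fun parity :: "osp_basis \<Rightarrow> bit" where
  "parity e_b = 0" | "parity h_b = 0" | "parity f_b = 0" | "parity E_b = 1" | "parity F_b = 1"

definition basis_vec :: "osp_basis \<Rightarrow> 'k::field osp" where
  "basis_vec b = (\<lambda>j. if j = b then 1 else 0)"

definition scale :: "'k::field \<Rightarrow> 'k osp \<Rightarrow> 'k osp" where
  "scale c x = (\<lambda>j. c * x j)"

fun bracket_basis :: "osp_basis \<Rightarrow> osp_basis \<Rightarrow> 'k::field osp" where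
  "bracket_basis h_b e_b = scale 2 (basis_vec e_b)"
| "bracket_basis e_b h_b = scale (-2) (basis_vec e_b)"
| "bracket_basis h_b f_b = scale (-2) (basis_vec f_b)"
| "bracket_basis f_b h_b = scale 2 (basis_vec f_b)"
| "bracket_basis e_b f_b = basis_vec h_b"
| "bracket_basis f_b e_b = scale (-1) (basis_vec h_b)"
| "bracket_basis h_b E_b = basis_vec E_b"
| "bracket_basis E_b h_b = scale (-1) (basis_vec E_b)"
| "bracket_basis h_b F_b = scale (-1) (basis_vec F_b)"
| "bracket_basis F_b h_b = basis_vec F_b"
| "bracket_basis e_b F_b = scale (-1) (basis_vec E_b)"
| "bracket_basis F_b e_b = basis_vec E_b"
| "bracket_basis f_b E_b = scale (-1) (basis_vec F_b)"
| "bracket_basis E_b f_b = basis_vec F_b"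
| "bracket_basis E_b E_b = scale 2 (basis_vec e_b)"
| "bracket_basis E_b F_b = basis_vec h_b"
| "bracket_basis F_b E_b = basis_vec h_b"
| "bracket_basis F_b F_b = scale (-2) (basis_vec f_b)"
| "bracket_basis _ _ = (\<lambda>_. 0)"

definition bracket :: "'k::field osp \<Rightarrow> 'k osp \<Rightarrow> 'k osp" where
  "bracket x y = (\<lambda>k. \<Sum>i\<in>UNIV. \<Sum>j\<in>UNIV. x i * y j * bracket_basis i j k)"

text \<open>\<open>osp_part S i\<close> is the part of parity \<open>i\<close> of the span of the basis elements in \<open>S\<close>.\<close>

definition osp_part :: "osp_basis set \<Rightarrow> bit \<Rightarrow> 'k::field osp set" where
  "osp_part S i = {x. \<forall>b. x b \<noteq> 0 \<longrightarrow> b \<in> S \<and> parity b = i}"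

abbreviation osp_even :: "'k::field osp set" where
  "osp_even \<equiv> osp_part UNIV 0"

text \<open>
  The \<open>p\<close>-map on the even part, which is \<open>sl\<^sub>2\<close>: its element \<open>x = a e + b h + c f\<close> is the matrix with
  rows \<open>(b, a)\<close> and \<open>(c, -b)\<close>, whose square is the scalar \<open>b\<^sup>2 + a c\<close>; so its \<open>p\<close>-th power is
  \<open>(b\<^sup>2 + a c)^((p-1)/2) x\<close>. The lemmas below confirm the prescribed values on the basis and the
  identity \<open>(ad x)^p = ad (x^[p])\<close>, which determines the \<open>p\<close>-map because \<open>sl\<^sub>2\<close> has trivial centre.
\<close>

definition p_map :: "'k::field osp \<Rightarrow> 'k osp" where
  "p_map x = scale (((x h_b)\<^sup>2 + x e_b * x f_b) ^ ((CHAR('k) - 1) div 2)) x"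

lemma p_map_basis:
  assumes "CHAR('k::field) > 2"
  shows "p_map (basis_vec e_b :: 'k osp) = (\<lambda>_. 0)" "p_map (basis_vec f_b :: 'k osp) = (\<lambda>_. 0)"
    "p_map (basis_vec h_b :: 'k osp) = basis_vec h_b"
  using assms by (auto simp: p_map_def basis_vec_def scale_def power_0_left)
lemma osp_evenD: "x \<in> osp_even \<Longrightarrow> x E_b = 0 \<and> x F_b = 0"
  by (force simp: osp_part_def)

lemma osp_oddD: "x \<in> osp_part UNIV 1 \<Longrightarrow> x e_b = 0 \<and> x h_b = 0 \<and> x f_b = 0"
  by (force simp: osp_part_def)

lemma sum_osp_basis:
  "(\<Sum>b\<in>UNIV. g b) = g e_b + g h_b + g f_b + g E_b + (g F_b :: 'a::comm_monoid_add)"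
  by (simp add: UNIV_osp_basis add.assoc)

lemma bracket_coords:
  "bracket x y e_b = 2 * (x h_b * y e_b - x e_b * y h_b + x E_b * y E_b)"
  "bracket x y h_b = x e_b * y f_b - x f_b * y e_b + x E_b * y F_b + x F_b * y E_b"
  "bracket x y f_b = 2 * (x f_b * y h_b - x h_b * y f_b - x F_b * y F_b)"
  "bracket x y E_b = x h_b * y E_b - x E_b * y h_b - x e_b * y F_b + x F_b * y e_b"
  "bracket x y F_b = x F_b * y h_b - x h_b * y F_b - x f_b * y E_b + x E_b * y f_b"
  unfolding bracket_def sum_osp_basis bracket_basis.simps scale_def basis_vec_def
  by (simp_all only: osp_basis.distinct  if_True if_False mult_zero_right mult_zero_left add_0_left add_0_right simp_thms mult_1_right) (simp_all add: ring_distribs)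

lemma osp_ext:
  assumes "x e_b = y e_b" "x h_b = y h_b" "x f_b = y f_b" "x E_b = y E_b" "x F_b = y F_b"
  shows "x = y"
proof
  fix j show "x j = y j" using assms by (cases j) auto
qed

lemma ad_square_odd:
  assumes "x \<in> osp_even" "y \<in> osp_part UNIV 1"
  shows "bracket x (bracket x y) = scale ((x h_b)\<^sup>2 + x e_b * x f_b) y"
proof -
  have x: "x E_b = 0" "x F_b = 0" and y: "y e_b = 0" "y h_b = 0" "y f_b = 0"
    using osp_evenD[OF assms(1)] osp_oddD[OF assms(2)] by auto
  show ?thesis
    by (rule osp_ext; simp only: bracket_coords scale_def x y mult_zero_left mult_zero_right add_0_left add_0_right diff_0_right; simp add: algebra_simps power2_eq_square)
qed

lemma ad_cube_even:
  assumes "x \<in> osp_even" "y \<in> osp_even"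
  shows "bracket x (bracket x (bracket x y)) = scale (4 * ((x h_b)\<^sup>2 + x e_b * x f_b)) (bracket x y)"
proof -
  have x: "x E_b = 0" "x F_b = 0" and y: "y E_b = 0" "y F_b = 0"
    using osp_evenD[OF assms(1)] osp_evenD[OF assms(2)] by auto
  show ?thesis
    by (rule osp_ext; simp only: bracket_coords scale_def x y mult_zero_left mult_zero_right add_0_left add_0_right diff_0_right; simp add: algebra_simps power2_eq_square)
qed

lemma four_power_CHAR:
  assumes "CHAR('k::field) > 2"
  shows "(4::'k) ^ ((CHAR('k) - 1) div 2) = 1"
proof -
  let ?p = "CHAR('k)"
  have p: "prime ?p" using assms by (intro prime_CHAR_semidom) auto
  have odd: "odd ?p" using p assms prime_odd_nat by blast
  have "\<not> ?p dvd 2" using assms by (auto dest: dvd_imp_le)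
  then have "[2 ^ (?p - 1) = 1] (mod ?p)" using p by (rule fermat_theorem[rotated])
  then have "of_nat (2 ^ (?p - 1)) = (of_nat 1 :: 'k)" by (simp only: of_nat_eq_iff_cong_CHAR)
  moreover have "?p - 1 = 2 * ((?p - 1) div 2)" using odd by auto
  ultimately have "(2::'k) ^ (2 * ((?p - 1) div 2)) = 1" by (metis of_nat_1 of_nat_numeral of_nat_power)
  then show ?thesis by (simp add: power_mult)
qed

lemma bracket_scale_right: "bracket x (scale c y) = scale c (bracket x y)"
  by (rule osp_ext; simp add: bracket_coords scale_def; simp add: algebra_simps)

lemma bracket_scale_left: "bracket (scale c x) y = scale c (bracket x y)"
  by (rule osp_ext; simp add: bracket_coords scale_def; simp add: algebra_simps)

lemma bracket_add_right: "bracket x (\<lambda>j. y j + z j) = (\<lambda>j. bracket x y j + bracket x z j)"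
  by (rule osp_ext; simp add: bracket_coords; simp add: algebra_simps)

lemma scale_scale: "scale c (scale d y) = scale (c * d) y"
  by (simp add: scale_def mult.assoc)

lemma ad_funpow_odd:
  assumes "x \<in> osp_even" "y \<in> osp_part UNIV 1"
  shows "(bracket x ^^ Suc (2 * n)) y = scale (((x h_b)\<^sup>2 + x e_b * x f_b) ^ n) (bracket x y)"
proof (induction n)
  case 0 show ?case by (simp add: scale_def)
next
  case (Suc n)
  have "(bracket x ^^ Suc (2 * Suc n)) y = bracket x (bracket x ((bracket x ^^ Suc (2 * n)) y))"
    by simp
  also have "\<dots> = scale (((x h_b)\<^sup>2 + x e_b * x f_b) ^ n) (bracket x (bracket x (bracket x y)))"
    by (simp only: Suc bracket_scale_right)
  also have "\<dots> = scale (((x h_b)\<^sup>2 + x e_b * x f_b) ^ Suc n) (bracket x y)"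
    by (simp only: ad_square_odd[OF assms] bracket_scale_right scale_scale power_Suc2)
  finally show ?case .
qed

lemma ad_funpow_even:
  assumes "x \<in> osp_even" "y \<in> osp_even"
  shows "(bracket x ^^ Suc (2 * n)) y = scale ((4 * ((x h_b)\<^sup>2 + x e_b * x f_b)) ^ n) (bracket x y)"
proof (induction n)
  case 0 show ?case by (simp add: scale_def)
next
  case (Suc n)
  have "(bracket x ^^ Suc (2 * Suc n)) y = bracket x (bracket x ((bracket x ^^ Suc (2 * n)) y))"
    by simp
  also have "\<dots> = scale ((4 * ((x h_b)\<^sup>2 + x e_b * x f_b)) ^ n) (bracket x (bracket x (bracket x y)))"
    by (simp only: Suc bracket_scale_right)
  also have "\<dots> = scale ((4 * ((x h_b)\<^sup>2 + x e_b * x f_b)) ^ Suc n) (bracket x y)"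
    by (simp only: ad_cube_even[OF assms] scale_scale power_Suc2)
  finally show ?case .
qed

lemma funpow_bracket_add:
  "(bracket x ^^ n) (\<lambda>j. y j + z j) = (\<lambda>j. (bracket x ^^ n) y j + (bracket x ^^ n) z j)"
  by (induction n) (simp_all add: bracket_add_right)

lemma ad_p_map:
  fixes x y :: "'k::field osp"
  assumes p: "CHAR('k) > 2" and x: "x \<in> osp_even"
  shows "(bracket x ^^ CHAR('k)) y = bracket (p_map x) y"
proof -
  define n where "n = (CHAR('k) - 1) div 2"
  have "prime CHAR('k)" using p by (intro prime_CHAR_semidom) auto
  then have "odd CHAR('k)" using p prime_odd_nat by blast
  then have n: "CHAR('k) = Suc (2 * n)" by (auto simp: n_def elim: oddE)
  define y0 y1 where "y0 = (\<lambda>j. if parity j = 0 then y j else 0)"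
    and "y1 = (\<lambda>j. if parity j = 1 then y j else 0)"
  have y: "y = (\<lambda>j. y0 j + y1 j)"
    by (rule osp_ext) (simp_all add: y0_def y1_def)
  have y0: "y0 \<in> osp_even" and y1: "y1 \<in> osp_part UNIV 1"
    by (auto simp: osp_part_def y0_def y1_def split: if_splits)
  have 4: "(4::'k) ^ n = 1" using four_power_CHAR[OF p] by (simp add: n_def)
  show ?thesis
    unfolding y funpow_bracket_add n ad_funpow_even[OF x y0] ad_funpow_odd[OF x y1]
    unfolding p_map_def n_def[symmetric] bracket_scale_left bracket_add_right power_mult_distrib 4
    by (simp add: scale_def distrib_left)
qed

definition even_dual :: "('k::field osp \<Rightarrow> 'k) set" where
  "even_dual = {\<chi>. \<forall>x\<in>osp_even. \<forall>y\<in>osp_even. \<forall>a b.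
    \<chi> (\<lambda>j. a * x j + b * y j) = a * \<chi> x + b * \<chi> y}"

text \<open>
  A functional on the even part is regular semisimple if its stabilizer under the coadjoint action
  is a maximal torus, that is (for \<open>sl\<^sub>2\<close>) a line spanned by an \<open>ad\<close>-semisimple element.
\<close>

definition coadjoint_stabilizer :: "('k::field osp \<Rightarrow> 'k) \<Rightarrow> 'k osp set" where
  "coadjoint_stabilizer \<chi> = {x\<in>osp_even. \<forall>y\<in>osp_even. \<chi> (bracket x y) = 0}"

definition ad_semisimple :: "'k::field osp \<Rightarrow> bool" where
  "ad_semisimple t \<longleftrightarrow> (\<forall>y\<in>osp_even. \<exists>(S::'k set) v. finite S \<and>
    (\<forall>a\<in>S. v a \<in> osp_even \<and> bracket t (v a) = scale a (v a)) \<and> y = (\<lambda>j. \<Sum>a\<in>S. v a j))"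

definition regular_semisimple :: "('k::field osp \<Rightarrow> 'k) \<Rightarrow> bool" where
  "regular_semisimple \<chi> \<longleftrightarrow>
    (\<exists>t\<in>osp_even. t \<noteq> (\<lambda>_. 0) \<and> ad_semisimple t \<and> coadjoint_stabilizer \<chi> = range (\<lambda>c. scale c t))"

lemma basis_vec_even: "parity b = 0 \<Longrightarrow> basis_vec b \<in> osp_even"
  by (auto simp: osp_part_def basis_vec_def)

lemma even_dual_coords:
  fixes \<chi> :: "'k::field osp \<Rightarrow> 'k"
  assumes \<chi>: "\<chi> \<in> even_dual" and x: "x \<in> osp_even"
    and "\<chi> (basis_vec e_b) = 0" "\<chi> (basis_vec f_b) = 0"
  shows "\<chi> x = x h_b * \<chi> (basis_vec h_b)"
proof -
  have lin: "\<chi> (\<lambda>j. a * x j + b * y j) = a * \<chi> x + b * \<chi> y" if "x \<in> osp_even" "y \<in> osp_even" for x y a b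
    using \<chi> that by (simp add: even_dual_def)
  let ?u = "\<lambda>j. x e_b * basis_vec e_b j + x f_b * basis_vec f_b j"
  have u: "?u \<in> osp_even"
    by (auto simp: osp_part_def basis_vec_def split: if_splits)
  have "x = (\<lambda>j. 1 * ?u j + x h_b * basis_vec h_b j)"
    using osp_evenD[OF x] by (intro osp_ext) (simp_all add: basis_vec_def)
  then have "\<chi> x = 1 * \<chi> ?u + x h_b * \<chi> (basis_vec h_b)"
    using lin[OF u basis_vec_even, of h_b 1 "x h_b"] by simp
  then show ?thesis
    using lin[OF basis_vec_even basis_vec_even, of e_b f_b "x e_b" "x f_b"] assms by simp
qed

lemma regular_semisimple_iff:
  fixes \<chi> :: "'k::field osp \<Rightarrow> 'k"
  assumes p: "CHAR('k) > 2" and \<chi>: "\<chi> \<in> even_dual"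
    and ef: "\<chi> (basis_vec e_b) = 0" "\<chi> (basis_vec f_b) = 0"
  shows "regular_semisimple \<chi> \<longleftrightarrow> \<chi> (basis_vec h_b) \<noteq> 0"
proof -
  have two: "(2::'k) \<noteq> 0"
  proof
    assume "(2::'k) = 0"
    then have "of_nat 2 = (0::'k)" by simp
    then have "CHAR('k) dvd 2" by (simp only: of_nat_eq_0_iff_char_dvd)
    then show False using p by (auto dest: dvd_imp_le)
  qed
  have br: "bracket x y \<in> osp_even" if "x \<in> osp_even" "y \<in> osp_even" for x y :: "'k osp"
  proof -
    have "bracket x y b \<noteq> 0 \<Longrightarrow> parity b = 0" for b
      using osp_evenD[OF that(1)] osp_evenD[OF that(2)] by (cases b) (auto simp: bracket_coords)
    then show ?thesis by (simp add: osp_part_def)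
  qed
  have stab: "coadjoint_stabilizer \<chi> =
      {x\<in>osp_even. \<forall>y\<in>osp_even. (x e_b * y f_b - x f_b * y e_b) * \<chi> (basis_vec h_b) = 0}"
  proof -
    have "\<chi> (bracket x y) = (x e_b * y f_b - x f_b * y e_b) * \<chi> (basis_vec h_b)"
      if "x \<in> osp_even" "y \<in> osp_even" for x y
      using even_dual_coords[OF \<chi> br[OF that] ef] osp_evenD[OF that(1)] by (simp add: bracket_coords)
    then show ?thesis unfolding coadjoint_stabilizer_def by (intro Collect_cong conj_cong ball_cong) auto
  qed
  have ev: "basis_vec e_b \<in> (osp_even :: 'k osp set)" "basis_vec h_b \<in> (osp_even :: 'k osp set)"
    "basis_vec f_b \<in> (osp_even :: 'k osp set)"
    by (simp_all add: basis_vec_even)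
  show ?thesis
  proof
    assume "regular_semisimple \<chi>"
    then obtain t where t: "coadjoint_stabilizer \<chi> = range (\<lambda>c. scale c t)"
      by (auto simp: regular_semisimple_def)
    show "\<chi> (basis_vec h_b) \<noteq> 0"
    proof
      assume "\<chi> (basis_vec h_b) = 0"
      then have "range (\<lambda>c. scale c t) = osp_even" using stab t by auto
      then obtain c d where c: "basis_vec e_b = scale c t" and d: "basis_vec h_b = scale d t"
        using ev by (metis (no_types, lifting) imageE)
      have "c * t e_b = 1" "d * t e_b = 0" "d * t h_b = 1"
        using fun_cong[OF c, of e_b] fun_cong[OF d, of e_b] fun_cong[OF d, of h_b]
        by (simp_all add: basis_vec_def scale_def)
      then show False by auto
    qed
  next
    assume h: "\<chi> (basis_vec h_b) \<noteq> 0"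
    have "coadjoint_stabilizer \<chi> = range (\<lambda>c. scale c (basis_vec h_b))"
    proof (intro equalityI subsetI)
      fix x assume "x \<in> coadjoint_stabilizer \<chi>"
      then have x: "x \<in> osp_even" and *: "\<And>y. y \<in> osp_even \<Longrightarrow> x e_b * y f_b - x f_b * y e_b = 0"
        using h by (auto simp: stab)
      have "x e_b = 0" "x f_b = 0"
        using *[OF ev(1)] *[OF ev(3)] by (simp_all add: basis_vec_def)
      then have "x = scale (x h_b) (basis_vec h_b)"
        using osp_evenD[OF x] by (intro osp_ext) (simp_all add: scale_def basis_vec_def)
      then show "x \<in> range (\<lambda>c. scale c (basis_vec h_b))" by blast
    next
      fix x :: "'k osp" assume "x \<in> range (\<lambda>c. scale c (basis_vec h_b))"
      then show "x \<in> coadjoint_stabilizer \<chi>"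
        by (auto simp: stab scale_def basis_vec_def osp_part_def split: if_splits)
    qed
    moreover have "ad_semisimple (basis_vec h_b :: 'k osp)"
      unfolding ad_semisimple_def
    proof
      fix y :: "'k osp" assume y: "y \<in> osp_even"
      define v :: "'k \<Rightarrow> 'k osp" where
        "v a = (if a = 2 then scale (y e_b) (basis_vec e_b) else
                if a = 0 then scale (y h_b) (basis_vec h_b) else scale (y f_b) (basis_vec f_b))" for a
      have d: "(2::'k) \<noteq> -2" 
      proof
        assume "(2::'k) = -2"
        then have "2 * 2 = (0::'k)" by (metis add.right_inverse mult_2)
        then show False using two by (metis mult_eq_0_iff)
      qed
      have 1: "v a \<in> osp_even" for a
        by (auto simp: v_def osp_part_def scale_def basis_vec_def split: if_splits)
      have 2: "bracket (basis_vec h_b) (v a) = scale a (v a)" if "a \<in> {2, 0, -2}" for a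
        using that two d
        by (intro osp_ext) (auto simp: v_def bracket_coords scale_def basis_vec_def)
      have 3: "y = (\<lambda>j. \<Sum>a\<in>{2, 0, -2}. v a j)"
        using osp_evenD[OF y] two d two[symmetric]
        by (intro osp_ext) (simp_all add: v_def scale_def basis_vec_def)
      show "\<exists>S v. finite S \<and> (\<forall>a\<in>S. v a \<in> osp_even \<and> bracket (basis_vec h_b) (v a) = scale a (v a)) \<and>
          y = (\<lambda>j. \<Sum>a\<in>S. v a j)"
        by (rule exI[of _ "{2, 0, -2}"], rule exI[of _ v]) (use 1 2 3 in auto)
    qed
    moreover have "basis_vec h_b \<noteq> (\<lambda>_. 0 :: 'k)"
      by (auto simp: basis_vec_def fun_eq_iff)
    ultimately show "regular_semisimple \<chi>"
      unfolding regular_semisimple_def using ev(2) by blast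
  qed
qed

text \<open>
  The monomials of the tensor algebra are the words in the basis, so with concatenation as
  addition of words the tensor algebra is the monoid algebra \<^typ>\<open>osp_basis list \<Rightarrow>\<^sub>0 'k\<close>.
\<close>

instantiation list :: (type) monoid_add
begin

definition zero_list :: "'a list" where "zero_list = []"

definition plus_list :: "'a list \<Rightarrow> 'a list \<Rightarrow> 'a list" where "plus_list = (@)"

instance by standard (simp_all add: zero_list_def plus_list_def)

end

type_synonym 'k words = "osp_basis list \<Rightarrow>\<^sub>0 'k"

definition scalar_word :: "'k::field \<Rightarrow> 'k words" where
  "scalar_word c = Poly_Mapping.single [] c"

definition embed :: "'k::field osp \<Rightarrow> 'k words" where
  "embed x = (\<Sum>b\<in>UNIV. Poly_Mapping.single [b] (x b))"

definition tensor_algebra :: "osp_basis set \<Rightarrow> ('k::field words) ring" where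
  "tensor_algebra S = \<lparr>carrier = {a. \<forall>w\<in>Poly_Mapping.keys a. set w \<subseteq> S},
    monoid.mult = (*), one = 1, ring.zero = 0, add = (+)\<rparr>"

definition tensor_part :: "osp_basis set \<Rightarrow> bit \<Rightarrow> 'k::field words set" where
  "tensor_part S i = {a \<in> carrier (tensor_algebra S).
    \<forall>w\<in>Poly_Mapping.keys a. sum_list (map parity w) = i}"

definition reduced_relations :: "('k::field osp \<Rightarrow> 'k) \<Rightarrow> osp_basis set \<Rightarrow> 'k words set" where
  "reduced_relations \<chi> S =
    {embed x * embed y - (if i = 1 \<and> j = 1 then - 1 else 1) * (embed y * embed x) - embed (bracket x y)
      | x y i j. x \<in> osp_part S i \<and> y \<in> osp_part S j} \<union>
    {embed x ^ CHAR('k) - embed (p_map x) - scalar_word (\<chi> x ^ CHAR('k)) | x. x \<in> osp_part S 0}"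

definition reduced_ideal :: "('k::field osp \<Rightarrow> 'k) \<Rightarrow> osp_basis set \<Rightarrow> 'k words set" where
  "reduced_ideal \<chi> S = Idl\<^bsub>tensor_algebra S\<^esub> (reduced_relations \<chi> S)"

text \<open>
  The reduced enveloping superalgebra of the subalgebra spanned by the basis elements in \<open>S\<close>
  (which has to be closed under the bracket). \<open>S = UNIV\<close> gives the one of \<open>osp(1|2)\<close>.
\<close>

definition reduced_enveloping ::
  "('k::field osp \<Rightarrow> 'k) \<Rightarrow> osp_basis set \<Rightarrow> ('k, 'k words set) supermodule" where
  "reduced_enveloping \<chi> S =
    (let T = tensor_algebra S; I = reduced_ideal \<chi> S; Q = T Quot I
     in \<lparr>carrier = carrier Q, monoid.mult = monoid.mult Q, one = one Q, ring.zero = ring.zero Q,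
         add = add Q, module.smult = (\<lambda>c X. monoid.mult Q (I +>\<^bsub>T\<^esub> scalar_word c) X),
         homog = (\<lambda>i. {I +>\<^bsub>T\<^esub> a | a. a \<in> tensor_part S i})\<rparr>)"

abbreviation U_osp :: "('k::field osp \<Rightarrow> 'k) \<Rightarrow> ('k, 'k words set) supermodule" where
  "U_osp \<chi> \<equiv> reduced_enveloping \<chi> UNIV"

abbreviation U_borel :: "('k::field osp \<Rightarrow> 'k) \<Rightarrow> ('k, 'k words set) supermodule" where
  "U_borel \<chi> \<equiv> reduced_enveloping \<chi> {e_b, h_b, E_b}"

text \<open>
  The canonical homomorphism from \<^term>\<open>U_borel \<chi>\<close> to \<^term>\<open>U_osp \<chi>\<close>: as the ideal of the former is
  contained in the one of the latter, adding the latter to a coset gives the image coset.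
\<close>

definition borel_inclusion :: "('k::field osp \<Rightarrow> 'k) \<Rightarrow> 'k words set \<Rightarrow> 'k words set" where
  "borel_inclusion \<chi> X = reduced_ideal \<chi> UNIV <+>\<^bsub>tensor_algebra UNIV\<^esub> X"

text \<open>
  The homomorphism from the tensor algebra to \<open>'k\<close> with \<open>h \<mapsto> \<lambda>\<close> and the other basis elements mapped
  to 0. For \<open>\<lambda>^p - \<lambda> = \<chi>(h)^p\<close> and \<open>\<chi>(e) = 0\<close> it is constant on the cosets forming \<^term>\<open>U_borel \<chi>\<close>.
\<close>

definition borel_character :: "'k::field \<Rightarrow> 'k words \<Rightarrow> 'k" where
  "borel_character l a = (\<Sum>w\<in>Poly_Mapping.keys a.
    Poly_Mapping.lookup a w * prod_list (map (\<lambda>b. if b = h_b then l else 0) w))"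

definition K_module :: "'k::field \<Rightarrow> ('k words set, 'k) supermodule" where
  "K_module l = \<lparr>carrier = UNIV, monoid.mult = (*), one = 1, ring.zero = 0, add = (+),
    module.smult = (\<lambda>X v. the_elem (borel_character l ` X) * v),
    homog = (\<lambda>i. if i = 0 then UNIV else {0})\<rparr>"

definition baby_verma ::
  "('k::field osp \<Rightarrow> 'k) \<Rightarrow> 'k \<Rightarrow> ('k words set, ('k words set \<times> 'k \<Rightarrow>\<^sub>0 int) set) supermodule" where
  "baby_verma \<chi> l = tensor_module (U_osp \<chi>) (U_borel \<chi>) (borel_inclusion \<chi>) (K_module l)"

definition weights :: "('k::field osp \<Rightarrow> 'k) \<Rightarrow> 'k set" where
  "weights \<chi> = {l. l ^ CHAR('k) - l = \<chi> (basis_vec h_b) ^ CHAR('k)}"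

end

theory Submission
  imports Defs "HOL-Library.Function_Algebras"
begin

text \<open>
  A baby Verma module of highest weight \<open>\<lambda>\<close> has the basis \<open>F\<^sup>i v\<^sub>0\<close>, \<open>i < 2p\<close>, in which \<open>E\<close> lowers the
  index with the coefficients \<open>\<lambda> - (i - 1)/2\<close> (\<open>i\<close> odd) and \<open>-i/2\<close> (\<open>i\<close> even). As \<open>\<chi>(h) \<noteq> 0\<close>, no weight
  \<open>\<lambda>\<close> lies in the prime field, so these coefficients are nonzero for \<open>0 < i < 2p\<close>. The element
  \<open>F\<^sup>i E\<^sup>r L\<close>, with \<open>L\<close> a polynomial in \<open>h\<close> singling out one weight, therefore sends \<open>v\<^sub>r\<close> in the
  corresponding module to a nonzero multiple of \<open>v\<^sub>i\<close> and kills \<open>v\<^sub>0, \<dots>, v\<^bsub>r-1\<^esub>\<close> in all of them. By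
  induction on \<open>r\<close>, the product of the \<open>p\<close> representations maps \<open>U\<^sub>\<chi>\<close> onto \<open>M\<^bsub>2p\<^esub>(K)\<^sup>p\<close>, and the same
  triangularity shows that it is injective on the combinations of the monomials \<open>F\<^sup>i E\<^sup>k h\<^sup>j\<close> with
  \<open>i, k < 2p\<close> and \<open>j < p\<close>, which span \<open>U\<^sub>\<chi>\<close>. Everything else is read off from matrix units of definite
  parity. That the representations satisfy \<open>x\<^sup>p - x\<^bsup>[p]\<^esup> = \<chi>(x)\<^sup>p\<close> for all even \<open>x\<close> and not only
  for \<open>e, h, f\<close> rests on Jacobson's formula.
\<close>

section \<open>Additive endomorphisms\<close>

text \<open>The defining ideal contains the relation x^p - x^[p] = \<chi>(x)^p for every even x, so
  no representation descends to the quotient before that relation is known for all x; direct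
  computation reaches only multiples of e, h and f. The remaining x are reached by joining two even
  elements by a line with a polynomial parameter and differentiating along it, which is why the
  operators are defined over an arbitrary commutative ring of coefficients. The operators act on all
  functions on the naturals, so that they form a ring in which powers and commutators can be
  computed by rewriting; the module of dimension 2p is recovered as the subspace
  \<open>Zspace\<close>. Facts about modules are proved for any supermodule that corresponds to
  \<open>Zspace\<close> under a bijection transporting action and grading
  (\<open>verma_like\<close>). The tensor product, a quotient of a free abelian group, is opened
  only to construct such a bijection, by identifying its subgroup of relations with the kernel of
  the evaluation at the highest weight vector.\<close>

text \<open>The sort constraint \<open>zero_neq_one\<close> only serves to make the underlying group nontrivial.\<close>

typedef (overloaded) 'a endo =
    "{f :: 'a::{ab_group_add, zero_neq_one} \<Rightarrow> 'a. \<forall>x y. f (x + y) = f x + f y}"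
  morphisms app Endo
  by (rule exI[of _ id]) simp

setup_lifting type_definition_endo

lemma app_add: "app a (x + y) = app a x + app a y"
  using app[of a] by simp

lemma app_0 [simp]: "app a 0 = 0"
  using app_add[of a 0 0] by simp

lemma app_minus: "app a (- x) = - app a x"
  using app_add[of a x "- x"] by (simp add: eq_neg_iff_add_eq_0 add.commute)

lemma app_diff: "app a (x - y) = app a x - app a y"
  using app_add[of a x "- y"] by (simp add: app_minus)

lemma app_sum: "app a (sum f A) = (\<Sum>i\<in>A. app a (f i))"
  by (induction A rule: infinite_finite_induct) (simp_all add: app_add)

lemma endo_eqI: "(\<And>x. app a x = app b x) \<Longrightarrow> a = b"
  by (simp add: app_inject[symmetric] fun_eq_iff)

instantiation endo :: ("{ab_group_add, zero_neq_one}") ring_1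
begin

lift_definition zero_endo :: "'a endo" is "\<lambda>_. 0" by simp
lift_definition one_endo :: "'a endo" is "\<lambda>x. x" by simp
lift_definition plus_endo :: "'a endo \<Rightarrow> 'a endo \<Rightarrow> 'a endo" is "\<lambda>f g x. f x + g x"
  by (simp add: algebra_simps)
lift_definition minus_endo :: "'a endo \<Rightarrow> 'a endo \<Rightarrow> 'a endo" is "\<lambda>f g x. f x - g x"
  by (simp add: algebra_simps)
lift_definition uminus_endo :: "'a endo \<Rightarrow> 'a endo" is "\<lambda>f x. - f x"
  by (simp add: algebra_simps)
lift_definition times_endo :: "'a endo \<Rightarrow> 'a endo \<Rightarrow> 'a endo" is "\<lambda>f g x. f (g x)"
  by simp

instance
proof
  show "(0::'a endo) \<noteq> 1"
    by transfer (metis zero_neq_one)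
qed (transfer; simp add: algebra_simps)+

end

lemma app_ring [simp]:
  "app 0 x = 0" "app 1 x = x" "app (a + b) x = app a x + app b x" "app (a - b) x = app a x - app b x"
  "app (- a) x = - app a x" "app (a * b) x = app a (app b x)"
  by (simp_all add: zero_endo.rep_eq one_endo.rep_eq plus_endo.rep_eq minus_endo.rep_eq
      uminus_endo.rep_eq times_endo.rep_eq)

lemma app_sum_left: "app (sum f A) x = (\<Sum>i\<in>A. app (f i) x)"
  by (induction A rule: infinite_finite_induct) simp_all

section \<open>Iterated commutators\<close>

definition comm :: "'a::ring_1 \<Rightarrow> 'a \<Rightarrow> 'a" where
  "comm z y = z * y - y * z"

text \<open>Bracketing with \<open>z\<close> is the difference of left and right multiplication by
  \<open>z\<close>, two commuting operations; this is its binomial expansion.\<close>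

lemma comm_funpow:
  "(comm z ^^ n) y = (\<Sum>k\<le>n. of_nat (n choose k) * ((-1) ^ k * (z ^ (n - k) * y * z ^ k)))"
proof (induction n)
  case (Suc n)
  let ?f = "\<lambda>n k. (-1) ^ k * (z ^ (n - k) * y * z ^ k)"
  have L: "z * (of_nat m * ((-1) ^ k * w)) = of_nat m * ((-1) ^ k * (z * w))" for m k w
    by (metis (no_types, lifting) mult.assoc mult_of_nat_commute mult_minus1 mult_minus1_right
        mult_1 minus_one_power_iff)
  have "z * (comm z ^^ n) y = (\<Sum>k\<le>n. of_nat (n choose k) * ?f (Suc n) k)"
    unfolding Suc sum_distrib_left L
    by (intro sum.cong refl) (simp add: Suc_diff_le mult.assoc)
  also have "\<dots> = (\<Sum>k\<le>Suc n. of_nat (n choose k) * ?f (Suc n) k)"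
    by (simp add: binomial_eq_0)
  also have "\<dots> = ?f (Suc n) 0 + (\<Sum>k\<le>n. of_nat (n choose Suc k) * ?f (Suc n) (Suc k))"
    by (simp add: sum.atMost_Suc_shift del: sum.atMost_Suc power_Suc)
  finally have 1: "z * (comm z ^^ n) y = \<dots>" .
  have 2: "(comm z ^^ n) y * z = - (\<Sum>k\<le>n. of_nat (n choose k) * ?f (Suc n) (Suc k))"
    unfolding Suc sum_distrib_right sum_negf[symmetric]
    by (intro sum.cong refl) (simp add: mult.assoc power_commutes)
  have "(comm z ^^ Suc n) y = z * (comm z ^^ n) y - (comm z ^^ n) y * z"
    by (simp add: comm_def[of z "(comm z ^^ n) y"])
  also have "\<dots> = ?f (Suc n) 0 + (\<Sum>k\<le>n. of_nat (Suc n choose Suc k) * ?f (Suc n) (Suc k))"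
    unfolding 1 2 binomial_Suc_Suc of_nat_add distrib_right sum.distrib by (simp add: add_ac)
  also have "\<dots> = (\<Sum>k\<le>Suc n. of_nat (Suc n choose k) * ?f (Suc n) k)"
    by (simp add: sum.atMost_Suc_shift del: sum.atMost_Suc power_Suc)
  finally show ?case .
qed simp

text \<open>Modulo p only the two outer binomial terms survive, and the oddness of p makes the last
  one negative.\<close>

lemma comm_funpow_prime:
  fixes z y :: "'a::ring_1"
  assumes p: "prime p" "odd p" and char: "(of_nat p :: 'a) = 0"
  shows "(comm z ^^ p) y = comm (z ^ p) y"
proof -
  have "of_nat (p choose k) = (0::'a)" if "k \<noteq> 0" "k \<noteq> p" "k \<le> p" for k
  proof -
    have "p dvd p choose k" using that p by (intro dvd_choose_prime) auto
    then show ?thesis using char by (auto elim!: dvdE)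
  qed
  then have "(\<Sum>k\<le>p. of_nat (p choose k) * ((-1) ^ k * (z ^ (p - k) * y * z ^ k))) =
      (\<Sum>k\<in>{0, p}. of_nat (p choose k) * ((-1) ^ k * (z ^ (p - k) * y * z ^ k)))"
    by (intro sum.mono_neutral_right) auto
  also have "\<dots> = comm (z ^ p) y"
    using p by (simp add: comm_def prime_gt_0_nat)
  finally show ?thesis by (simp add: comm_funpow)
qed

text \<open>
  Jacobson's formula for \<open>sl\<^sub>2\<close>. Here \<open>D\<close> plays the role of differentiation with respect to a parameter
  on which \<open>z\<close> depends, \<open>x\<close> is the derivative of \<open>z\<close>, and \<open>q'\<close> the one of the quadratic form \<open>q\<close>:
  \<open>(ad z)\<^sup>p D\<close> is computed both as \<open>[z\<^sup>p, D]\<close> and as \<open>- (ad z)\<^bsup>p-1\<^esup> x\<close>.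
\<close>

lemma derivation_commutes:
  fixes z x D q q' :: "'a::ring_1"
  assumes p: "prime p" and pm: "p = 2 * m + 1" and char: "(of_nat p :: 'a) = 0"
    and D: "comm z D = - x"
    and ad2: "comm z (comm z x) = 4 * q * x - 2 * q' * z"
    and q: "q * z = z * q" "q * x = x * q" and q': "q' * z = z * q'" "q' * q = q * q'"
    and Dq: "D * q = q * D + q'"
    and four: "(4::'a) ^ m = 1"
  shows "D * (z ^ p - q ^ m * z) = (z ^ p - q ^ m * z) * D"
proof -
  have p2: "p \<noteq> 2" using pm by presburger
  then have m: "m \<ge> 1" using p pm by (cases m) auto
  have qz: "q ^ n * z = z * q ^ n" for n
    by (rule power_commuting_commutes[OF q(1)])
  have qm: "q' * q ^ n = q ^ n * q'" for n
    by (metis q'(2) power_commuting_commutes)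
  have num: "(numeral k :: 'a) * w = w * numeral k" for k w
    by (rule mult_of_nat_commute[of "numeral k", simplified])
  have lin: "comm z (a * b) = a * comm z b" if "a * z = z * a" for a b
    using that by (simp add: comm_def right_diff_distrib mult.assoc[symmetric])
  have fqz: "(4 * q) * z = z * (4 * q)"
    by (metis num mult.assoc q(1))
  have ad3: "comm z (4 * q * x - 2 * q' * z) = 4 * q * comm z x"
  proof -
    have 1: "comm z (2 * q' * z) = 0"
      unfolding comm_def by (metis num mult.assoc q'(1) diff_self)
    have "comm z (4 * q * x - 2 * q' * z) = comm z (4 * q * x) - comm z (2 * q' * z)"
      by (simp add: comm_def algebra_simps)
    then show ?thesis using lin[OF fqz, of x] 1 by simp
  qed
  \<comment> \<open>Two more brackets reproduce an even power up to the factor 4q, because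
    \<open>ad3\<close> removes the summand with \<open>z\<close>; so \<open>ad2\<close> determines
    all of them.\<close>
  have even: "(comm z ^^ (2 * Suc k)) x = (4 * q) ^ k * (4 * q * x - 2 * q' * z)" for k
  proof (induction k)
    case 0
    then show ?case by (simp add: ad2 numeral_2_eq_2)
  next
    case (Suc k)
    have fq: "(4 * q) ^ n * z = z * (4 * q) ^ n" for n
      by (rule power_commuting_commutes[OF fqz])
    have "(comm z ^^ (2 * Suc (Suc k))) x = comm z (comm z ((4 * q) ^ k * (4 * q * x - 2 * q' * z)))"
      using Suc by simp
    also have "\<dots> = (4 * q) ^ k * (4 * q) * comm z (comm z x)"
      by (simp only: lin[OF fq] ad3 lin[OF fqz]) (simp only: mult.assoc)
    also have "\<dots> = (4 * q) ^ Suc k * (4 * q * x - 2 * q' * z)"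
      by (simp only: ad2 power_Suc2)
    finally show ?case .
  qed
  obtain k where k: "m = Suc k" using m by (cases m) auto
  have "comm (z ^ p) D = (comm z ^^ p) D"
    by (rule comm_funpow_prime[symmetric]) (use p pm char in auto)
  also have "\<dots> = (comm z ^^ (2 * m)) (- x)"
    by (simp add: pm funpow_swap1 D)
  also have "\<dots> = - (comm z ^^ (2 * m)) x"
  proof -
    have "(comm z ^^ n) (- x) = - (comm z ^^ n) x" for n
      by (induction n) (simp_all add: comm_def)
    then show ?thesis .
  qed
  also have "\<dots> = - ((4 * q) ^ k * (4 * q * x - 2 * q' * z))"
    by (simp only: k even)
  finally have Z: "D * z ^ p = z ^ p * D + (4 * q) ^ k * (4 * q * x - 2 * q' * z)"
    by (simp add: comm_def algebra_simps)
  have Dz: "D * z = z * D + x" using D by (simp add: comm_def algebra_simps)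
  have Dqn: "D * q ^ n = q ^ n * D + of_nat n * q ^ (n - 1) * q'" for n
  proof (induction n)
    case (Suc n)
    have "D * q ^ Suc n = (q ^ n * D + of_nat n * q ^ (n - 1) * q') * q"
      by (simp only: power_Suc2 mult.assoc[symmetric] Suc)
    also have "\<dots> = q ^ n * (q * D + q') + of_nat n * (q ^ (n - 1) * q) * q'"
      by (simp add: distrib_right mult.assoc Dq q')
    also have "of_nat n * (q ^ (n - 1) * q) = of_nat n * q ^ n"
      by (cases n) (simp_all add: power_commutes)
    finally show ?case
      by (simp add: distrib_left distrib_right mult.assoc power_Suc2 add_ac del: power_Suc)
  qed simp
  have c4: "q * 4 ^ n = 4 ^ n * q" for n
    by (metis num power_commuting_commutes)
  have fp: "(4 * q) ^ n = 4 ^ n * q ^ n" for n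
    by (induction n) (simp_all add: mult.assoc, metis c4 mult.assoc)
  \<comment> \<open>As p = 2m + 1 is zero, 1 = -2m, and multiplying 2 * 4^k by it gives -4^m m = -m.
    The coefficient left by the iterated brackets thereby matches the factor m in the derivative of
    q^m.\<close>
  have half: "(4::'a) ^ k * 2 = - of_nat m"
  proof -
    have "2 * (of_nat m :: 'a) = -1" using char by (simp add: pm eq_neg_iff_add_eq_0 add.commute)
    have "(4::'a) ^ k * 2 = (4 ^ k * 2) * (- (2 * of_nat m))" by (simp add: \<open>2 * of_nat m = -1\<close>)
    also have "\<dots> = - (4 ^ m * of_nat m)"
      by (simp add: k power_Suc2 algebra_simps del: power_Suc)
    finally show ?thesis by (simp add: four)
  qed
  have "(4 * q) ^ k * (2 * q' * z) = (4 ^ k * 2) * (q ^ k * q' * z)"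
    by (simp only: fp) (metis num mult.assoc)
  then have "(4 * q) ^ k * (4 * q * x - 2 * q' * z) = (4 * q) ^ m * x - (4 ^ k * 2) * (q ^ k * q' * z)"
    by (simp only: right_diff_distrib) (simp only: k power_Suc2 mult.assoc)
  also have "\<dots> = q ^ m * x + of_nat m * (q ^ k * q' * z)"
    by (simp only: fp four half) simp
  finally have A: "D * z ^ p = z ^ p * D + q ^ m * x + of_nat m * (q ^ k * q' * z)"
    using Z by simp
  have B: "D * (q ^ m * z) = q ^ m * z * D + q ^ m * x + of_nat m * (q ^ k * q' * z)"
  proof -
    have "D * (q ^ m * z) = q ^ m * (D * z) + of_nat m * q ^ (m - 1) * q' * z"
      by (simp add: mult.assoc[symmetric] Dqn distrib_right)
    then show ?thesis by (simp add: Dz k distrib_left mult.assoc)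
  qed
  show ?thesis
    by (simp add: right_diff_distrib left_diff_distrib A B)
qed

section \<open>Relations of osp(1|2) from three generators\<close>

text \<open>Since e = E^2 and f = -F^2, these three relations carry all brackets. They are oriented
  as rewrite rules towards the order F, H, E, and their primed forms apply inside longer
  products.\<close>

locale osp_triple =
  fixes E F H :: "'a::ring_1"
  assumes EF: "E * F = H - F * E" and HF: "H * F = F * H - F" and EH: "E * H = H * E - E"
begin

lemma EF': "E * (F * x) = H * x - F * (E * x)"
  by (metis EF left_diff_distrib mult.assoc)

lemma HF': "H * (F * x) = F * (H * x) - F * x"
  by (metis HF left_diff_distrib mult.assoc)

lemma EH': "E * (H * x) = H * (E * x) - E * x"
  by (metis EH left_diff_distrib mult.assoc)

lemmas pbw = EF HF EH EF' HF' EH'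

lemma sl2_relations:
  "H * (E * E) - (E * E) * H = 2 * (E * E)"
  "H * (- (F * F)) - (- (F * F)) * H = - (2 * (- (F * F)))"
  "(E * E) * (- (F * F)) - (- (F * F)) * (E * E) = H"
  by (simp_all only: mult.assoc pbw right_diff_distrib left_diff_distrib mult_minus_left mult_minus_right mult_2)
    (simp_all add: algebra_simps)

end

section \<open>Baby Verma modules as modules of functions\<close>

lift_definition scal :: "'r::comm_ring_1 \<Rightarrow> (nat \<Rightarrow> 'r) endo" is "\<lambda>c g i. c * g i"
  by (simp add: fun_eq_iff algebra_simps)

lemma app_scal [simp]: "app (scal c) g i = c * g i"
  by (simp add: scal.rep_eq)

lemma scal_hom:
  "scal 0 = 0" "scal 1 = 1" "scal (a + b) = scal a + scal b" "scal (a - b) = scal a - scal b"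
  "scal (- a) = - scal a" "scal (a * b) = scal a * scal b"
  by (rule endo_eqI; simp add: fun_eq_iff algebra_simps)+

lemma scal_power: "scal (a ^ n) = scal a ^ n"
  by (induction n) (simp_all add: scal_hom)

lemma scal_of_nat: "scal (of_nat n) = of_nat n"
  by (induction n) (simp_all add: scal_hom)

lemma scal_numeral: "scal (numeral n) = numeral n"
  using scal_of_nat[of "numeral n"] by simp

text \<open>
  On the basis \<open>v\<^sub>i = F\<^sup>i v\<^sub>0\<close> of a baby Verma module of highest weight \<open>l\<close>, \<open>E v\<^sub>i\<close> is this coefficient
  times \<open>v\<^bsub>i-1\<^esub>\<close>. It has period \<open>2p\<close> in \<open>i\<close> and vanishes at \<open>0\<close>, so that \<open>E\<close> and \<open>F\<close> act on functions on
  all of \<open>\<nat>\<close> (a product of copies of the baby Verma module) as soon as \<open>F\<close> is cut at multiples of \<open>2p\<close>.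
\<close>

definition verma_coeff :: "'r::comm_ring_1 \<Rightarrow> nat \<Rightarrow> 'r" where
  "verma_coeff l n = (if even n then - of_nat (n div 2) else l - of_nat (n div 2))"

text \<open>A function g stands for the formal sum of the \<open>g i\<close> times v_i, so the
  coefficient of E g at i comes from v_(i+1).\<close>

lift_definition verma_E :: "'r::comm_ring_1 \<Rightarrow> (nat \<Rightarrow> 'r) endo" is
  "\<lambda>l g i. verma_coeff l (Suc i) * g (Suc i)"
  by (simp add: fun_eq_iff algebra_simps)

text \<open>The cut includes i = 0, so the truncated difference \<open>0 - 1\<close> is never
  read.\<close>

lift_definition verma_F :: "(nat \<Rightarrow> 'r::comm_ring_1) endo" is
  "\<lambda>g i. if 2 * CHAR('r) dvd i then 0 else g (i - 1)"
  by (simp add: fun_eq_iff)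

lift_definition verma_H :: "'r::comm_ring_1 \<Rightarrow> (nat \<Rightarrow> 'r) endo" is
  "\<lambda>l g i. (l - of_nat i) * g i"
  by (simp add: fun_eq_iff algebra_simps)

lemma app_verma [simp]:
  "app (verma_E l) g i = verma_coeff l (Suc i) * g (Suc i)"
  "app (verma_F :: (nat \<Rightarrow> 'r::comm_ring_1) endo) g i = (if 2 * CHAR('r) dvd i then 0 else g (i - 1))"
  "app (verma_H l) g i = (l - of_nat i) * g i"
  by (simp_all add: verma_E.rep_eq verma_F.rep_eq verma_H.rep_eq)

lemma verma_coeff_period:
  assumes "2 * CHAR('r::comm_ring_1) dvd n"
  shows "verma_coeff (l::'r) n = 0"
proof -
  obtain k where k: "n = 2 * (CHAR('r) * k)" using assms unfolding dvd_def by (auto simp: mult.assoc)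
  show ?thesis by (simp add: verma_coeff_def k)
qed

text \<open>This is H = EF + FE evaluated on v_n, which determines the coefficients from their value
  at 0.\<close>

lemma verma_coeff_Suc: "verma_coeff l (Suc n) = l - of_nat n - verma_coeff l n"
proof (cases "even n")
  case True
  then obtain k where "n = 2 * k" by (auto elim: evenE)
  then show ?thesis by (simp add: verma_coeff_def)
next
  case False
  then obtain k where "n = Suc (2 * k)" by (auto elim: oddE)
  then show ?thesis by (simp add: verma_coeff_def)
qed

interpretation verma: osp_triple "verma_E l" verma_F "verma_H l" for l :: "'r::comm_ring_1"
proof
  show "verma_E l * verma_F = verma_H l - verma_F * verma_E l"
  proof (intro endo_eqI ext)
    fix g :: "nat \<Rightarrow> 'r" and i
    \<comment> \<open>If 2p divides \<open>Suc i\<close>, then F is cut there, but the coefficient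
      of E vanishes as well, so the formula has no exception.\<close>
    have "app (verma_E l * verma_F) g i = verma_coeff l (Suc i) * g i"
      using verma_coeff_period[of "Suc i" l] by auto
    moreover have "app (verma_F * verma_E l) g i = verma_coeff l i * g i"
      using verma_coeff_period[of i l] by (cases i) auto
    ultimately show "app (verma_E l * verma_F) g i = app (verma_H l - verma_F * verma_E l) g i"
      by (simp add: verma_coeff_Suc left_diff_distrib)
  qed
  show "verma_H l * verma_F = verma_F * verma_H l - verma_F"
  proof (intro endo_eqI ext)
    fix g :: "nat \<Rightarrow> 'r" and i
    show "app (verma_H l * verma_F) g i = app (verma_F * verma_H l - verma_F) g i"
      by (cases i) (auto simp: algebra_simps)
  qed
  show "verma_E l * verma_H l = verma_H l * verma_E l - verma_E l"
    by (intro endo_eqI ext) (simp add: algebra_simps)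
qed

lemma scal_commute:
  "verma_E l * scal c = scal c * verma_E l" "verma_F * scal c = scal c * verma_F"
  "verma_H l * scal c = scal c * verma_H l" "scal d * scal c = scal c * scal d"
  by (intro endo_eqI ext; simp add: algebra_simps)+

lemma commute_mult:
  fixes x y d :: "'a::ring_1"
  assumes "x * d = d * x" "y * d = d * y"
  shows "(x * y) * d = d * (x * y)"
  using assms by (metis mult.assoc)

text \<open>The operator of the even element a e + b h + c f. The coefficients may be polynomials in
  a parameter, and this is how lines of even elements are treated.\<close>

definition verma_lin :: "'r::comm_ring_1 \<Rightarrow> 'r \<Rightarrow> 'r \<Rightarrow> 'r \<Rightarrow> (nat \<Rightarrow> 'r) endo" where
  "verma_lin l a b c = scal a * (verma_E l * verma_E l) + scal b * verma_H l + scal c * (- (verma_F * verma_F))"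

lemma verma_lin_commute: "verma_lin l a b c * scal d = scal d * verma_lin l a b c"
proof -
  show ?thesis
    by (simp only: verma_lin_def distrib_left distrib_right mult_minus_left mult_minus_right
        commute_mult scal_commute)
qed

lemma comm_verma_lin:
  "comm (verma_lin l a b c) (verma_lin l a' b' c') =
    verma_lin l (2 * (b * a' - a * b')) (a * c' - c * a') (2 * (c * b' - b * c'))"
proof -
  define e h f where "e = verma_E l * verma_E l" and "h = verma_H l" and "f = - (verma_F * verma_F :: (nat \<Rightarrow> 'a) endo)"
  have rel: "h * e = e * h + 2 * e" "h * f = f * h - 2 * f" "e * f = f * e + h"
    using verma.sl2_relations[of l] by (simp_all add: e_def h_def f_def algebra_simps)
  have sc: "e * scal x = scal x * e" "h * scal x = scal x * h" "f * scal x = scal x * f" for x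
    unfolding e_def h_def f_def mult_minus_left mult_minus_right
    by (simp_all only: scal_commute commute_mult[OF scal_commute(1) scal_commute(1)]
        commute_mult[OF scal_commute(2) scal_commute(2)])
  have bil: "comm (scal x * u) (scal y * v) = scal (x * y) * comm u v"
    if u: "u * scal y = scal y * u" and v: "v * scal x = scal x * v" for x y u v
  proof -
    have "(scal x * u) * (scal y * v) = scal x * (u * scal y) * v" by (simp only: mult.assoc)
    also have "\<dots> = scal (x * y) * (u * v)" by (simp only: u scal_hom mult.assoc)
    finally have 1: "(scal x * u) * (scal y * v) = scal (x * y) * (u * v)" .
    have "(scal y * v) * (scal x * u) = scal y * (v * scal x) * u" by (simp only: mult.assoc)
    also have "\<dots> = scal (y * x) * (v * u)" by (simp only: v scal_hom mult.assoc)
    finally show ?thesis using 1 by (simp only: comm_def mult.commute[of y x] right_diff_distrib)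
  qed
  have lin: "comm (u + v) w = comm u w + comm v w" "comm w (u + v) = comm w u + comm w v"
    for u v w :: "(nat \<Rightarrow> 'a) endo"
    by (simp_all add: comm_def distrib_left distrib_right)
  have c0: "comm u u = 0" for u :: "(nat \<Rightarrow> 'a) endo" by (simp add: comm_def)
  have cs: "comm h e = scal 2 * e" "comm e h = scal (- 2) * e" "comm h f = scal (- 2) * f"
    "comm f h = scal 2 * f" "comm e f = h" "comm f e = - h"
    by (simp_all add: comm_def rel scal_hom scal_numeral)
  have "comm (verma_lin l a b c) (verma_lin l a' b' c') =
     scal (a * b') * (scal (- 2) * e) + scal (a * c') * h + scal (b * a') * (scal 2 * e) +
     scal (b * c') * (scal (- 2) * f) + scal (c * a') * (- h) + scal (c * b') * (scal 2 * f)"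
    unfolding verma_lin_def e_def[symmetric] h_def[symmetric] f_def[symmetric] lin
    by (simp add: bil sc c0 cs)
  also have "\<dots> = scal (2 * (b * a' - a * b')) * e + scal (a * c' - c * a') * h + scal (2 * (c * b' - b * c')) * f"
  proof (rule endo_eqI, rule ext)
    fix g i

    show "app (scal (a * b') * (scal (- 2) * e) + scal (a * c') * h + scal (b * a') * (scal 2 * e) +
        scal (b * c') * (scal (- 2) * f) + scal (c * a') * (- h) + scal (c * b') * (scal 2 * f)) g i =
      app (scal (2 * (b * a' - a * b')) * e + scal (a * c' - c * a') * h + scal (2 * (c * b' - b * c')) * f) g i"
      by (simp add: algebra_simps)
  qed
  also have "\<dots> = verma_lin l (2 * (b * a' - a * b')) (a * c' - c * a') (2 * (c * b' - b * c'))"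
    by (simp only: verma_lin_def e_def h_def f_def)
  finally show ?thesis .
qed

lemma verma_lin_linear:
  "verma_lin l (a + a') (b + b') (c + c') = verma_lin l a b c + verma_lin l a' b' c'"
  "verma_lin l (a - a') (b - b') (c - c') = verma_lin l a b c - verma_lin l a' b' c'"
  "verma_lin l (d * a) (d * b) (d * c) = scal d * verma_lin l a b c"
  by (simp_all only: verma_lin_def scal_hom mult.assoc distrib_left distrib_right left_diff_distrib)
    simp_all

lemma of_nat_endo_CHAR: "(of_nat CHAR('r::comm_ring_1) :: (nat \<Rightarrow> 'r) endo) = 0"
  using scal_of_nat[of "CHAR('r)", where ?'a = 'r] by (simp add: scal_hom)

text \<open>4^m = 2^(p-1), so Fermat's little theorem applies, carried over to a ring in which p is
  zero.\<close>

lemma four_power: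
  assumes "prime p" and pm: "p = 2 * m + 1" and char: "(of_nat p :: 'a::ring_1) = 0"
  shows "(4::'a) ^ m = 1"
proof -
  have "\<not> p dvd 2"
  proof
    assume "p dvd 2"
    then have "p \<le> 2" by (auto dest: dvd_imp_le)
    then show False using pm assms(1) by (cases m) auto
  qed
  then have "[2 ^ (p - 1) = 1] (mod p)" using assms(1) by (rule fermat_theorem[rotated])
  then have "[4 ^ m = 1] (mod p)" by (simp add: pm power_mult)
  then have "p dvd 4 ^ m - 1" by (simp add: cong_altdef_nat)
  then obtain k where "4 ^ m - 1 = p * k" by (auto simp: dvd_def)
  then have "4 ^ m = p * k + 1" by (metis le_add_diff_inverse2 one_le_numeral one_le_power)
  then have "(of_nat (4 ^ m) :: 'a) = of_nat (p * k + 1)" by simp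
  then show ?thesis using char by simp
qed

section \<open>Differentiation along a line of even elements\<close>

lift_definition diff_op :: "(nat \<Rightarrow> 'k::field poly) endo" is "\<lambda>g i. pderiv (g i)"
  by (simp add: fun_eq_iff pderiv_add)

lemma app_diff_op [simp]: "app diff_op g i = pderiv (g i)"
  by (simp add: diff_op.rep_eq)

lemma verma_coeff_pCons: "verma_coeff [:l:] n = [:verma_coeff l n:]"
  by (simp add: verma_coeff_def of_nat_poly)

lemma diff_op_scal: "diff_op * scal q = scal q * diff_op + scal (pderiv q)"
  by (rule endo_eqI, rule ext) (simp add: pderiv_mult)

text \<open>The highest weight \<open>[:l:]\<close> is a constant polynomial, so the coefficients of
  these operators have derivative zero.\<close>

lemma diff_op_verma:
  fixes l :: "'k::field"
  shows "diff_op * verma_E [:l:] = verma_E [:l:] * diff_op"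
    "diff_op * verma_F = (verma_F * diff_op :: (nat \<Rightarrow> 'k poly) endo)"
  "diff_op * verma_H [:l:] = verma_H [:l:] * diff_op"
proof -
  show "diff_op * verma_E [:l:] = verma_E [:l:] * diff_op"
    by (rule endo_eqI, rule ext) (simp add: verma_coeff_pCons pderiv_smult)
  show "diff_op * verma_F = verma_F * (diff_op :: (nat \<Rightarrow> 'k poly) endo)"
    by (rule endo_eqI, rule ext) simp
  show "diff_op * verma_H [:l:] = verma_H [:l:] * diff_op"
  proof (rule endo_eqI, rule ext)
    fix x :: "nat \<Rightarrow> 'k poly" and i
    have "[:l:] - of_nat i = [:l - of_nat i:]" by (simp add: of_nat_poly)
    then show "app (diff_op * verma_H [:l:]) x i = app (verma_H [:l:] * diff_op) x i"
      by (simp add: pderiv_smult)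
  qed
qed

lemma comm_lin_diff_op:
  "comm (verma_lin [:l:] a b c) diff_op = - verma_lin [:l:] (pderiv a) (pderiv b) (pderiv c)"
proof -
  have 2: "diff_op * (x * y) = (x * y) * diff_op" if "diff_op * x = x * diff_op" "diff_op * y = y * diff_op"
    for x y :: "(nat \<Rightarrow> 'a poly) endo"
    using that by (metis mult.assoc)
  have 1: "diff_op * (scal q * x) = (scal q * x) * diff_op + scal (pderiv q) * x" if "diff_op * x = x * diff_op"
    for x :: "(nat \<Rightarrow> 'a poly) endo" and q
    by (simp only: mult.assoc[symmetric] diff_op_scal distrib_right) (simp only: mult.assoc that)
  note d = 2[OF diff_op_verma(1) diff_op_verma(1)] diff_op_verma(3) 2[OF diff_op_verma(2) diff_op_verma(2)]
  have "diff_op * verma_lin [:l:] a b c = verma_lin [:l:] a b c * diff_op + verma_lin [:l:] (pderiv a) (pderiv b) (pderiv c)"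
    unfolding verma_lin_def distrib_left distrib_right mult_minus_right mult_minus_left
      1[OF d(1)] 1[OF d(2)] 1[OF d(3)] by (simp add: algebra_simps)
  then show ?thesis by (simp add: comm_def)
qed

text \<open>Coordinate form of (ad z)^2 x = 4 q x - 2 q' z in sl2, where q = b^2 + ac is minus the
  determinant of z and q' is its derivative in the direction x.\<close>

lemma ad_square_coords:
  fixes a b c a' b' c' :: "'r::comm_ring_1"
  shows "2 * (b * (2 * (b * a' - a * b')) - a * (a * c' - c * a')) =
      4 * (b\<^sup>2 + a * c) * a' - 2 * (2 * b * b' + a' * c + a * c') * a"
    "a * (2 * (c * b' - b * c')) - c * (2 * (b * a' - a * b')) =
      4 * (b\<^sup>2 + a * c) * b' - 2 * (2 * b * b' + a' * c + a * c') * b"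
    "2 * (c * (a * c' - c * a') - b * (2 * (c * b' - b * c'))) =
      4 * (b\<^sup>2 + a * c) * c' - 2 * (2 * b * b' + a' * c + a * c') * c"
  by (simp add: power2_eq_square algebra_simps)+

text \<open>The abstract formula for an element whose coordinates depend on the parameter. Applied
  to a vector that is constant in the parameter, the commutation says that its image has derivative
  zero.\<close>

lemma diff_op_commutes:
  fixes l :: "'k::field" and a b c :: "'k poly"
  assumes p: "prime CHAR('k)" and pm: "CHAR('k) = 2 * m + 1"
  defines "z \<equiv> verma_lin [:l:] a b c" and "q \<equiv> b ^ 2 + a * c"
  shows "diff_op * (z ^ CHAR('k) - scal (q ^ m) * z) = (z ^ CHAR('k) - scal (q ^ m) * z) * diff_op"
  unfolding scal_power
proof (rule derivation_commutes[OF p pm])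
  let ?a = "pderiv a" and ?b = "pderiv b" and ?c = "pderiv c"
  let ?x = "verma_lin [:l:] ?a ?b ?c"
  let ?q' = "scal (pderiv q)"
  show char: "(of_nat CHAR('k) :: (nat \<Rightarrow> 'k poly) endo) = 0"
    using of_nat_endo_CHAR[where 'r = "'k poly"] by simp
  show "comm z diff_op = - ?x" by (simp add: z_def comm_lin_diff_op)
  have q': "pderiv q = 2 * b * ?b + ?a * c + a * ?c"
    by (simp add: q_def power2_eq_square pderiv_add pderiv_mult algebra_simps)
  have "comm z (comm z ?x) = verma_lin [:l:] (4 * q * ?a - 2 * pderiv q * a) (4 * q * ?b - 2 * pderiv q * b)
      (4 * q * ?c - 2 * pderiv q * c)"
    unfolding z_def comm_verma_lin q' unfolding q_def
    by (simp only: ad_square_coords)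
  also have "\<dots> = 4 * scal q * ?x - 2 * ?q' * z"
    by (simp only: z_def verma_lin_linear scal_hom scal_numeral)
  finally show "comm z (comm z ?x) = 4 * scal q * ?x - 2 * ?q' * z" .
  show "scal q * z = z * scal q" "scal q * ?x = ?x * scal q" "?q' * z = z * ?q'" "?q' * scal q = scal q * ?q'"
    unfolding z_def by (simp_all only: verma_lin_commute) (rule scal_commute(4))
  show "diff_op * scal q = scal q * diff_op + ?q'" by (rule diff_op_scal)
  show "(4 :: (nat \<Rightarrow> 'k poly) endo) ^ m = 1" by (rule four_power[OF p pm char])
qed

lemma coeff_app_verma:
  fixes l :: "'k::field"
  shows "Polynomial.coeff (app (verma_E [:l:]) u i) n = app (verma_E l) (\<lambda>j. Polynomial.coeff (u j) n) i"
    "Polynomial.coeff (app verma_F u i) n = app (verma_F :: (nat \<Rightarrow> 'k) endo) (\<lambda>j. Polynomial.coeff (u j) n) i"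
    "Polynomial.coeff (app (verma_H [:l:]) u i) n = app (verma_H l) (\<lambda>j. Polynomial.coeff (u j) n) i"
proof -
  show "Polynomial.coeff (app (verma_E [:l:]) u i) n = app (verma_E l) (\<lambda>j. Polynomial.coeff (u j) n) i"
    by (simp add: verma_coeff_pCons)
  show "Polynomial.coeff (app verma_F u i) n = app (verma_F :: (nat \<Rightarrow> 'k) endo) (\<lambda>j. Polynomial.coeff (u j) n) i"
    by simp
  have "[:l:] - of_nat i = [:l - of_nat i:]" by (simp add: of_nat_poly)
  then show "Polynomial.coeff (app (verma_H [:l:]) u i) n = app (verma_H l) (\<lambda>j. Polynomial.coeff (u j) n) i"
    by simp
qed

lemma poly_app_verma:
  fixes l :: "'k::field"
  shows "poly (app (verma_E [:l:]) u i) t = app (verma_E l) (\<lambda>j. poly (u j) t) i"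
    "poly (app verma_F u i) t = app (verma_F :: (nat \<Rightarrow> 'k) endo) (\<lambda>j. poly (u j) t) i"
    "poly (app (verma_H [:l:]) u i) t = app (verma_H l) (\<lambda>j. poly (u j) t) i"
  by (simp_all add: verma_coeff_pCons)

lemma app_verma_lin:
  "app (verma_lin l a b c) u i =
    a * app (verma_E l) (app (verma_E l) u) i + b * app (verma_H l) u i - c * app verma_F (app verma_F u) i"
  by (simp add: verma_lin_def algebra_simps)

text \<open>The operator has the form z0 + t z1 on polynomials in t: degree n of the result receives
  z0 from degree n and z1 from degree n - 1.\<close>

lemma coeff_app_verma_lin:
  fixes l :: "'k::field"
  shows "Polynomial.coeff (app (verma_lin [:l:] [:a, a':] [:b, b':] [:c, c':]) u i) n =
    app (verma_lin l a b c) (\<lambda>j. Polynomial.coeff (u j) n) i +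
    (case n of 0 \<Rightarrow> 0 | Suc n' \<Rightarrow> app (verma_lin l a' b' c') (\<lambda>j. Polynomial.coeff (u j) n') i)"
  by (cases n) (simp_all only: app_verma_lin coeff_add coeff_diff mult_pCons_left coeff_smult coeff_pCons
      nat.case coeff_app_verma mult_zero_left coeff_0 add_0_right, simp_all split: nat.split)

lemma poly_app_verma_lin:
  fixes l :: "'k::field"
  shows "poly (app (verma_lin [:l:] [:a, a':] [:b, b':] [:c, c':]) u i) 1 =
    app (verma_lin l (a + a') (b + b') (c + c')) (\<lambda>j. poly (u j) 1) i"
  by (simp only: app_verma_lin poly_add poly_diff poly_mult poly_app_verma) simp

text \<open>Let y be the added element and z the line x + t y. Then z^p - q^m z has derivative zero
  in t. Its degree is below p, because y^p = 0 removes the top coefficient of z^p and q(y) = 0 makes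
  q linear in t. A polynomial of degree below p with derivative zero is constant, so its values at t
  = 0 and t = 1 agree.\<close>

lemma verma_lin_shift:
  fixes l a b c a' b' c' :: "'k::field"
  assumes p: "prime CHAR('k)" and pm: "CHAR('k) = 2 * m + 1"
    and nil: "b' ^ 2 + a' * c' = 0" "verma_lin l a' b' c' ^ CHAR('k) = 0"
  defines "Z \<equiv> \<lambda>a b c. verma_lin l a b c ^ CHAR('k) - scal ((b ^ 2 + a * c) ^ m) * verma_lin l a b c"
  shows "Z (a + a') (b + b') (c + c') = Z a b c"
proof (rule endo_eqI)
  fix g :: "nat \<Rightarrow> 'k"
  let ?p = "CHAR('k)"
  define A B C where "A = [:a, a':]" and "B = [:b, b':]" and "C = [:c, c':]"
  define z Q where "z = verma_lin [:l:] A B C" and "Q = B ^ 2 + A * C"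
  define u where "u = (\<lambda>i. [:g i:])"
  define h where "h = app (z ^ ?p - scal (Q ^ m) * z) u"
  have cz: "Polynomial.coeff (app z v i) n = app (verma_lin l a b c) (\<lambda>j. Polynomial.coeff (v j) n) i +
    (case n of 0 \<Rightarrow> 0 | Suc n' \<Rightarrow> app (verma_lin l a' b' c') (\<lambda>j. Polynomial.coeff (v j) n') i)" for v i n
    by (simp add: z_def A_def B_def C_def coeff_app_verma_lin)
  have m: "Suc m < ?p" "m \<noteq> 0" using p pm by (cases m; simp)+
  have z0: "(\<lambda>i. 0) = (0 :: nat \<Rightarrow> 'k)" by (simp add: fun_eq_iff)
  \<comment> \<open>The power z^k has degree at most k in t, with the k-th power of the added
    element on top; for k = p that coefficient vanishes by \<open>nil\<close>.\<close>
  have pow: "(\<forall>n>k. (\<lambda>i. Polynomial.coeff (app (z ^ k) u i) n) = 0) \<and>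
      (\<lambda>i. Polynomial.coeff (app (z ^ k) u i) k) = app (verma_lin l a' b' c' ^ k) g" for k
  proof (induction k)
    case 0
    then show ?case by (auto simp: u_def fun_eq_iff coeff_pCons split: nat.splits)
  next
    case (Suc k)
    then show ?case
      by (auto simp: cz Suc z0 fun_eq_iff split: nat.splits)
  qed
  have pow0: "(\<lambda>i. Polynomial.coeff (app (z ^ k) u i) 0) = app (verma_lin l a b c ^ k) g" for k
    by (induction k) (simp_all add: cz u_def fun_eq_iff)
  have pow1: "(\<lambda>i. poly (app (z ^ k) u i) 1) = app (verma_lin l (a + a') (b + b') (c + c') ^ k) g" for k
    by (induction k) (simp_all add: poly_app_verma_lin z_def A_def B_def C_def u_def fun_eq_iff)
  have Q: "Q = [:b ^ 2 + a * c, 2 * b * b' + a * c' + a' * c:]"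
    using nil(1) by (simp add: Q_def A_def B_def C_def power2_eq_square algebra_simps)
  have degQ: "Polynomial.degree (Q ^ m) \<le> m"
  proof -
    have "Polynomial.degree Q \<le> 1" by (simp add: Q)
    then show ?thesis using degree_power_le[of Q m] by (metis le_trans mult_le_mono1 mult_1)
  qed
  have "(\<lambda>i. Polynomial.coeff (app z u i) n) = 0" if "n > 1" for n
    using pow[of 1] that by simp
  then have degz: "Polynomial.degree (app z u i) \<le> 1" for i
    by (intro degree_le) (auto simp: fun_eq_iff)
  have high: "Polynomial.coeff (h i) n = 0" if "n \<ge> ?p" for i n
  proof -
    have "Polynomial.degree (Q ^ m * app z u i) \<le> Suc m"
      using degree_mult_le[of "Q ^ m" "app z u i"] degQ degz[of i] by linarith
    then have 1: "Polynomial.coeff (Q ^ m * app z u i) n = 0" using that m by (intro coeff_eq_0) linarith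
    have "(\<lambda>i. Polynomial.coeff (app (z ^ ?p) u i) n) = 0"
    proof (cases "n = ?p")
      case True
      then show ?thesis using pow[of ?p] nil by simp
    next
      case False
      then show ?thesis using pow[of ?p] that by simp
    qed
    then have "Polynomial.coeff (app (z ^ ?p) u i) n = 0" by (simp add: fun_eq_iff)
    then show ?thesis by (simp add: h_def 1)
  qed
  have "app diff_op h = app (z ^ ?p - scal (Q ^ m) * z) (app diff_op u)"
    using diff_op_commutes[OF p pm, of l A B C]
    unfolding h_def z_def[symmetric] Q_def[symmetric] app_ring(6)[symmetric] by (simp only:)
  also have "app diff_op u = 0" by (simp add: u_def fun_eq_iff)
  finally have dh: "app diff_op h = 0" by (simp only: app_0)
  have "pderiv (h i) = 0" for i using fun_cong[OF dh, of i] by simp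
  \<comment> \<open>The derivative being zero settles 0 < n < p, where n is invertible; all larger n
    are covered by \<open>high\<close>.\<close>
  have low: "Polynomial.coeff (h i) n = 0" if nz: "n \<noteq> 0" for i n
  proof (cases "n < ?p")
    case True
    obtain k where k: "n = Suc k" using nz by (cases n) auto
    have "of_nat (Suc k) * Polynomial.coeff (h i) (Suc k) = 0"
      using \<open>pderiv (h i) = 0\<close> by (metis coeff_pderiv coeff_0)
    moreover have "(of_nat (Suc k) :: 'k) \<noteq> 0"
      using True k by (auto simp: of_nat_eq_0_iff_char_dvd dest: dvd_imp_le simp del: of_nat_Suc)
    ultimately show ?thesis using k by simp
  qed (simp add: high)
  have const: "poly (h i) 1 = Polynomial.coeff (h i) 0" for i
  proof -
    have "h i = [:Polynomial.coeff (h i) 0:]"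
      by (rule poly_eqI) (auto simp: coeff_pCons low split: nat.splits)
    then show ?thesis by (metis poly_pCons poly_0 mult_zero_right add_0_right)
  qed
  have "app (Z (a + a') (b + b') (c + c')) g = (\<lambda>i. poly (h i) 1)"
  proof
    fix i
    have "poly Q 1 = (b + b') ^ 2 + (a + a') * (c + c')"
      by (simp add: Q_def A_def B_def C_def power2_eq_square algebra_simps)
    then show "app (Z (a + a') (b + b') (c + c')) g i = poly (h i) 1"
      using fun_cong[OF pow1[of ?p], of i] fun_cong[OF pow1[of 1], of i]
      by (simp add: Z_def h_def poly_power)
  qed
  also have "\<dots> = (\<lambda>i. Polynomial.coeff (h i) 0)" by (simp add: const)
  also have "\<dots> = app (Z a b c) g"
  proof
    fix i
    have "Polynomial.coeff (Q ^ m) 0 = (b ^ 2 + a * c) ^ m"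
      by (simp add: coeff_0_power Q)
    then show "Polynomial.coeff (h i) 0 = app (Z a b c) g i"
      using fun_cong[OF pow0[of ?p], of i] fun_cong[OF pow0[of 1], of i]
      by (simp add: Z_def h_def coeff_mult)
  qed
  finally show "app (Z (a + a') (b + b') (c + c')) g = app (Z a b c) g" .
qed

section \<open>Powers of the generators and of even elements\<close>

lemma verma_E_power: "app (verma_E l ^ k) g i = (\<Prod>j=1..k. verma_coeff l (i + j)) * g (i + k)"
proof (induction k arbitrary: g i)
  case (Suc k)
  have "app (verma_E l ^ Suc k) g i = app (verma_E l ^ k) (app (verma_E l) g) i"
    by (simp add: power_Suc2 del: power_Suc)
  also have "\<dots> = (\<Prod>j=1..k. verma_coeff l (i + j)) * (verma_coeff l (i + Suc k) * g (i + Suc k))"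
    by (simp add: Suc)
  finally show ?case by (simp add: mult.assoc)
qed simp

text \<open>F^k shifts by k places and lets nothing cross a multiple of 2p, hence the remainder in
  the condition.\<close>

lemma verma_F_power:
  "app (verma_F ^ k :: (nat \<Rightarrow> 'r::comm_ring_1) endo) g i =
    (if k \<le> i mod (2 * CHAR('r)) \<or> CHAR('r) = 0 \<and> k \<le> i then g (i - k) else 0)"
proof (induction k arbitrary: i)
  case (Suc k)
  let ?N = "2 * CHAR('r)"
  show ?case
  proof (cases "?N dvd i")
    case True
    then show ?thesis by (auto simp: mod_eq_0_iff_dvd)
  next
    case False
    then obtain j where j: "i = Suc j" by (cases i) auto
    have "Suc j mod ?N = Suc (j mod ?N)"
      using False j by (auto simp: mod_Suc mod_eq_0_iff_dvd[symmetric])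
    then show ?thesis using False by (auto simp: Suc j)
  qed
qed auto

text \<open>Among 2p consecutive indices one is a multiple of 2p, and there the coefficient
  vanishes.\<close>

lemma verma_E_nilpotent:
  assumes "CHAR('r::comm_ring_1) > 0"
  shows "verma_E (l::'r) ^ (2 * CHAR('r)) = 0"
proof (rule endo_eqI, rule ext)
  fix g :: "nat \<Rightarrow> 'r" and i
  let ?N = "2 * CHAR('r)"
  define j where "j = ?N - i mod ?N"
  have "i mod ?N < ?N" using assms by simp
  then have j: "j \<in> {1..?N}" by (simp add: j_def)
  have "i + j = ?N * (i div ?N) + (i mod ?N + j)"
    by (simp only: add.assoc[symmetric] mult_div_mod_eq)
  also have "i mod ?N + j = ?N"
    using \<open>i mod ?N < ?N\<close> by (simp add: j_def)
  finally have "?N dvd i + j" by simp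
  then have "verma_coeff l (i + j) = 0" by (rule verma_coeff_period)
  then have "(\<Prod>j=1..?N. verma_coeff l (i + j)) = 0" using j by (intro prod_zero) auto
  then show "app (verma_E l ^ ?N) g i = app 0 g i" by (simp only: verma_E_power) simp
qed

lemma verma_F_nilpotent:
  assumes "CHAR('r::comm_ring_1) > 0"
  shows "(verma_F :: (nat \<Rightarrow> 'r) endo) ^ (2 * CHAR('r)) = 0"
proof (rule endo_eqI, rule ext)
  fix g :: "nat \<Rightarrow> 'r" and i
  have "i mod (2 * CHAR('r)) < 2 * CHAR('r)" using assms by simp
  then have "\<not> (2 * CHAR('r) \<le> i mod (2 * CHAR('r)) \<or> CHAR('r) = 0 \<and> 2 * CHAR('r) \<le> i)"
    using assms by linarith
  then show "app (verma_F ^ (2 * CHAR('r))) g i = app 0 g i" by (simp only: verma_F_power if_False) simp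
qed

lemma of_nat_power_CHAR:
  assumes "prime CHAR('r::comm_semiring_1)"
  shows "(of_nat n :: 'r) ^ CHAR('r) = of_nat n"
  using assms by (induction n) (auto simp: freshmans_dream power_0_left dest: prime_gt_0_nat)

lemma verma_H_power: "app (verma_H l ^ n) g i = (l - of_nat i) ^ n * g i"
  by (induction n) simp_all

lemma diff_power_CHAR:
  fixes x y :: "'r::comm_ring_1"
  assumes "prime CHAR('r)"
  shows "(x - y) ^ CHAR('r) = x ^ CHAR('r) - y ^ CHAR('r)"
  using freshmans_dream[OF assms refl, of "x - y" y] by simp

text \<open>The multiples of e and of f are nilpotent and isotropic for q, so
  \<open>verma_lin_shift\<close> removes first c f and then a e. For the remaining b h one has
  (b^2)^m b = b^p, and h^p - h is the scalar l^p - l because i^p = i for natural i.\<close>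

theorem verma_lin_power:
  fixes l a b c :: "'k::field"
  assumes p: "prime CHAR('k)" and odd: "odd CHAR('k)"
  shows "verma_lin l a b c ^ CHAR('k) =
    scal ((b ^ 2 + a * c) ^ ((CHAR('k) - 1) div 2)) * verma_lin l a b c +
    scal (b ^ CHAR('k) * (l ^ CHAR('k) - l))"
proof -
  let ?p = "CHAR('k)"
  define m where "m = (?p - 1) div 2"
  have pm: "?p = 2 * m + 1" using odd by (auto simp: m_def elim: oddE)
  have m: "m \<noteq> 0" using p pm by (cases m) auto
  define Z where "Z a b c = verma_lin l a b c ^ ?p - scal ((b ^ 2 + a * c) ^ m) * verma_lin l a b c" for a b c
  have cp: "CHAR('k) > 0" using p by (simp add: prime_gt_0_nat)
  have com: "(scal x * y) ^ n = scal (x ^ n) * y ^ n" if "y * scal x = scal x * y"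
    for x :: 'k and y n
  proof (induction n)
    case (Suc n)
    have "y * scal (x ^ n) = scal (x ^ n) * y"
      unfolding scal_power by (metis that power_commuting_commutes)
    then have "(scal x * y) * (scal (x ^ n) * y ^ n) = scal x * scal (x ^ n) * (y * y ^ n)"
      by (metis mult.assoc)
    then show ?case by (simp add: Suc scal_hom)
  qed (simp add: scal_hom)
  have 2: "(x * y) * scal d = scal d * (x * y)" if "x * scal d = scal d * x" "y * scal d = scal d * y"
    for x y :: "(nat \<Rightarrow> 'k) endo" and d
    using that by (metis mult.assoc)
  have e: "verma_lin l a 0 0 ^ ?p = 0"
  proof -
    have "verma_lin l a 0 0 = scal a * (verma_E l * verma_E l)" by (simp add: verma_lin_def scal_hom)
    moreover have "(verma_E l * verma_E l) ^ ?p = 0"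
      using verma_E_nilpotent[OF cp, of l] by (simp add: power_mult power2_eq_square)
    ultimately show ?thesis by (simp add: com[OF 2] scal_commute)
  qed
  have f: "verma_lin l 0 0 c ^ ?p = 0"
  proof -
    have "verma_lin l 0 0 c = scal (- c) * (verma_F * verma_F)" by (simp add: verma_lin_def scal_hom)
    moreover have "(verma_F * verma_F :: (nat \<Rightarrow> 'k) endo) ^ ?p = 0"
      using verma_F_nilpotent[OF cp] by (simp add: power_mult power2_eq_square)
    ultimately show ?thesis by (simp add: com[OF 2] scal_commute)
  qed
  have "Z a b c = Z a b 0"
    using verma_lin_shift[OF p pm _ f, of a b 0] by (simp add: Z_def)
  also have "\<dots> = Z 0 b 0"
    using verma_lin_shift[OF p pm _ e, of 0 b 0] by (simp add: Z_def)
  also have "\<dots> = scal (b ^ ?p * (l ^ ?p - l))"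
  proof -
    have "verma_lin l 0 b 0 = scal b * verma_H l" by (simp add: verma_lin_def scal_hom)
    moreover have "verma_H l ^ ?p - verma_H l = scal (l ^ ?p - l)"
      by (rule endo_eqI, rule ext)
        (simp add: verma_H_power diff_power_CHAR[OF p] of_nat_power_CHAR[OF p] algebra_simps)
    moreover have "scal ((b ^ 2 + 0 * 0) ^ m) * (scal b * verma_H l) = scal (b ^ ?p) * verma_H l"
      by (simp add: pm power_mult mult.assoc[symmetric] flip: scal_hom(6)) (simp add: mult.commute)
    ultimately show ?thesis
      by (simp only: Z_def com[OF scal_commute(3)] scal_hom(6) right_diff_distrib[symmetric])
  qed
  finally show ?thesis
    unfolding m_def[symmetric] by (simp only: Z_def diff_eq_eq add.commute)
qed

section \<open>The tensor algebra and its quotients\<close>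

lemma carrier_tensor_algebra: "a \<in> carrier (tensor_algebra S) \<longleftrightarrow> (\<forall>w\<in>Poly_Mapping.keys a. set w \<subseteq> S)"
  by (simp add: tensor_algebra_def)

lemma carrier_tensor_UNIV [simp]: "carrier (tensor_algebra UNIV) = UNIV"
  by (simp add: tensor_algebra_def)

lemma tensor_algebra_simps [simp]:
  "a \<otimes>\<^bsub>tensor_algebra S\<^esub> b = a * b" "\<one>\<^bsub>tensor_algebra S\<^esub> = 1" "\<zero>\<^bsub>tensor_algebra S\<^esub> = 0"
  "a \<oplus>\<^bsub>tensor_algebra S\<^esub> b = a + b"
  by (simp_all add: tensor_algebra_def)

lemma tensor_closed [simp]:
  "a \<in> carrier (tensor_algebra S) \<Longrightarrow> b \<in> carrier (tensor_algebra S) \<Longrightarrow> a + b \<in> carrier (tensor_algebra S)"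
  "a \<in> carrier (tensor_algebra S) \<Longrightarrow> b \<in> carrier (tensor_algebra S) \<Longrightarrow> a * b \<in> carrier (tensor_algebra S)"
  "a \<in> carrier (tensor_algebra S) \<Longrightarrow> - a \<in> carrier (tensor_algebra S)"
  "1 \<in> carrier (tensor_algebra S)" "0 \<in> carrier (tensor_algebra S)"
  using keys_add[of a b] keys_mult[of a b]
  by (auto simp: carrier_tensor_algebra zero_list_def plus_list_def) (blast | force)+

lemma ring_tensor_algebra: "ring (tensor_algebra S)"
proof (intro ringI abelian_groupI monoidI)
  fix x assume "x \<in> carrier (tensor_algebra S)"
  then show "\<exists>y\<in>carrier (tensor_algebra S). y \<oplus>\<^bsub>tensor_algebra S\<^esub> x = \<zero>\<^bsub>tensor_algebra S\<^esub>"
    by (intro bexI[of _ "- x"]) simp_all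
qed (simp_all add: algebra_simps)

lemma reduced_ideal_minimal:
  assumes "ideal J (tensor_algebra S)" "reduced_relations \<chi> S \<subseteq> J"
  shows "reduced_ideal \<chi> S \<subseteq> J"
  unfolding reduced_ideal_def using assms by (intro ring.genideal_minimal[OF ring_tensor_algebra])

lemma zero_in_reduced_ideal: "0 \<in> reduced_ideal \<chi> S"
proof -
  have "0 \<in> J" if "ideal J (tensor_algebra S)" for J
    using additive_subgroup.zero_closed[OF ideal.axioms(1)[OF that]] by simp
  then show ?thesis by (auto simp: reduced_ideal_def genideal_def)
qed

lemma reduced_ideal_UNIV: "ideal (reduced_ideal \<chi> UNIV) (tensor_algebra UNIV)"
  unfolding reduced_ideal_def by (intro ring.genideal_ideal[OF ring_tensor_algebra]) simp

lemma reduced_ideal_closed: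
  "a \<in> reduced_ideal \<chi> UNIV \<Longrightarrow> b \<in> reduced_ideal \<chi> UNIV \<Longrightarrow> a + b \<in> reduced_ideal \<chi> UNIV"
  "a \<in> reduced_ideal \<chi> UNIV \<Longrightarrow> x * a \<in> reduced_ideal \<chi> UNIV"
  "a \<in> reduced_ideal \<chi> UNIV \<Longrightarrow> a * x \<in> reduced_ideal \<chi> UNIV"
  "a \<in> reduced_ideal \<chi> UNIV \<Longrightarrow> - a \<in> reduced_ideal \<chi> UNIV"
  "a \<in> reduced_ideal \<chi> UNIV \<Longrightarrow> b \<in> reduced_ideal \<chi> UNIV \<Longrightarrow> a - b \<in> reduced_ideal \<chi> UNIV"
proof -
  interpret I: ideal "reduced_ideal \<chi> UNIV" "tensor_algebra UNIV" by (rule reduced_ideal_UNIV)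
  show add: "a + b \<in> reduced_ideal \<chi> UNIV" if "a \<in> reduced_ideal \<chi> UNIV" "b \<in> reduced_ideal \<chi> UNIV" for a b
    using additive_subgroup.a_closed[OF I.additive_subgroup_axioms that] by simp
  show l: "x * a \<in> reduced_ideal \<chi> UNIV" if "a \<in> reduced_ideal \<chi> UNIV" for a x
    using I.I_l_closed[OF that, of x] by simp
  show "a * x \<in> reduced_ideal \<chi> UNIV" if "a \<in> reduced_ideal \<chi> UNIV" for a x
    using I.I_r_closed[OF that, of x] by simp
  show neg: "- a \<in> reduced_ideal \<chi> UNIV" if "a \<in> reduced_ideal \<chi> UNIV" for a
    using l[OF that, of "-1"] by simp
  show "a - b \<in> reduced_ideal \<chi> UNIV" if "a \<in> reduced_ideal \<chi> UNIV" "b \<in> reduced_ideal \<chi> UNIV" for a b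
    using add[OF that(1) neg[OF that(2)]] by simp
qed

lemma relations_in_reduced_ideal: "r \<in> reduced_relations \<chi> UNIV \<Longrightarrow> r \<in> reduced_ideal \<chi> UNIV"
  unfolding reduced_ideal_def using ring.genideal_self[OF ring_tensor_algebra, of "reduced_relations \<chi> UNIV" UNIV] by auto

lemma osp_part_mono: "S \<subseteq> S' \<Longrightarrow> osp_part S i \<subseteq> osp_part S' i"
  by (auto simp: osp_part_def)

lemma reduced_relations_mono:
  assumes "S \<subseteq> S'" shows "reduced_relations \<chi> S \<subseteq> reduced_relations \<chi> S'"
proof -
  have "x \<in> osp_part S i \<Longrightarrow> x \<in> osp_part S' i" for x i using osp_part_mono[OF assms] by blast
  then show ?thesis unfolding reduced_relations_def by blast
qed

lemma embed_in_tensor: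
  assumes "x \<in> osp_part S i" shows "embed x \<in> carrier (tensor_algebra S)"
  using assms unfolding embed_def sum_osp_basis
  by (intro tensor_closed) (auto simp: carrier_tensor_algebra osp_part_def)

section \<open>Representations of the tensor algebra\<close>

lemma words_decomp: "a = (\<Sum>w\<in>Poly_Mapping.keys a. Poly_Mapping.single w (Poly_Mapping.lookup a w))"
proof (rule poly_mapping_eqI)
  fix k
  have "(\<Sum>w\<in>Poly_Mapping.keys a. Poly_Mapping.lookup (Poly_Mapping.single w (Poly_Mapping.lookup a w)) k) =
    (\<Sum>w\<in>Poly_Mapping.keys a. if w = k then Poly_Mapping.lookup a w else 0)"
    by (intro sum.cong refl) (simp add: lookup_single when_def)
  also have "\<dots> = Poly_Mapping.lookup a k"
    by (simp add: in_keys_iff)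
  finally show "Poly_Mapping.lookup a k =
      Poly_Mapping.lookup (\<Sum>w\<in>Poly_Mapping.keys a. Poly_Mapping.single w (Poly_Mapping.lookup a w)) k"
    by (simp add: lookup_sum)
qed

text \<open>\<open>s\<close> is the structure map of an algebra, and \<open>g\<close> gives the images of the basis of osp(1|2).\<close>

locale word_rep =
  fixes s :: "'k::field \<Rightarrow> 'a::ring_1" and g :: "osp_basis \<Rightarrow> 'a"
  assumes s_add: "s (c + d) = s c + s d" and s_mult: "s (c * d) = s c * s d" and s_one: "s 1 = 1"
    and s_commute: "g b * s c = s c * g b"
begin

definition W :: "'k words \<Rightarrow> 'a" where
  "W a = (\<Sum>w\<in>Poly_Mapping.keys a. s (Poly_Mapping.lookup a w) * prod_list (map g w))"

lemma s_zero: "s 0 = 0"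
  using s_add[of 0 0] by simp

lemma s_sum: "s (sum f A) = (\<Sum>i\<in>A. s (f i))"
  by (induction A rule: infinite_finite_induct) (simp_all add: s_zero s_add)

lemma s_commute_word: "prod_list (map g w) * s c = s c * prod_list (map g w)"
  by (induction w) (simp_all add: mult.assoc, simp add: mult.assoc[symmetric] s_commute)

lemma W_superset:
  assumes "finite A" "Poly_Mapping.keys a \<subseteq> A"
  shows "W a = (\<Sum>w\<in>A. s (Poly_Mapping.lookup a w) * prod_list (map g w))"
  unfolding W_def using assms by (intro sum.mono_neutral_left) (auto simp: in_keys_iff s_zero)

lemma W_add: "W (a + b) = W a + W b"
proof -
  let ?A = "Poly_Mapping.keys a \<union> Poly_Mapping.keys b"
  have "W (a + b) = (\<Sum>w\<in>?A. s (Poly_Mapping.lookup (a + b) w) * prod_list (map g w))"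
    by (rule W_superset) (use keys_add[of a b] in auto)
  then show ?thesis
    using W_superset[of ?A a] W_superset[of ?A b]
    by (simp add: lookup_add s_add distrib_right sum.distrib)
qed

lemma W_0 [simp]: "W 0 = 0"
  by (simp add: W_def)

lemma W_sum: "W (sum f A) = (\<Sum>i\<in>A. W (f i))"
  by (induction A rule: infinite_finite_induct) (simp_all add: W_add)

lemma W_minus: "W (- a) = - W a"
  using W_add[of a "- a"] by (simp add: eq_neg_iff_add_eq_0 add.commute)

lemma W_diff: "W (a - b) = W a - W b"
  using W_add[of a "- b"] by (simp add: W_minus)

lemma W_single: "W (Poly_Mapping.single w c) = s c * prod_list (map g w)"
  by (cases "c = 0") (simp_all add: W_def s_zero)

lemma W_1 [simp]: "W 1 = 1"
  using W_single[of 0 1] unfolding single_one by (simp add: s_one zero_list_def)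

lemma W_mult: "W (a * b) = W a * W b"
proof -
  have 1: "W (Poly_Mapping.single w c * Poly_Mapping.single w' c') =
      W (Poly_Mapping.single w c) * W (Poly_Mapping.single w' c')" for w w' c c'
  proof -
    have "s c * prod_list (map g w) * (s c' * prod_list (map g w')) =
        s c * (prod_list (map g w) * s c') * prod_list (map g w')"
      by (simp only: mult.assoc)
    also have "\<dots> = s (c * c') * (prod_list (map g w) * prod_list (map g w'))"
      by (simp only: s_commute_word s_mult mult.assoc)
    finally show ?thesis by (simp add: mult_single W_single plus_list_def)
  qed
  have "W (a * b) = W ((\<Sum>w\<in>Poly_Mapping.keys a. Poly_Mapping.single w (Poly_Mapping.lookup a w)) *
      (\<Sum>w\<in>Poly_Mapping.keys b. Poly_Mapping.single w (Poly_Mapping.lookup b w)))"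
    by (simp only: words_decomp[symmetric])
  also have "\<dots> = W (\<Sum>w\<in>Poly_Mapping.keys a. Poly_Mapping.single w (Poly_Mapping.lookup a w)) *
      W (\<Sum>w\<in>Poly_Mapping.keys b. Poly_Mapping.single w (Poly_Mapping.lookup b w))"
    by (simp only: sum_product W_sum 1)
  finally show ?thesis by (simp only: words_decomp[symmetric])
qed

lemma W_power: "W (a ^ n) = W a ^ n"
  by (induction n) (simp_all add: W_mult)

lemma W_scalar_word: "W (scalar_word c) = s c"
  by (simp add: scalar_word_def W_single)

lemma W_embed: "W (embed x) = (\<Sum>b\<in>UNIV. s (x b) * g b)"
  by (simp add: embed_def W_sum W_single)

text \<open>The relation is bilinear in x and y, and a pair of basis elements enters only if its
  parities are i and j, so the sign is the right one for each pair. The set \<open>S\<close> allows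
  the use for the whole superalgebra and for the Borel subalgebra.\<close>

lemma W_bracket_relation:
  assumes rel: "\<And>b b'. b \<in> S \<Longrightarrow> b' \<in> S \<Longrightarrow>
      g b * g b' - (if parity b = 1 \<and> parity b' = 1 then - 1 else 1) * (g b' * g b) =
      (\<Sum>k\<in>UNIV. s (bracket_basis b b' k) * g k)"
    and x: "x \<in> osp_part S i" and y: "y \<in> osp_part S j"
  shows "W (embed x * embed y - (if i = 1 \<and> j = 1 then - 1 else 1) * (embed y * embed x) -
    embed (bracket x y)) = 0"
proof -
  define e :: 'a where "e = (if i = 1 \<and> j = 1 then - 1 else 1)"
  have e: "e * u = (if i = 1 \<and> j = 1 then - u else u)" for u by (simp add: e_def)
  have ee: "W (if i = 1 \<and> j = 1 then - 1 else 1) = e" by (simp add: e_def W_minus)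
  have comm: "(s c * g b) * (s d * g b') = s c * s d * (g b * g b')" for b b' c d
  proof -
    have "(s c * g b) * (s d * g b') = s c * (g b * s d) * g b'" by (simp only: mult.assoc)
    then show ?thesis by (simp only: s_commute mult.assoc)
  qed
  have sc: "s c * s d = s d * s c" for c d by (metis s_mult mult.commute)
  have 1: "W (embed x) * W (embed y) = (\<Sum>b\<in>UNIV. \<Sum>b'\<in>UNIV. s (x b) * s (y b') * (g b * g b'))"
    by (simp only: W_embed sum_product comm)
  have "W (embed y) * W (embed x) = (\<Sum>b'\<in>UNIV. \<Sum>b\<in>UNIV. s (x b) * s (y b') * (g b' * g b))"
    by (simp only: W_embed sum_product comm sc)
  then have 2: "W (embed y) * W (embed x) = (\<Sum>b\<in>UNIV. \<Sum>b'\<in>UNIV. s (x b) * s (y b') * (g b' * g b))"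
    by (subst sum.swap)
  have "W (embed (bracket x y)) = (\<Sum>k\<in>UNIV. (\<Sum>b\<in>UNIV. \<Sum>b'\<in>UNIV. s (x b) * s (y b') * (s (bracket_basis b b' k) * g k)))"
    by (simp only: W_embed bracket_def s_sum s_mult sum_distrib_right mult.assoc)
  also have "\<dots> = (\<Sum>b\<in>UNIV. \<Sum>b'\<in>UNIV. \<Sum>k\<in>UNIV. s (x b) * s (y b') * (s (bracket_basis b b' k) * g k))"
    by (rule trans[OF sum.swap], rule sum.cong, rule refl, rule sum.swap)
  finally have 3: "W (embed (bracket x y)) =
      (\<Sum>b\<in>UNIV. \<Sum>b'\<in>UNIV. s (x b) * s (y b') * (\<Sum>k\<in>UNIV. s (bracket_basis b b' k) * g k))"
    by (simp only: sum_distrib_left)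
  have zero_term: "s (x b) * s (y b') * (g b * g b') - e * (s (x b) * s (y b') * (g b' * g b)) -
      s (x b) * s (y b') * (\<Sum>k\<in>UNIV. s (bracket_basis b b' k) * g k) = 0" for b b'
  proof (cases "x b = 0 \<or> y b' = 0")
    case False
    then have b: "b \<in> S" "parity b = i" "b' \<in> S" "parity b' = j"
      using x y by (auto simp: osp_part_def)
    have "g b * g b' - e * (g b' * g b) = (\<Sum>k\<in>UNIV. s (bracket_basis b b' k) * g k)"
      using rel[OF b(1,3)] b by (simp add: e_def)
    then show ?thesis by (simp only: e right_diff_distrib[symmetric]) (simp add: e algebra_simps)
  qed (auto simp: s_zero)
  have "W (embed x * embed y - (if i = 1 \<and> j = 1 then - 1 else 1) * (embed y * embed x) - embed (bracket x y)) =
    W (embed x) * W (embed y) - e * (W (embed y) * W (embed x)) - W (embed (bracket x y))"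
    by (simp only: W_diff W_mult ee)
  also have "\<dots> = (\<Sum>b\<in>UNIV. \<Sum>b'\<in>UNIV. s (x b) * s (y b') * (g b * g b') - e * (s (x b) * s (y b') * (g b' * g b)) -
      s (x b) * s (y b') * (\<Sum>k\<in>UNIV. s (bracket_basis b b' k) * g k))"
    unfolding 1 2 3 sum_distrib_left sum_subtractf ..
  also have "\<dots> = 0" by (simp only: zero_term sum.neutral_const)
  finally show ?thesis .
qed

text \<open>The kernel of \<open>W\<close> is an ideal, and the reduced ideal is the smallest one
  containing the relations.\<close>

lemma W_reduced_ideal:
  assumes "\<And>r. r \<in> reduced_relations \<chi> S \<Longrightarrow> r \<in> carrier (tensor_algebra S) \<Longrightarrow> W r = 0"
    and sub: "reduced_relations \<chi> S \<subseteq> carrier (tensor_algebra S)"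
    and a: "a \<in> reduced_ideal \<chi> S"
  shows "W a = 0"
proof -
  let ?J = "{a \<in> carrier (tensor_algebra S). W a = 0}"
  interpret T: ring "tensor_algebra S" by (rule ring_tensor_algebra)
  have inv: "inv\<^bsub>add_monoid (tensor_algebra S)\<^esub> x = - x" if "x \<in> carrier (tensor_algebra S)" for x
  proof -
    have "\<ominus>\<^bsub>tensor_algebra S\<^esub> x = - x" by (rule T.minus_equality) (use that in simp_all)
    then show ?thesis by (simp only: a_inv_def)
  qed
  have "ideal ?J (tensor_algebra S)"
  proof (intro idealI T.ring_axioms subgroup.intro)
    fix x assume "x \<in> ?J"
    then show "inv\<^bsub>add_monoid (tensor_algebra S)\<^esub> x \<in> ?J"
      using inv[of x] by (simp only: mem_Collect_eq) (simp add: W_minus)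
  qed (auto simp: W_add W_mult)
  moreover have "reduced_relations \<chi> S \<subseteq> ?J" using assms(1) sub by auto
  ultimately show ?thesis using reduced_ideal_minimal a by blast
qed

end

section \<open>The representations on baby Verma modules\<close>

text \<open>The brackets [E,E] = 2e and [F,F] = -2f dictate the images of e and f.\<close>

fun verma_op :: "'k::field \<Rightarrow> osp_basis \<Rightarrow> (nat \<Rightarrow> 'k) endo" where
  "verma_op l e_b = verma_E l * verma_E l"
| "verma_op l h_b = verma_H l"
| "verma_op l f_b = - (verma_F * verma_F)"
| "verma_op l E_b = verma_E l"
| "verma_op l F_b = verma_F"

interpretation verma: word_rep scal "verma_op l" for l :: "'k::field"
proof
  show "verma_op l b * scal c = scal c * verma_op l b" for b c
    by (cases b) (simp_all add: scal_commute commute_mult)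
qed (simp_all add: scal_hom)

abbreviation verma_rep :: "'k::field \<Rightarrow> 'k words \<Rightarrow> (nat \<Rightarrow> 'k) endo" where
  "verma_rep \<equiv> verma.W"

lemma verma_basis_relation:
  "verma_op l b * verma_op l b' - (if parity b = 1 \<and> parity b' = 1 then - 1 else 1) * (verma_op l b' * verma_op l b) =
    (\<Sum>k\<in>UNIV. scal (bracket_basis b b' k) * verma_op l k)"
proof -
  have two: "scal 2 * X = X + X" "scal (- 2) * X = - X - X" for X :: "(nat \<Rightarrow> 'a) endo"
    by (simp_all add: scal_hom scal_numeral mult_2)
  show ?thesis
    unfolding sum_osp_basis
    by (cases b; cases b';
        simp add: basis_vec_def scale_def scal_hom(1,2,5) two;
        simp add: mult.assoc verma.pbw right_diff_distrib left_diff_distrib;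
        simp add: algebra_simps)
qed

lemma scalar_word_hom:
  "scalar_word (c + d) = scalar_word c + scalar_word d" "scalar_word (c * d) = scalar_word c * scalar_word d"
  "scalar_word 0 = 0" "scalar_word 1 = 1" "scalar_word (- c) = - scalar_word c"
  "scalar_word (c - d) = scalar_word c - scalar_word d"
  by (simp_all add: scalar_word_def single_add single_diff single_uminus mult_single plus_list_def)
    (simp add: zero_list_def[symmetric])

lemma scalar_word_commute: "a * scalar_word c = scalar_word c * a"
proof -
  have 1: "Poly_Mapping.single w d * scalar_word c = scalar_word c * Poly_Mapping.single w d" for w d
    by (simp add: scalar_word_def mult_single plus_list_def mult.commute)
  have "(\<Sum>w\<in>Poly_Mapping.keys a. Poly_Mapping.single w (Poly_Mapping.lookup a w)) * scalar_word c =
      scalar_word c * (\<Sum>w\<in>Poly_Mapping.keys a. Poly_Mapping.single w (Poly_Mapping.lookup a w))"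
    by (simp only: sum_distrib_left sum_distrib_right 1)
  then show ?thesis by (simp only: words_decomp[symmetric])
qed

lemma scalar_word_left_commute: "a * (scalar_word c * b) = scalar_word c * (a * b)"
  by (metis scalar_word_commute mult.assoc)

definition gen :: "osp_basis \<Rightarrow> 'k::field words" where
  "gen b = Poly_Mapping.single [b] 1"

lemma embed_basis_vec: "embed (basis_vec b) = gen b"
  by (cases b) (simp_all add: embed_def sum_osp_basis basis_vec_def gen_def)

lemma embed_scale: "embed (scale c x) = scalar_word c * embed x"
  by (simp add: embed_def scale_def sum_distrib_left scalar_word_def mult_single plus_list_def)

lemma embed_zero: "embed (\<lambda>_. 0) = 0"
  by (simp add: embed_def)

lemma tensor_induct:
  fixes P :: "'k::field words \<Rightarrow> bool"
  assumes "P 1" "\<And>a b. P a \<Longrightarrow> P b \<Longrightarrow> P (a + b)" "\<And>c a. P a \<Longrightarrow> P (scalar_word c * a)"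
    "\<And>b a. P a \<Longrightarrow> P (gen b * a)"
  shows "P a"
proof -
  have w: "P (Poly_Mapping.single w 1)" for w
  proof (induction w)
    case Nil
    then show ?case using assms(1) by (simp add: zero_list_def[symmetric])
  next
    case (Cons b w)
    have "Poly_Mapping.single (b # w) (1::'k) = gen b * Poly_Mapping.single w 1"
      by (simp add: gen_def mult_single plus_list_def)
    then show ?case using assms(4)[OF Cons] by simp
  qed
  have s: "P (Poly_Mapping.single w c)" for w c
    using assms(3)[OF w, of c w] by (simp add: scalar_word_def mult_single plus_list_def)
  have "P (\<Sum>w\<in>A. Poly_Mapping.single w (Poly_Mapping.lookup a w))" if "finite A" for A
    using that
  proof (induction A rule: finite_induct)
    case empty
    then show ?case using s[of "[]" 0] by simp
  qed (simp add: assms(2) s)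
  then show ?thesis using words_decomp[of a] by (metis finite_keys)
qed

locale osp_regular =
  fixes \<chi> :: "'k::alg_closed_field osp \<Rightarrow> 'k"
  assumes CHAR_gt_2: "CHAR('k) > 2" and dual: "\<chi> \<in> even_dual"
    and chi_h: "\<chi> (basis_vec h_b) \<noteq> 0"
    and chi_e: "\<chi> (basis_vec e_b) = 0" and chi_f: "\<chi> (basis_vec f_b) = 0"
begin

abbreviation "I \<equiv> reduced_ideal \<chi> UNIV"

lemma prime_CHAR: "prime CHAR('k)"
  using CHAR_gt_2 by (intro prime_CHAR_semidom) auto

lemma odd_CHAR: "odd CHAR('k)"
  using prime_CHAR CHAR_gt_2 prime_odd_nat by blast

lemma two_nz: "(2::'k) \<noteq> 0"
proof
  assume "(2::'k) = 0"
  then have "of_nat 2 = (0::'k)" by simp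
  then have "CHAR('k) dvd 2" by (simp only: of_nat_eq_0_iff_char_dvd)
  then show False using CHAR_gt_2 by (auto dest: dvd_imp_le)
qed

subsection \<open>The weights\<close>

lemma of_nat_nz: "0 < n \<Longrightarrow> n < CHAR('k) \<Longrightarrow> (of_nat n :: 'k) \<noteq> 0"
  by (auto simp: of_nat_eq_0_iff_char_dvd dest: dvd_imp_le)

lemma weight_add_nat: "l \<in> weights \<chi> \<Longrightarrow> l + of_nat n \<in> weights \<chi>"
  using freshmans_dream[OF prime_CHAR refl, of l "of_nat n"]
  by (simp add: weights_def of_nat_power_CHAR[OF prime_CHAR])

text \<open>A natural number satisfies n^p = n and would give \<chi>(h) = 0; this is where
  regularity enters.\<close>

lemma weight_not_nat: "l \<in> weights \<chi> \<Longrightarrow> l \<noteq> of_nat n"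
  using chi_h by (auto simp: weights_def of_nat_power_CHAR[OF prime_CHAR])

text \<open>The weights are the roots of an Artin-Schreier polynomial: one root exists over an
  algebraically closed field, its p translates by the prime field are again roots, and the degree p
  allows no more.\<close>

lemma weights_card: "card (weights \<chi>) = CHAR('k)"
  and finite_weights: "finite (weights \<chi>)"
proof -
  let ?p = "CHAR('k)" and ?s = "\<chi> (basis_vec h_b) ^ CHAR('k)"
  define P where "P = Polynomial.monom (1::'k) ?p - Polynomial.monom 1 1 - [:?s:]"
  have P: "poly P x = x ^ ?p - x - ?s" for x
    by (simp add: P_def poly_monom)
  define Q where "Q = Polynomial.monom (1::'k) 1 + [:?s:]"
  have "Polynomial.degree Q \<le> 1"
    unfolding Q_def by (intro degree_add_le) (auto simp: degree_monom_le)
  then have "Polynomial.degree (- Q) < Polynomial.degree (Polynomial.monom (1::'k) ?p)"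
    using CHAR_gt_2 by (simp add: degree_monom_eq)
  then have "Polynomial.degree (Polynomial.monom 1 ?p + - Q) = ?p"
    by (simp only: degree_add_eq_left degree_monom_eq[OF one_neq_zero])
  moreover have "P = Polynomial.monom 1 ?p + - Q" by (simp add: P_def Q_def)
  ultimately have degP: "Polynomial.degree P = ?p" by simp
  have W: "weights \<chi> = {x. poly P x = 0}" by (auto simp: weights_def P)
  have P0: "P \<noteq> 0" using degP CHAR_gt_2 by auto
  show fin: "finite (weights \<chi>)" unfolding W by (rule poly_roots_finite[OF P0])
  have le: "card (weights \<chi>) \<le> ?p" unfolding W using card_poly_roots_bound[OF P0] degP by simp
  obtain l where l: "l \<in> weights \<chi>"
    using alg_closed_imp_poly_has_root[of P] degP CHAR_gt_2 unfolding W by auto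
  have "inj_on (\<lambda>n. l + of_nat n) {..<?p}"
    by (auto intro!: inj_onI simp: of_nat_eq_iff_cong_CHAR cong_def)
  then have "card ((\<lambda>n. l + of_nat n) ` {..<?p}) = ?p" by (simp add: card_image)
  moreover have "(\<lambda>n. l + of_nat n) ` {..<?p} \<subseteq> weights \<chi>" using weight_add_nat[OF l] by auto
  ultimately have "?p \<le> card (weights \<chi>)" using card_mono[OF fin] by metis
  then show "card (weights \<chi>) = ?p" using le by simp
qed

text \<open>Differences of weights are fixed by the p-th power map. Hence 1 - x^(p-1) is the
  indicator of x = 0 on them, which separates the weights in
  \<open>entries_surjective\<close>.\<close>

lemma weight_diff_power:
  assumes "l \<in> weights \<chi>" "m \<in> weights \<chi>" "l \<noteq> m"
  shows "(l - m) ^ (CHAR('k) - 1) = 1"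
proof -
  have "(l - m) ^ CHAR('k) = l - m"
    using assms by (simp add: diff_power_CHAR[OF prime_CHAR] weights_def algebra_simps)
  then have "(l - m) * (l - m) ^ (CHAR('k) - 1) = (l - m) * 1"
    using CHAR_gt_2 by (cases "CHAR('k)") simp_all
  then show ?thesis using assms(3) by (simp only: mult_cancel_left) simp
qed

lemma verma_coeff_nz:
  assumes l: "l \<in> weights \<chi>" and n: "0 < n" "n < 2 * CHAR('k)"
  shows "verma_coeff l n \<noteq> 0"
proof (cases "even n")
  case True
  then have "0 < n div 2" "n div 2 < CHAR('k)" using n by (auto elim!: evenE)
  then show ?thesis using of_nat_nz True by (simp add: verma_coeff_def)
next
  case False
  then show ?thesis using weight_not_nat[OF l, of "n div 2"] by (simp add: verma_coeff_def)
qed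

subsection \<open>The action of the reduced enveloping algebra\<close>

lemma verma_rep_embed_even:
  assumes "x \<in> osp_even"
  shows "verma_rep l (embed x) = verma_lin l (x e_b) (x h_b) (x f_b)"
  using osp_evenD[OF assms] by (simp add: verma.W_embed sum_osp_basis verma_lin_def scal_hom)

text \<open>The bracket relations reduce to pairs of basis elements. The p-th power relation is
  needed for every even x and is \<open>verma_lin_power\<close>; the scalar there is \<chi>(x)^p
  because \<chi> sees only the h-coordinate of x.\<close>

lemma verma_rep_ideal:
  assumes l: "l \<in> weights \<chi>" and a: "a \<in> I"
  shows "verma_rep l a = 0"
proof (rule verma.W_reduced_ideal[OF _ _ a])
  fix r assume "r \<in> reduced_relations \<chi> UNIV"
  then consider x y i j where "r = embed x * embed y - (if i = 1 \<and> j = 1 then - 1 else 1) * (embed y * embed x) -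
      embed (bracket x y)" "x \<in> osp_part UNIV i" "y \<in> osp_part UNIV j"
    | x where "r = embed x ^ CHAR('k) - embed (p_map x) - scalar_word (\<chi> x ^ CHAR('k))" "x \<in> osp_even"
    unfolding reduced_relations_def by blast
  then show "verma_rep l r = 0"
  proof cases
    case 1
    show ?thesis unfolding 1(1)
      by (rule verma.W_bracket_relation[OF verma_basis_relation 1(2,3)])
  next
    case 2
    have "verma_rep l (embed (p_map x)) =
        scal (((x h_b)\<^sup>2 + x e_b * x f_b) ^ ((CHAR('k) - 1) div 2)) * verma_lin l (x e_b) (x h_b) (x f_b)"
      by (simp add: p_map_def embed_scale verma.W_mult verma.W_scalar_word verma_rep_embed_even 2)
    moreover have "x h_b ^ CHAR('k) * (l ^ CHAR('k) - l) = \<chi> x ^ CHAR('k)"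
      using l even_dual_coords[OF dual 2(2) chi_e chi_f] by (simp add: weights_def power_mult_distrib)
    ultimately show ?thesis
      using verma_lin_power[OF prime_CHAR odd_CHAR, of l "x e_b" "x h_b" "x f_b"]
      by (simp add: 2(1) verma.W_diff verma.W_power verma.W_scalar_word verma_rep_embed_even 2(2))
  qed
qed simp

lemma verma_rep_gen: "verma_rep l (gen b) = verma_op l b"
  by (simp add: gen_def verma.W_single scal_hom)

subsection \<open>Congruences in the tensor algebra\<close>

definition eqv (infix \<open>\<sim>\<^sub>I\<close> 50) where "a \<sim>\<^sub>I b \<longleftrightarrow> a - b \<in> I"

lemma eqv_refl [simp]: "a \<sim>\<^sub>I a"
  by (simp add: eqv_def zero_in_reduced_ideal)

lemma eqv_sym: "a \<sim>\<^sub>I b \<Longrightarrow> b \<sim>\<^sub>I a"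
  unfolding eqv_def using reduced_ideal_closed(4)[of "a - b" \<chi>] by simp

lemma eqv_trans [trans]: "a \<sim>\<^sub>I b \<Longrightarrow> b \<sim>\<^sub>I c \<Longrightarrow> a \<sim>\<^sub>I c"
  unfolding eqv_def using reduced_ideal_closed(1)[of "a - b" \<chi> "b - c"] by simp

lemma eqv_add: "a \<sim>\<^sub>I b \<Longrightarrow> c \<sim>\<^sub>I d \<Longrightarrow> a + c \<sim>\<^sub>I b + d"
  unfolding eqv_def using reduced_ideal_closed(1)[of "a - b" \<chi> "c - d"] by (simp add: algebra_simps)

lemma eqv_diff: "a \<sim>\<^sub>I b \<Longrightarrow> c \<sim>\<^sub>I d \<Longrightarrow> a - c \<sim>\<^sub>I b - d"
  unfolding eqv_def using reduced_ideal_closed(5)[of "a - b" \<chi> "c - d"] by (simp add: algebra_simps)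

lemma eqv_minus: "a \<sim>\<^sub>I b \<Longrightarrow> - a \<sim>\<^sub>I - b"
  using eqv_diff[of 0 0 a b] by simp

lemma eqv_left: "a \<sim>\<^sub>I b \<Longrightarrow> x * a \<sim>\<^sub>I x * b"
  unfolding eqv_def using reduced_ideal_closed(2)[of "a - b" \<chi> x] by (simp add: right_diff_distrib)

lemma eqv_right: "a \<sim>\<^sub>I b \<Longrightarrow> a * x \<sim>\<^sub>I b * x"
  unfolding eqv_def using reduced_ideal_closed(3)[of "a - b" \<chi> x] by (simp add: left_diff_distrib)

lemma eqv_mult: "a \<sim>\<^sub>I b \<Longrightarrow> c \<sim>\<^sub>I d \<Longrightarrow> a * c \<sim>\<^sub>I b * d"
  using eqv_trans[OF eqv_left eqv_right] by blast

lemma eqv_power: "a \<sim>\<^sub>I b \<Longrightarrow> a ^ n \<sim>\<^sub>I b ^ n"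
  by (induction n) (simp_all add: eqv_mult)

lemma eqv_zero: "a \<sim>\<^sub>I 0 \<longleftrightarrow> a \<in> I"
  by (simp add: eqv_def)

lemma eqv_verma_rep: "a \<sim>\<^sub>I b \<Longrightarrow> l \<in> weights \<chi> \<Longrightarrow> verma_rep l a = verma_rep l b"
  using verma_rep_ideal[of l "a - b"] by (simp add: eqv_def verma.W_diff)

lemma eqv_bracket:
  "gen b * gen b' - (if parity b = 1 \<and> parity b' = 1 then - 1 else 1) * (gen b' * gen b) \<sim>\<^sub>I embed (bracket_basis b b')"
proof -
  have br: "bracket (basis_vec b) (basis_vec b') = (bracket_basis b b' :: 'k osp)"
  proof
    fix k
    have eq: "basis_vec b i * basis_vec b' j * bracket_basis i j k =
        (if i = b then (if j = b' then bracket_basis i j k else 0) else (0::'k))" for i j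
      by (simp add: basis_vec_def)
    have "(\<Sum>i\<in>UNIV. \<Sum>j\<in>UNIV. basis_vec b i * basis_vec b' j * bracket_basis i j k) =
      (\<Sum>i\<in>UNIV. if i = b then (\<Sum>j\<in>UNIV. if j = b' then bracket_basis i j k else 0) else (0::'k))"
      unfolding eq by (intro sum.cong refl) simp
    then show "bracket (basis_vec b) (basis_vec b') k = (bracket_basis b b' k :: 'k)"
      by (simp add: bracket_def)
  qed
  have part: "basis_vec b \<in> osp_part UNIV (parity b)" for b
    by (simp add: osp_part_def basis_vec_def)
  have "embed (basis_vec b) * embed (basis_vec b') - (if parity b = 1 \<and> parity b' = 1 then - 1 else 1) *
      (embed (basis_vec b') * embed (basis_vec b)) - embed (bracket (basis_vec b) (basis_vec b')) \<in> reduced_relations \<chi> UNIV"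
    unfolding reduced_relations_def using part by blast
  from relations_in_reduced_ideal[OF this] show ?thesis
    unfolding eqv_def br embed_basis_vec .
qed

lemma eqv_p_power:
  assumes "parity b = 0"
  shows "gen b ^ CHAR('k) \<sim>\<^sub>I embed (p_map (basis_vec b)) + scalar_word (\<chi> (basis_vec b) ^ CHAR('k))"
proof -
  have "embed (basis_vec b) ^ CHAR('k) - embed (p_map (basis_vec b)) - scalar_word (\<chi> (basis_vec b) ^ CHAR('k))
      \<in> reduced_relations \<chi> UNIV"
    using basis_vec_even[OF assms] unfolding reduced_relations_def by blast
  from relations_in_reduced_ideal[OF this] show ?thesis
    by (simp add: eqv_def embed_basis_vec algebra_simps)
qed

abbreviation (input) "tE \<equiv> gen E_b :: 'k words"
abbreviation (input) "tF \<equiv> gen F_b :: 'k words"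
abbreviation (input) "tH \<equiv> gen h_b :: 'k words"

text \<open>The bracket relations speak of 2 E^2 and 2 F^2 only; p > 2 permits the division by
  2.\<close>

lemma eqv_half:
  assumes "a + a \<sim>\<^sub>I scalar_word 2 * b" shows "a \<sim>\<^sub>I b"
proof -
  have "a = scalar_word (1/2) * (a + a)"
  proof -
    have "scalar_word (1/2) * (a + a) = (scalar_word (1/2) + scalar_word (1/2)) * a"
      by (simp add: distrib_left distrib_right)
    also have "\<dots> = a" using two_nz by (simp only: scalar_word_hom(1)[symmetric]) (simp add: scalar_word_hom(4))
    finally show ?thesis by simp
  qed
  also have "\<dots> \<sim>\<^sub>I scalar_word (1/2) * (scalar_word 2 * b)" by (rule eqv_left[OF assms])
  also have "\<dots> = b"
    using two_nz by (simp only: mult.assoc[symmetric] scalar_word_hom(2)[symmetric]) (simp add: scalar_word_hom(4))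
  finally show ?thesis .
qed

lemma eqv_relations:
  "gen e_b \<sim>\<^sub>I tE * tE" "gen f_b \<sim>\<^sub>I - (tF * tF)"
  "tE * tF \<sim>\<^sub>I tH - tF * tE" "tH * tE \<sim>\<^sub>I tE * tH + tE" "tH * tF \<sim>\<^sub>I tF * tH - tF"
proof -
  have "tE * tE \<sim>\<^sub>I gen e_b"
    by (rule eqv_half) (use eqv_bracket[of E_b E_b] in \<open>simp add: embed_scale embed_basis_vec\<close>)
  then show "gen e_b \<sim>\<^sub>I tE * tE" by (rule eqv_sym)
  have "tF * tF \<sim>\<^sub>I - gen f_b"
    by (rule eqv_half) (use eqv_bracket[of F_b F_b] in \<open>simp add: embed_scale embed_basis_vec scalar_word_hom\<close>)
  then show "gen f_b \<sim>\<^sub>I - (tF * tF)" using eqv_minus[OF eqv_sym] by fastforce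
  have "tE * tF + tF * tE \<sim>\<^sub>I tH" using eqv_bracket[of E_b F_b] by (simp add: embed_basis_vec)
  from eqv_diff[OF this eqv_refl, of "tF * tE"] show "tE * tF \<sim>\<^sub>I tH - tF * tE" by simp
  have "tH * tE - tE * tH \<sim>\<^sub>I tE" using eqv_bracket[of h_b E_b] by (simp add: embed_basis_vec)
  from eqv_add[OF this eqv_refl, of "tE * tH"] show "tH * tE \<sim>\<^sub>I tE * tH + tE" by (simp add: add.commute)
  have "tH * tF - tF * tH \<sim>\<^sub>I - tF"
    using eqv_bracket[of h_b F_b] by (simp add: embed_basis_vec embed_scale scalar_word_hom)
  from eqv_add[OF this eqv_refl, of "tF * tH"] show "tH * tF \<sim>\<^sub>I tF * tH - tF" by (simp add: add.commute)
qed

lemma eqv_powers: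
  "tE ^ (2 * CHAR('k)) \<sim>\<^sub>I 0" "tF ^ (2 * CHAR('k)) \<sim>\<^sub>I 0" "tH ^ CHAR('k) \<sim>\<^sub>I tH + scalar_word (\<chi> (basis_vec h_b) ^ CHAR('k))"
proof -
  have cp: "CHAR('k) > 0" using CHAR_gt_2 by simp
  have "tE ^ (2 * CHAR('k)) = (tE * tE) ^ CHAR('k)" by (simp add: power_mult power2_eq_square)
  also have "\<dots> \<sim>\<^sub>I gen e_b ^ CHAR('k)" by (rule eqv_power[OF eqv_sym[OF eqv_relations(1)]])
  also have "\<dots> \<sim>\<^sub>I 0"
    using eqv_p_power[of e_b] cp by (simp add: p_map_basis(1)[OF CHAR_gt_2] embed_zero chi_e scalar_word_hom power_0_left)
  finally show "tE ^ (2 * CHAR('k)) \<sim>\<^sub>I 0" .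
  \<comment> \<open>f corresponds to -F^2, so the odd power costs a sign, kept as a factor on the
    right.\<close>
  have "tF ^ (2 * CHAR('k)) = (- (tF * tF)) ^ CHAR('k) * (- 1) ^ CHAR('k)"
    using odd_CHAR by (simp add: power_mult power2_eq_square power_minus_odd)
  also have "\<dots> \<sim>\<^sub>I gen f_b ^ CHAR('k) * (- 1) ^ CHAR('k)"
    by (intro eqv_right eqv_power eqv_sym[OF eqv_relations(2)])
  also have "\<dots> \<sim>\<^sub>I 0 * (- 1) ^ CHAR('k)"
    using eqv_p_power[of f_b] cp
    by (intro eqv_right) (simp add: p_map_basis(2)[OF CHAR_gt_2] embed_zero chi_f scalar_word_hom power_0_left)
  finally show "tF ^ (2 * CHAR('k)) \<sim>\<^sub>I 0" by simp
  show "tH ^ CHAR('k) \<sim>\<^sub>I tH + scalar_word (\<chi> (basis_vec h_b) ^ CHAR('k))"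
    using eqv_p_power[of h_b] by (simp add: p_map_basis(3)[OF CHAR_gt_2] embed_basis_vec)
qed

end

section \<open>Zeros of polynomials, unit vectors and parities\<close>

lemma polynomial_coeffs_zero:
  fixes c :: "nat \<Rightarrow> 'a::idom"
  assumes A: "finite A" "n \<le> card A" and zero: "\<And>x. x \<in> A \<Longrightarrow> (\<Sum>j<n. c j * x ^ j) = 0" and j: "j < n"
  shows "c j = 0"
proof -
  define P where "P = (\<Sum>j<n. Polynomial.monom (c j) j)"
  have coeff: "Polynomial.coeff P i = (if i < n then c i else 0)" for i
    by (simp add: P_def coeff_sum)
  have "P = 0"
  proof (rule ccontr)
    assume P: "P \<noteq> 0"
    have "Polynomial.degree P < n"
      using j P by (metis coeff leading_coeff_0_iff)
    moreover have "A \<subseteq> {x. poly P x = 0}"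
      using zero by (auto simp: P_def poly_sum poly_monom)
    then have "card A \<le> card {x. poly P x = 0}"
      by (intro card_mono poly_roots_finite[OF P])
    ultimately show False using card_poly_roots_bound[OF P] A by simp
  qed
  then show ?thesis using coeff[of j] j by simp
qed

definition delta :: "nat \<Rightarrow> nat \<Rightarrow> 'r::comm_ring_1" where
  "delta m = (\<lambda>i. if i = m then 1 else 0)"

lemma parity_part_decomp:
  obtains a0 a1 where "a0 \<in> tensor_part UNIV 0" "a1 \<in> tensor_part UNIV 1" "a = a0 + (a1 :: 'k::field words)"
proof -
  define part where "part i = (\<Sum>w\<in>{w\<in>Poly_Mapping.keys a. sum_list (map parity w) = i}.
    Poly_Mapping.single w (Poly_Mapping.lookup a w))" for i
  have "part i \<in> tensor_part UNIV i" for i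
    using keys_sum[of "\<lambda>w. Poly_Mapping.single w (Poly_Mapping.lookup a w)" "{w\<in>Poly_Mapping.keys a. sum_list (map parity w) = i}"]
    by (auto simp: tensor_part_def part_def split: if_splits)
  moreover have "a = part 0 + part 1"
  proof -
    have "(\<Sum>w\<in>Poly_Mapping.keys a. Poly_Mapping.single w (Poly_Mapping.lookup a w)) = part 0 + part 1"
      unfolding part_def by (subst sum.union_disjoint[symmetric]) (auto intro!: sum.cong)
    then show ?thesis by (simp only: words_decomp[symmetric])
  qed
  ultimately show ?thesis using that by blast
qed

lemma tensor_part_mult:
  assumes "a \<in> tensor_part UNIV i" "b \<in> tensor_part UNIV j" shows "a * b \<in> tensor_part UNIV (i + j)"
  using assms keys_mult[of a b] by (fastforce simp: tensor_part_def plus_list_def)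

lemma tensor_part_add:
  assumes "a \<in> tensor_part S i" "b \<in> tensor_part S i" shows "a + b \<in> tensor_part S i"
  using assms keys_add[of a b] by (fastforce simp: tensor_part_def)

lemma tensor_part_zero: "0 \<in> tensor_part S i"
  by (simp add: tensor_part_def)

lemma tensor_part_minus: "a \<in> tensor_part S i \<Longrightarrow> - a \<in> tensor_part S i"
  by (simp add: tensor_part_def)

text \<open>With v_0 even, v_n = F^n v_0 has the parity of n.\<close>

definition parity_space :: "bit \<Rightarrow> (nat \<Rightarrow> 'r::zero) set" where
  "parity_space q = {g. \<forall>n. g n \<noteq> 0 \<longrightarrow> of_nat n = q}"

lemma bit_of_nat_Suc: "(of_nat (Suc n) :: bit) = q \<Longrightarrow> of_nat n = q + 1"
  by (cases q) (auto simp: )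

lemma parity_space_sum: "(\<And>i. i \<in> A \<Longrightarrow> f i \<in> parity_space q) \<Longrightarrow> sum f A \<in> (parity_space q :: (nat \<Rightarrow> 'r::comm_ring_1) set)"
  by (induction A rule: infinite_finite_induct) (auto simp: parity_space_def, metis add_0)

lemma verma_op_parity:
  assumes g: "g \<in> parity_space q" shows "app (verma_op l b) g \<in> parity_space (q + parity b)"
proof -
  have E: "app (verma_E l) g \<in> parity_space (q + 1)" if "g \<in> parity_space q" for q g
    using that by (auto simp: parity_space_def dest: bit_of_nat_Suc)
  have F: "app verma_F g \<in> parity_space (q + 1)" if "g \<in> parity_space q" for q and g :: "nat \<Rightarrow> 'a"
  proof -
    have "of_nat n = q + 1" if "\<not> 2 * CHAR('a) dvd n" "g (n - 1) \<noteq> 0" for n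
      using that \<open>g \<in> parity_space q\<close> by (cases n) (auto simp: parity_space_def)
    then show ?thesis by (auto simp: parity_space_def)
  qed
  have H: "app (verma_H l) g \<in> parity_space q" if "g \<in> parity_space q" for q g
    using that by (auto simp: parity_space_def)
  have m: "- g \<in> parity_space q" if "g \<in> parity_space q" for q and g :: "nat \<Rightarrow> 'a"
    using that by (auto simp: parity_space_def)
  have q: "q + 1 + 1 = q" for q :: bit by (cases q) simp_all
  show ?thesis
    using E[OF E[OF g]] m[OF F[OF F[OF g]]] E[OF g] F[OF g] H[OF g] by (cases b; cases q) (simp_all add: q)
qed

lemma verma_rep_parity:
  assumes a: "a \<in> tensor_part UNIV j" and g: "g \<in> parity_space q"
  shows "app (verma_rep l a) g \<in> parity_space (q + j)"
proof -
  have w: "app (prod_list (map (verma_op l) w)) g \<in> parity_space (q + sum_list (map parity w))" for w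
  proof (induction w)
    case Nil
    then show ?case using g by (cases q) simp_all
  next
    case (Cons b w)
    have "q + sum_list (map parity (b # w)) = q + sum_list (map parity w) + parity b"
      by (simp only: list.map sum_list.Cons ac_simps)
    then show ?case using verma_op_parity[OF Cons, of l b] by simp
  qed
  have "app (scal c * prod_list (map (verma_op l) w)) g \<in> parity_space (q + j)"
    if "w \<in> Poly_Mapping.keys a" for c w
  proof -
    have "sum_list (map parity w) = j" using a that by (simp add: tensor_part_def)
    with w[of w] show ?thesis unfolding parity_space_def by auto
  qed
  then show ?thesis
    unfolding verma.W_def app_sum_left by (rule parity_space_sum)
qed

context osp_regular
begin

subsection \<open>A spanning set\<close>

text \<open>The linear span of \<open>G\<close> modulo the ideal: as \<open>I\<close> is included,
  members may be replaced by congruent elements.\<close>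

inductive_set tspan :: "'k words set \<Rightarrow> 'k words set" for G where
  ideal: "a \<in> I \<Longrightarrow> a \<in> tspan G"
| add: "a \<in> tspan G \<Longrightarrow> b \<in> tspan G \<Longrightarrow> a + b \<in> tspan G"
| scale: "u \<in> G \<Longrightarrow> scalar_word c * u \<in> tspan G"

lemma tspan_base: "u \<in> G \<Longrightarrow> u \<in> tspan G"
  using tspan.scale[of u G 1] by (simp add: scalar_word_hom)

lemma tspan_eqv: "a \<in> tspan G \<Longrightarrow> b \<sim>\<^sub>I a \<Longrightarrow> b \<in> tspan G"
  using tspan.add[OF _ tspan.ideal, of a G "b - a"] by (simp add: eqv_def)

lemma tspan_left:
  assumes "\<And>u. u \<in> G \<Longrightarrow> x * u \<in> tspan H" "\<And>c a. a \<in> tspan H \<Longrightarrow> scalar_word c * a \<in> tspan H"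
  shows "a \<in> tspan G \<Longrightarrow> x * a \<in> tspan H"
proof (induction rule: tspan.induct)
  case (ideal a)
  then show ?case by (intro tspan.ideal reduced_ideal_closed)
next
  case (scale u c)
  then show ?case using assms by (simp add: scalar_word_left_commute)
qed (simp add: distrib_left tspan.add)

lemma tspan_smult: "a \<in> tspan G \<Longrightarrow> scalar_word c * a \<in> tspan G"
proof (induction rule: tspan.induct)
  case (ideal a)
  then show ?case by (intro tspan.ideal reduced_ideal_closed)
next
  case (scale u d)
  then show ?case using tspan.scale[of u G "c * d"] by (simp add: scalar_word_hom mult.assoc)
qed (simp add: distrib_left tspan.add)

lemma tspan_minus: "a \<in> tspan G \<Longrightarrow> - a \<in> tspan G"
  using tspan_smult[of a G "-1"] by (simp add: scalar_word_hom)

lemma tspan_diff: "a \<in> tspan G \<Longrightarrow> b \<in> tspan G \<Longrightarrow> a - b \<in> tspan G"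
  using tspan.add[OF _ tspan_minus, of a G b] by simp

lemma tspan_trans:
  assumes "\<And>u. u \<in> G \<Longrightarrow> u \<in> tspan H" shows "a \<in> tspan G \<Longrightarrow> a \<in> tspan H"
  by (induction rule: tspan.induct) (auto intro: tspan.intros assms tspan_smult)

text \<open>h stands on the right so that it acts first, as a scalar on a basis vector; E and F then
  only shift the index and contribute a product of coefficients.\<close>

definition pbw :: "nat \<Rightarrow> nat \<Rightarrow> nat \<Rightarrow> 'k words" where
  "pbw i k j = tF ^ i * (tE ^ k * tH ^ j)"

definition PBW :: "'k words set" where
  "PBW = {pbw i k j | i k j. True}"

lemma pbw_in_span: "pbw i k j \<in> tspan PBW"
  by (rule tspan_base) (auto simp: PBW_def)

lemma PBW_left: "(\<And>i k j. x * pbw i k j \<in> tspan PBW) \<Longrightarrow> a \<in> tspan PBW \<Longrightarrow> x * a \<in> tspan PBW"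
  by (rule tspan_left[of PBW]) (auto simp: PBW_def intro: tspan_smult)

lemma H_E_power: "tH * tE ^ k \<sim>\<^sub>I tE ^ k * tH + scalar_word (of_nat k) * tE ^ k"
proof (induction k)
  case (Suc k)
  have "tH * tE ^ Suc k = (tH * tE) * tE ^ k" by (simp add: mult.assoc)
  also have "\<dots> \<sim>\<^sub>I (tE * tH + tE) * tE ^ k" by (rule eqv_right[OF eqv_relations(4)])
  also have "\<dots> = tE * (tH * tE ^ k) + tE ^ Suc k" by (simp add: distrib_right mult.assoc)
  also have "\<dots> \<sim>\<^sub>I tE * (tE ^ k * tH + scalar_word (of_nat k) * tE ^ k) + tE ^ Suc k"
    by (intro eqv_add eqv_left Suc eqv_refl)
  also have "\<dots> = tE ^ Suc k * tH + scalar_word (of_nat (Suc k)) * tE ^ Suc k"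
    by (simp add: distrib_left distrib_right mult.assoc scalar_word_left_commute scalar_word_hom add_ac)
  finally show ?case .
qed (simp add: scalar_word_hom)

lemma F_pbw: "tF * pbw i k j \<in> tspan PBW"
  using pbw_in_span[of "Suc i" k j] by (simp add: pbw_def mult.assoc)

lemma H_pbw: "tH * pbw i k j \<in> tspan PBW"
proof (induction i)
  case 0
  have "tH * pbw 0 k j = (tH * tE ^ k) * tH ^ j" by (simp add: pbw_def mult.assoc)
  also have "\<dots> \<sim>\<^sub>I (tE ^ k * tH + scalar_word (of_nat k) * tE ^ k) * tH ^ j"
    by (rule eqv_right[OF H_E_power])
  also have "\<dots> = pbw 0 k (Suc j) + scalar_word (of_nat k) * pbw 0 k j"
    by (simp add: pbw_def distrib_right mult.assoc)
  finally show ?case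
    by (rule tspan_eqv[OF tspan.add[OF pbw_in_span tspan_smult[OF pbw_in_span]]])
next
  case (Suc i)
  have "tH * pbw (Suc i) k j = (tH * tF) * pbw i k j" by (simp add: pbw_def mult.assoc)
  also have "\<dots> \<sim>\<^sub>I (tF * tH - tF) * pbw i k j" by (rule eqv_right[OF eqv_relations(5)])
  also have "\<dots> = tF * (tH * pbw i k j) - tF * pbw i k j" by (simp add: left_diff_distrib mult.assoc)
  finally show ?case
    by (rule tspan_eqv[OF tspan_diff[OF PBW_left[OF F_pbw Suc] F_pbw]])
qed

lemma E_pbw: "tE * pbw i k j \<in> tspan PBW"
proof (induction i)
  case 0
  then show ?case using pbw_in_span[of 0 "Suc k" j] by (simp add: pbw_def mult.assoc)
next
  case (Suc i)
  have "tE * pbw (Suc i) k j = (tE * tF) * pbw i k j" by (simp add: pbw_def mult.assoc)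
  also have "\<dots> \<sim>\<^sub>I (tH - tF * tE) * pbw i k j" by (rule eqv_right[OF eqv_relations(3)])
  also have "\<dots> = tH * pbw i k j - tF * (tE * pbw i k j)" by (simp add: left_diff_distrib mult.assoc)
  finally show ?case
    by (rule tspan_eqv[OF tspan_diff[OF H_pbw PBW_left[OF F_pbw Suc]]])
qed

text \<open>The span contains 1 and is stable under left multiplication by E, F and h, hence also by
  e and f, which are congruent to E^2 and -F^2.\<close>

lemma span_PBW: "a \<in> tspan PBW"
proof (induction a rule: tensor_induct)
  case 1
  then show ?case using pbw_in_span[of 0 0 0] by (simp add: pbw_def)
next
  case (4 b a)
  have E: "tE * a \<in> tspan PBW" and F: "tF * a \<in> tspan PBW" and H: "tH * a \<in> tspan PBW"
    if "a \<in> tspan PBW" for a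
    using PBW_left[OF E_pbw that] PBW_left[OF F_pbw that] PBW_left[OF H_pbw that] .
  show ?case
  proof (cases b)
    case e_b
    have "gen e_b * a \<sim>\<^sub>I tE * (tE * a)"
      using eqv_right[OF eqv_relations(1), of a] by (simp add: mult.assoc)
    from tspan_eqv[OF E[OF E[OF 4]] this] show ?thesis using e_b by simp
  next
    case f_b
    have "gen f_b * a \<sim>\<^sub>I - (tF * (tF * a))"
      using eqv_right[OF eqv_relations(2), of a] by (simp add: mult.assoc)
    from tspan_eqv[OF tspan_minus[OF F[OF F[OF 4]]] this] show ?thesis using f_b by simp
  qed (use E F H 4 in auto)
qed (auto intro: tspan.add tspan_smult)

definition box :: "(nat \<times> nat \<times> nat) set" where
  "box = {..<2 * CHAR('k)} \<times> {..<2 * CHAR('k)} \<times> {..<CHAR('k)}"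

text \<open>Nilpotency bounds the exponents of F and E. The relation h^p = h + \<chi>(h)^p replaces
  the exponent j by j - p + 1 and j - p, whence the induction on j.\<close>

lemma pbw_box: "pbw i k j \<in> tspan ((\<lambda>(i, k, j). pbw i k j) ` box)" (is "_ \<in> ?S")
proof (induction j rule: less_induct)
  case (less j)
  have zero: "pbw i k j \<in> ?S" if "2 * CHAR('k) \<le> i \<or> 2 * CHAR('k) \<le> k"
  proof -
    have "tF ^ i \<sim>\<^sub>I 0" if "2 * CHAR('k) \<le> i"
      using eqv_right[OF eqv_powers(2), of "tF ^ (i - 2 * CHAR('k))"] that by (simp flip: power_add)
    moreover have "tE ^ k \<sim>\<^sub>I 0" if "2 * CHAR('k) \<le> k"
      using eqv_right[OF eqv_powers(1), of "tE ^ (k - 2 * CHAR('k))"] that by (simp flip: power_add)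
    ultimately have "pbw i k j \<sim>\<^sub>I 0"
      using that eqv_right[of "tF ^ i" 0 "tE ^ k * tH ^ j"] eqv_left[OF eqv_right[of "tE ^ k" 0 "tH ^ j"], of "tF ^ i"]
      by (auto simp: pbw_def)
    then show ?thesis by (simp add: eqv_zero tspan.ideal)
  qed
  show ?case
  proof (cases "j < CHAR('k)")
    case True
    show ?thesis
    proof (cases "2 * CHAR('k) \<le> i \<or> 2 * CHAR('k) \<le> k")
      case False
      then have "(i, k, j) \<in> box" using True by (simp add: box_def)
      then show ?thesis by (intro tspan_base) force
    qed (rule zero)
  next
    case False
    let ?j = "j - CHAR('k)" and ?s = "scalar_word (\<chi> (basis_vec h_b) ^ CHAR('k))"
    have lt: "Suc ?j < j" "?j < j" using False CHAR_gt_2 by auto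
    have "tH ^ j = tH ^ CHAR('k) * tH ^ ?j" using False by (simp flip: power_add)
    also have "\<dots> \<sim>\<^sub>I (tH + ?s) * tH ^ ?j" by (rule eqv_right[OF eqv_powers(3)])
    also have "\<dots> = tH ^ Suc ?j + ?s * tH ^ ?j" by (simp add: distrib_right)
    finally have "pbw i k j \<sim>\<^sub>I tF ^ i * (tE ^ k * (tH ^ Suc ?j + ?s * tH ^ ?j))"
      unfolding pbw_def by (intro eqv_left)
    also have "\<dots> = pbw i k (Suc ?j) + ?s * pbw i k ?j"
      by (simp add: pbw_def distrib_left scalar_word_left_commute)
    finally show ?thesis
      by (rule tspan_eqv[OF tspan.add[OF less(1)[OF lt(1)] tspan_smult[OF less(1)[OF lt(2)]]]])
  qed
qed

lemma span_coeffs: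
  assumes "finite A" "a \<in> tspan (u ` A)"
  shows "\<exists>c. a \<sim>\<^sub>I (\<Sum>x\<in>A. scalar_word (c x) * u x)"
  using assms(2)
proof (induction rule: tspan.induct)
  case (ideal a)
  then show ?case by (intro exI[of _ "\<lambda>_. 0"]) (simp add: scalar_word_hom eqv_zero)
next
  case (add a b)
  then obtain c d where "a \<sim>\<^sub>I (\<Sum>x\<in>A. scalar_word (c x) * u x)" "b \<sim>\<^sub>I (\<Sum>x\<in>A. scalar_word (d x) * u x)"
    by blast
  from eqv_add[OF this] show ?case
    by (intro exI[of _ "\<lambda>x. c x + d x"]) (simp add: scalar_word_hom distrib_right sum.distrib)
next
  case (scale v c)
  then obtain x where x: "x \<in> A" "v = u x" by auto
  have "(\<Sum>y\<in>A. scalar_word (if y = x then c else 0) * u y) = (\<Sum>y\<in>A. if y = x then scalar_word c * u y else 0)"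
    by (intro sum.cong refl) (simp add: scalar_word_hom)
  then show ?case using x assms(1) by (intro exI[of _ "\<lambda>y. if y = x then c else 0"]) simp
qed

lemma pbw_expansion:
  obtains c where "a \<sim>\<^sub>I (\<Sum>(i, k, j)\<in>box. scalar_word (c i k j) * pbw i k j)"
proof -
  have "a \<in> tspan ((\<lambda>(i, k, j). pbw i k j) ` box)"
    by (rule tspan_trans[OF _ span_PBW]) (use pbw_box in \<open>auto simp: PBW_def\<close>)
  then obtain c where "a \<sim>\<^sub>I (\<Sum>x\<in>box. scalar_word (c x) * (case x of (i, k, j) \<Rightarrow> pbw i k j))"
    using span_coeffs[of box a "\<lambda>(i, k, j). pbw i k j"] by (auto simp: box_def)
  then show ?thesis
    by (intro that[of "\<lambda>i k j. c (i, k, j)"]) (simp add: case_prod_unfold)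
qed

subsection \<open>Matrix entries\<close>

text \<open>The coefficient of v_n in a v_m: the column index precedes the row index.\<close>

definition entry :: "'k words \<Rightarrow> 'k \<Rightarrow> nat \<Rightarrow> nat \<Rightarrow> 'k" where
  "entry a l m n = app (verma_rep l a) (delta m) n"

lemma entry_add: "entry (a + b) l m n = entry a l m n + entry b l m n"
  and entry_diff: "entry (a - b) l m n = entry a l m n - entry b l m n"
  and entry_scalar: "entry (scalar_word c * a) l m n = c * entry a l m n"
  and entry_0: "entry 0 l m n = 0"
  by (simp_all add: entry_def verma.W_add verma.W_diff verma.W_mult verma.W_scalar_word)

lemma entry_sum: "entry (sum f A) l m n = (\<Sum>i\<in>A. entry (f i) l m n)"
  by (induction A rule: infinite_finite_induct) (simp_all add: entry_add entry_0)

lemma entry_eqv: "a \<sim>\<^sub>I b \<Longrightarrow> l \<in> weights \<chi> \<Longrightarrow> entry a l m n = entry b l m n"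
  by (simp add: entry_def eqv_verma_rep)

text \<open>Any \<open>x\<close> acting on v_m by a scalar is allowed, so as to cover both the
  powers of h and the polynomial in h that singles out a weight. F^i E^k sends v_m to a multiple of
  v_(m-k+i), and \<open>n - i\<close> is the intermediate index m - k.\<close>

lemma entry_F_E:
  assumes n: "n < 2 * CHAR('k)" and x: "app (verma_rep l x) (delta m) = app (scal d) (delta m)"
  shows "entry (tF ^ i * (tE ^ k * x)) l m n =
    (if i \<le> n \<and> n - i + k = m then d * (\<Prod>t=1..k. verma_coeff l (n - i + t)) else 0)"
proof -
  have "entry (tF ^ i * (tE ^ k * x)) l m n =
      app (verma_F ^ i) (app (verma_E l ^ k) (app (scal d) (delta m))) n"
    by (simp add: entry_def verma.W_mult verma.W_power verma_rep_gen x)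
  then show ?thesis
    using n CHAR_gt_2 by (simp add: verma_F_power verma_E_power delta_def)
qed

lemma verma_H_delta: "app (verma_rep l (tH ^ j)) (delta m) = app (scal ((l - of_nat m) ^ j)) (delta m)"
  by (auto simp: fun_eq_iff verma.W_power verma_rep_gen verma_H_power delta_def)

lemma entry_pbw:
  assumes "n < 2 * CHAR('k)"
  shows "entry (pbw i k j) l m n = (if i \<le> n \<and> n - i + k = m
    then (l - of_nat m) ^ j * (\<Prod>t=1..k. verma_coeff l (n - i + t)) else 0)"
  unfolding pbw_def by (rule entry_F_E[OF assms verma_H_delta])

lemma verma_prod_nz: "l \<in> weights \<chi> \<Longrightarrow> k < 2 * CHAR('k) \<Longrightarrow> (\<Prod>t=1..k. verma_coeff l t) \<noteq> 0"
  using verma_coeff_nz by auto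

text \<open>In column k the monomials with E-exponent above k vanish, and those below k have
  coefficient zero by induction. For the exponent k itself, E^k v_k is a nonzero multiple of v_0,
  which F^i puts into row i. The entry in row i is therefore, up to that multiple, a polynomial of
  degree below p in l - k, and the p weights supply p zeros.\<close>

theorem entries_zero:
  assumes zero: "\<And>l m n. l \<in> weights \<chi> \<Longrightarrow> m < 2 * CHAR('k) \<Longrightarrow> n < 2 * CHAR('k) \<Longrightarrow> entry a l m n = 0"
  shows "a \<in> I"
proof -
  let ?N = "2 * CHAR('k)"
  obtain c where c: "a \<sim>\<^sub>I (\<Sum>(i, k, j)\<in>box. scalar_word (c i k j) * pbw i k j)" by (rule pbw_expansion)
  have "\<forall>i<?N. \<forall>j<CHAR('k). c i k j = 0" if "k < ?N" for k
    using that
  proof (induction k rule: less_induct)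
    case (less k)
    show ?case
    proof (intro allI impI)
      fix i j assume i: "i < ?N" and j: "j < CHAR('k)"
      show "c i k j = 0"
      proof (rule polynomial_coeffs_zero[OF _ _ _ j])
        let ?A = "(\<lambda>l. l - of_nat k) ` weights \<chi>"
        show "finite ?A" using finite_weights by simp
        show "CHAR('k) \<le> card ?A" using weights_card by (subst card_image) (auto simp: inj_on_def)
        fix x assume "x \<in> ?A"
        then obtain l where l: "l \<in> weights \<chi>" "x = l - of_nat k" by auto
        let ?t = "\<lambda>i' k' j'. c i' k' j' * entry (pbw i' k' j') l k i"
        have "0 = entry a l k i" using zero l i less.prems by simp
        also have "\<dots> = (\<Sum>(i', k', j')\<in>box. ?t i' k' j')"
          unfolding entry_eqv[OF c l(1)] entry_sum by (intro sum.cong refl) (auto simp: entry_scalar)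
        also have "\<dots> = (\<Sum>y\<in>{i} \<times> {k} \<times> {..<CHAR('k)}. case y of (i', k', j') \<Rightarrow> ?t i' k' j')"
        proof (rule sum.mono_neutral_right)
          show "finite box" by (simp add: box_def)
          show "{i} \<times> {k} \<times> {..<CHAR('k)} \<subseteq> box" using i less.prems by (auto simp: box_def)
          show "\<forall>y\<in>box - {i} \<times> {k} \<times> {..<CHAR('k)}. (case y of (i', k', j') \<Rightarrow> ?t i' k' j') = 0"
          proof
            fix z assume z: "z \<in> box - {i} \<times> {k} \<times> {..<CHAR('k)}"
            obtain i' k' j' where zz: "z = (i', k', j')" by (cases z)
            then have y: "(i', k', j') \<in> box" "(i', k', j') \<notin> {i} \<times> {k} \<times> {..<CHAR('k)}"
              using z by auto
            have "?t i' k' j' = 0"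
            proof (cases "k' < k")
              case True
              then show ?thesis using less y by (auto simp: box_def)
            next
              case False
              \<comment> \<open>For k' \<ge> k the equation i - i' + k' = k forces k' = k and i' =
                i.\<close>
              then have nz: "\<not> (i' \<le> i \<and> i - i' + k' = k)" using y by (auto simp: box_def)
              show ?thesis unfolding entry_pbw[OF i] if_not_P[OF nz] by simp
            qed
            then show "(case z of (i', k', j') \<Rightarrow> ?t i' k' j') = 0" by (simp add: zz)
          qed
        qed
        also have "\<dots> = (\<Sum>j'<CHAR('k). ?t i k j')"
          by (simp add: sum.cartesian_product[symmetric])
        also have "\<dots> = (\<Sum>j'<CHAR('k). c i k j' * x ^ j') * (\<Prod>t=1..k. verma_coeff l t)"
          by (simp add: entry_pbw[OF i] l sum_distrib_right mult.assoc)
        finally show "(\<Sum>j'<CHAR('k). c i k j' * x ^ j') = 0"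
          using verma_prod_nz[OF l(1) less.prems] by simp
      qed
    qed
  qed
  then have "(\<Sum>(i, k, j)\<in>box. scalar_word (c i k j) * pbw i k j) = 0"
    by (intro sum.neutral) (auto simp: box_def scalar_word_hom)
  then show ?thesis using c by (simp add: eqv_zero)
qed

theorem entries_surjective:
  "\<exists>a. \<forall>l\<in>weights \<chi>. \<forall>m<2 * CHAR('k). \<forall>n<2 * CHAR('k). entry a l m n = M l m n"
proof -
  let ?N = "2 * CHAR('k)"
  have "\<exists>a. \<forall>l\<in>weights \<chi>. \<forall>m<r. \<forall>n<?N. entry a l m n = M l m n" if "r \<le> ?N" for r
    using that
  proof (induction r)
    case (Suc r)
    then obtain a where a: "\<And>l m n. l \<in> weights \<chi> \<Longrightarrow> m < r \<Longrightarrow> n < ?N \<Longrightarrow> entry a l m n = M l m n"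
      by auto
    \<comment> \<open>h acts on v_r by l' - r in the module of weight l', so the base of the power
      is l' - l there, and \<open>L l\<close> acts on v_r by 1 if l' = l and by 0 for every other
      weight.\<close>
    define L where "L l = 1 - (tH - scalar_word (l - of_nat r)) ^ (CHAR('k) - 1)" for l
    define u where "u l i = tF ^ i * (tE ^ r * L l)" for l i
    have L: "app (verma_rep l' (L l)) (delta m) = app (scal (1 - (l' - of_nat m - (l - of_nat r)) ^ (CHAR('k) - 1))) (delta m)"
      for l' l m
    proof -
      have "app (verma_rep l' (tH - scalar_word (l - of_nat r)) ^ n) (delta m) =
          app (scal ((l' - of_nat m - (l - of_nat r)) ^ n)) (delta m)" for n
      proof (induction n)
        case (Suc n)
        then show ?case
          by (auto simp: verma.W_diff verma_rep_gen verma.W_scalar_word fun_eq_iff delta_def algebra_simps)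
      qed (simp add: fun_eq_iff)
      then show ?thesis
        by (simp add: L_def verma.W_diff verma.W_power fun_eq_iff algebra_simps)
    qed
    have u: "entry (u l i) l' m n = (if i \<le> n \<and> n - i + r = m
        then (1 - (l' - of_nat m - (l - of_nat r)) ^ (CHAR('k) - 1)) * (\<Prod>t=1..r. verma_coeff l' (n - i + t)) else 0)"
      if "n < ?N" for l l' i m n
      unfolding u_def by (rule entry_F_E[OF that L])
    have ur: "entry (u l i) l' r n = (if i = n \<and> l = l' then \<Prod>t=1..r. verma_coeff l' t else 0)"
      if "n < ?N" "l \<in> weights \<chi>" "l' \<in> weights \<chi>" for l l' i n
    proof -
      have "0 < CHAR('k) - 1" using CHAR_gt_2 by simp
      then show ?thesis
        using u[OF that(1), of l i l' r] weight_diff_power[OF that(3,2)] by (auto simp: power_0_left)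
    qed
    \<comment> \<open>The defect of column r, divided by the factor that E^r produces on
      v_r.\<close>
    define d where "d l i = (M l r i - entry a l r i) / (\<Prod>t=1..r. verma_coeff l t)" for l i
    define b where "b = a + (\<Sum>l\<in>weights \<chi>. \<Sum>i<?N. scalar_word (d l i) * u l i)"
    have "entry b l' m n = M l' m n" if l': "l' \<in> weights \<chi>" and m: "m < Suc r" and n: "n < ?N" for l' m n
    proof (cases "m = r")
      case False
      then have "entry (u l i) l' m n = 0" for l i using u[OF n] m by auto
      then show ?thesis using a[OF l' _ n, of m] m False by (simp add: b_def entry_add entry_sum entry_scalar)
    next
      case True
      have "(\<Sum>l\<in>weights \<chi>. \<Sum>i<?N. d l i * entry (u l i) l' r n) =
          (\<Sum>l\<in>weights \<chi>. \<Sum>i<?N. if i = n then (if l = l' then d l i * (\<Prod>t=1..r. verma_coeff l' t) else 0) else 0)"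
        by (intro sum.cong refl) (simp add: ur[OF n _ l'])
      also have "\<dots> = d l' n * (\<Prod>t=1..r. verma_coeff l' t)"
        using l' n finite_weights by (simp add: sum.delta)
      also have "\<dots> = M l' r n - entry a l' r n"
        using verma_prod_nz[OF l', of r] Suc.prems by (simp add: d_def)
      finally show ?thesis using True by (simp add: b_def entry_add entry_sum entry_scalar)
    qed
    then show ?case by blast
  qed simp
  from this[OF order_refl] show ?thesis .
qed

lemma eqv_iff_entries:
  "a \<sim>\<^sub>I b \<longleftrightarrow> (\<forall>l\<in>weights \<chi>. \<forall>m<2 * CHAR('k). \<forall>n<2 * CHAR('k). entry a l m n = entry b l m n)"
proof
  assume "\<forall>l\<in>weights \<chi>. \<forall>m<2 * CHAR('k). \<forall>n<2 * CHAR('k). entry a l m n = entry b l m n"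
  then show "a \<sim>\<^sub>I b" unfolding eqv_def by (intro entries_zero) (simp add: entry_diff)
qed (blast intro: entry_eqv)

text \<open>Modulo the left ideal generated by E and h - l every monomial becomes a multiple of some
  F^i, and the vectors F^i v_0 with i < 2p are independent. This is needed to see that the tensor
  relations of the baby Verma module kill the whole annihilator of v_0.\<close>

lemma annihilator_highest_weight:
  assumes l: "l \<in> weights \<chi>" and a: "\<And>n. n < 2 * CHAR('k) \<Longrightarrow> entry a l 0 n = 0"
  obtains x y where "a \<sim>\<^sub>I x * tE + y * (tH - scalar_word l)"
proof -
  let ?N = "2 * CHAR('k)"
  define J where "J = {a. \<exists>x y. a \<sim>\<^sub>I x * tE + y * (tH - scalar_word l)}"
  have J_eqv: "a \<in> J" if "a \<sim>\<^sub>I b" "b \<in> J" for a b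
    using that unfolding J_def by (blast intro: eqv_trans)
  have J_add: "a + b \<in> J" if "a \<in> J" "b \<in> J" for a b
  proof -
    from that obtain x y x' y' where "a \<sim>\<^sub>I x * tE + y * (tH - scalar_word l)" "b \<sim>\<^sub>I x' * tE + y' * (tH - scalar_word l)"
      by (auto simp: J_def)
    from eqv_add[OF this] have "a + b \<sim>\<^sub>I (x + x') * tE + (y + y') * (tH - scalar_word l)"
      by (simp add: distrib_right add_ac)
    then show ?thesis unfolding J_def by blast
  qed
  have J_left: "z * a \<in> J" if "a \<in> J" for a z
  proof -
    from that obtain x y where "a \<sim>\<^sub>I x * tE + y * (tH - scalar_word l)" by (auto simp: J_def)
    from eqv_left[OF this, of z] have "z * a \<sim>\<^sub>I (z * x) * tE + (z * y) * (tH - scalar_word l)"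
      by (simp add: distrib_left mult.assoc)
    then show ?thesis unfolding J_def by blast
  qed
  have J_0: "0 \<in> J" unfolding J_def by (intro CollectI exI[of _ 0]) simp
  have J_sum: "(\<Sum>x\<in>A. f x) \<in> J" if "\<And>x. x \<in> A \<Longrightarrow> f x \<in> J" for A and f :: "'b \<Rightarrow> 'k words"
    using that by (induction A rule: infinite_finite_induct) (auto intro: J_0 J_add)
  have J_E: "x * tE \<in> J" for x unfolding J_def by (intro CollectI exI[of _ x] exI[of _ 0]) simp
  have J_H: "y * (tH - scalar_word l) \<in> J" for y unfolding J_def by (intro CollectI exI[of _ 0] exI[of _ y]) simp
  have Hj: "tH ^ j - scalar_word (l ^ j) \<in> J" for j
  proof (induction j)
    case 0
    then show ?case by (simp add: scalar_word_hom J_0)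
  next
    case (Suc j)
    have "tH ^ Suc j - scalar_word (l ^ Suc j) = tH * (tH ^ j - scalar_word (l ^ j)) + scalar_word (l ^ j) * (tH - scalar_word l)"
    proof -
      have "scalar_word (l ^ Suc j) = scalar_word (l ^ j) * scalar_word l"
        by (simp only: power_Suc2 scalar_word_hom(2))
      then show ?thesis by (simp add: right_diff_distrib scalar_word_commute[of tH])
    qed
    then show ?case using J_add[OF J_left[OF Suc] J_H] by metis
  qed
  have pbw: "pbw i k j - scalar_word (if k = 0 then l ^ j else 0) * tF ^ i \<in> J" for i k j
  proof -
    have 1: "tF ^ i * (tE ^ k * (tH ^ j - scalar_word (l ^ j))) \<in> J" by (intro J_left Hj)
    show ?thesis
    proof (cases k)
      case 0
      then show ?thesis using 1 by (simp add: pbw_def right_diff_distrib scalar_word_commute)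
    next
      case (Suc k')
      have "pbw i k j = tF ^ i * (tE ^ k * (tH ^ j - scalar_word (l ^ j))) + (scalar_word (l ^ j) * (tF ^ i * tE ^ k')) * tE"
        by (simp add: pbw_def Suc right_diff_distrib scalar_word_commute scalar_word_left_commute mult.assoc power_commutes)
      then show ?thesis using J_add[OF 1 J_E] Suc by (simp add: scalar_word_hom)
    qed
  qed
  obtain c where c: "a \<sim>\<^sub>I (\<Sum>(i, k, j)\<in>box. scalar_word (c i k j) * pbw i k j)" by (rule pbw_expansion)
  \<comment> \<open>The reduction of \<open>a\<close> modulo \<open>J\<close>: monomials containing
    E drop out and h becomes l.\<close>
  define b where "b = (\<Sum>(i, k, j)\<in>box. scalar_word (c i k j) * (scalar_word (if k = 0 then l ^ j else 0) * tF ^ i))"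
  define \<alpha> where "\<alpha> n = (\<Sum>(i, k, j)\<in>box. if i = n then c i k j * (if k = 0 then l ^ j else 0) else 0)" for n
  have "(\<Sum>(i, k, j)\<in>box. scalar_word (c i k j) * pbw i k j) - b =
      (\<Sum>(i, k, j)\<in>box. scalar_word (c i k j) * (pbw i k j - scalar_word (if k = 0 then l ^ j else 0) * tF ^ i))"
    unfolding b_def sum_subtractf[symmetric] by (intro sum.cong refl) (auto simp: right_diff_distrib)
  also have "\<dots> \<in> J" by (intro J_sum) (auto intro: J_left pbw)
  finally have ab: "a - b \<in> J" using J_eqv eqv_diff[OF c eqv_refl] by blast
  have b\<alpha>: "b = (\<Sum>n<?N. scalar_word (\<alpha> n) * tF ^ n)"
  proof -
    have sw: "scalar_word (sum f A) = (\<Sum>x\<in>A. scalar_word (f x))" for f :: "'b \<Rightarrow> 'k" and A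
      by (induction A rule: infinite_finite_induct) (simp_all add: scalar_word_hom)
    have "(\<Sum>n<?N. scalar_word (\<alpha> n) * tF ^ n) =
      (\<Sum>n<?N. \<Sum>(i, k, j)\<in>box. if i = n then scalar_word (c i k j) * (scalar_word (if k = 0 then l ^ j else 0) * tF ^ i) else 0)"
      unfolding \<alpha>_def sw sum_distrib_right
      by (intro sum.cong refl) (auto simp: scalar_word_hom mult.assoc)
    also have "\<dots> = (\<Sum>(i, k, j)\<in>box. \<Sum>n<?N. if i = n then scalar_word (c i k j) * (scalar_word (if k = 0 then l ^ j else 0) * tF ^ i) else 0)"
      by (subst sum.swap) (simp add: case_prod_unfold)
    also have "\<dots> = b"
      unfolding b_def by (intro sum.cong refl) (auto simp: box_def)
    finally show ?thesis by simp
  qed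
  have entJ: "entry z l 0 n = 0" if "z \<in> J" for z n
  proof -
    from that obtain x y where z: "z \<sim>\<^sub>I x * tE + y * (tH - scalar_word l)" by (auto simp: J_def)
    have "app (verma_E l) (delta 0) = 0" "app (verma_H l - scal l) (delta 0) = 0"
      by (auto simp: fun_eq_iff delta_def verma_coeff_def)
    then show ?thesis
      unfolding entry_eqv[OF z l] entry_add
      by (simp add: entry_def verma.W_mult verma.W_diff verma_rep_gen verma.W_scalar_word del: app_ring(4))
  qed
  have "\<alpha> n = 0" if n: "n < ?N" for n
  proof -
    have Fn: "entry (tF ^ i) l 0 n = (if i = n then 1 else 0)" for i
      using entry_pbw[OF n, of i 0 0 l 0] by (auto simp: pbw_def)
    have "0 = entry b l 0 n" using entJ[OF ab, of n] a[OF n] by (simp add: entry_diff)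
    also have "\<dots> = (\<Sum>i<?N. if i = n then \<alpha> i else 0)"
      unfolding b\<alpha> entry_sum by (intro sum.cong refl) (simp add: entry_scalar Fn)
    also have "\<dots> = \<alpha> n" using n by simp
    finally show ?thesis by simp
  qed
  then have "b = 0" unfolding b\<alpha> by (intro sum.neutral) (simp add: scalar_word_hom)
  then have "a \<in> J" using ab by simp
  then show ?thesis using that unfolding J_def by blast
qed

lemma entry_parity:
  assumes "a \<in> tensor_part UNIV j" "entry a l m n \<noteq> 0" shows "of_nat m + of_nat n = j"
proof -
  have "delta m \<in> parity_space (of_nat m)" by (auto simp: parity_space_def delta_def)
  from verma_rep_parity[OF assms(1) this, of l] have "of_nat n = of_nat m + j"
    using assms(2) by (auto simp: parity_space_def entry_def)
  then show ?thesis by (cases j; cases "of_nat m :: bit") simp_all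
qed

text \<open>The two parity components of a preimage have their nonzero entries at disjoint
  positions, so the component of parity j already has the prescribed entries.\<close>

lemma entries_surjective_homog:
  assumes "\<And>l m n. M l m n \<noteq> 0 \<Longrightarrow> of_nat m + of_nat n = j"
  shows "\<exists>a\<in>tensor_part UNIV j. \<forall>l\<in>weights \<chi>. \<forall>m<2 * CHAR('k). \<forall>n<2 * CHAR('k). entry a l m n = M l m n"
proof -
  obtain a where a: "\<forall>l\<in>weights \<chi>. \<forall>m<2 * CHAR('k). \<forall>n<2 * CHAR('k). entry a l m n = M l m n"
    using entries_surjective by blast
  obtain a0 a1 where a01: "a0 \<in> tensor_part UNIV 0" "a1 \<in> tensor_part UNIV 1" "a = a0 + a1"
    by (rule parity_part_decomp)
  define b b' where "b = (if j = 0 then a0 else a1)" and "b' = (if j = 0 then a1 else a0)"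
  have b: "b \<in> tensor_part UNIV j" "b' \<in> tensor_part UNIV (j + 1)" "a = b + b'"
    using a01 by (cases j; simp add: b_def b'_def add.commute)+
  have "entry b l m n = M l m n" if lmn: "l \<in> weights \<chi>" "m < 2 * CHAR('k)" "n < 2 * CHAR('k)" for l m n
  proof (cases "of_nat m + of_nat n = j")
    case True
    moreover have "j \<noteq> j + 1" by (cases j) simp_all
    ultimately have "entry b' l m n = 0" using entry_parity[OF b(2)] by metis
    moreover have "entry b l m n + entry b' l m n = M l m n"
      using a lmn by (simp only: b(3) entry_add)
    ultimately show ?thesis by simp
  next
    case False
    then have "entry b l m n = 0" "M l m n = 0" using entry_parity[OF b(1)] assms by blast+
    then show ?thesis by simp
  qed
  then show ?thesis using b(1) by blast
qed

section \<open>The reduced enveloping algebra\<close>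

abbreviation "U \<equiv> U_osp \<chi>"

definition cl :: "'k words \<Rightarrow> 'k words set" where
  "cl a = {x. x \<sim>\<^sub>I a}"

lemma cl_coset: "I +>\<^bsub>tensor_algebra UNIV\<^esub> a = cl a"
proof -
  have "x \<in> (\<Union>h\<in>I. {h + a}) \<longleftrightarrow> x - a \<in> I" for x
    by (auto intro: bexI[of _ "x - a"])
  then show ?thesis by (auto simp: a_r_coset_def r_coset_def cl_def eqv_def)
qed

lemma cl_eq_iff: "cl a = cl b \<longleftrightarrow> a \<sim>\<^sub>I b"
  unfolding cl_def using eqv_trans eqv_sym eqv_refl by blast

lemma mem_cl: "a \<in> cl a"
  by (simp add: cl_def)

lemma cl_eqI: "x \<in> cl a \<Longrightarrow> cl x = cl a"
  unfolding cl_eq_iff by (simp add: cl_def)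

interpretation T: ideal I "tensor_algebra UNIV"
  by (rule reduced_ideal_UNIV)

lemma carrier_U: "carrier U = range cl"
  by (auto simp: reduced_enveloping_def Let_def FactRing_def A_RCOSETS_def' cl_coset)

lemma cl_in_U [simp]: "cl a \<in> carrier U"
  by (simp add: carrier_U)

lemma U_cases: "X \<in> carrier U \<Longrightarrow> (\<And>a. X = cl a \<Longrightarrow> P) \<Longrightarrow> P"
  by (auto simp: carrier_U)

lemma U_add [simp]: "cl a \<oplus>\<^bsub>U\<^esub> cl b = cl (a + b)"
  using T.a_rcos_sum[of a b] by (simp add: reduced_enveloping_def Let_def FactRing_def cl_coset)

lemma U_mult [simp]: "cl a \<otimes>\<^bsub>U\<^esub> cl b = cl (a * b)"
  using T.rcoset_mult_add[of a b] by (simp add: reduced_enveloping_def Let_def FactRing_def cl_coset)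

lemma U_one: "\<one>\<^bsub>U\<^esub> = cl 1"
  by (simp add: reduced_enveloping_def Let_def FactRing_def cl_coset)

lemma U_zero: "\<zero>\<^bsub>U\<^esub> = cl 0"
  by (auto simp: reduced_enveloping_def Let_def FactRing_def cl_def eqv_zero)

lemma U_smult [simp]: "c \<odot>\<^bsub>U\<^esub> cl a = cl (scalar_word c * a)"
  using T.rcoset_mult_add[of "scalar_word c" a] by (simp add: reduced_enveloping_def Let_def FactRing_def cl_coset)

lemma U_homog: "homog U i = cl ` tensor_part UNIV i"
  by (auto simp: reduced_enveloping_def Let_def cl_coset)

lemma ring_U: "ring U"
proof (intro ringI abelian_groupI monoidI)
  fix X assume "X \<in> carrier U"
  then obtain a where a: "X = cl a" by (rule U_cases)
  show "\<exists>Y\<in>carrier U. Y \<oplus>\<^bsub>U\<^esub> X = \<zero>\<^bsub>U\<^esub>"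
    by (intro bexI[of _ "cl (- a)"]) (simp_all add: a U_zero)
qed (auto elim!: U_cases simp: U_one U_zero algebra_simps)

lemma U_a_inv: "\<ominus>\<^bsub>U\<^esub> cl a = cl (- a)"
  by (rule abelian_group.minus_equality[OF ring.is_abelian_group[OF ring_U]]) (simp_all add: U_zero)

subsection \<open>Entries of products\<close>

text \<open>The baby Verma module itself: of the copies making up the functions on the naturals, the
  one supported below 2p.\<close>

definition Zspace :: "(nat \<Rightarrow> 'k) set" where
  "Zspace = {g. \<forall>n\<ge>2 * CHAR('k). g n = 0}"

lemma Zspace_0 [simp]: "0 \<in> Zspace"
  by (simp add: Zspace_def)

lemma Zspace_add: "g \<in> Zspace \<Longrightarrow> g' \<in> Zspace \<Longrightarrow> g + g' \<in> Zspace"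
  by (simp add: Zspace_def)

lemma Zspace_uminus: "g \<in> Zspace \<Longrightarrow> - g \<in> Zspace"
  by (simp add: Zspace_def)

lemma Zspace_eqI: "g \<in> Zspace \<Longrightarrow> g' \<in> Zspace \<Longrightarrow> (\<And>n. n < 2 * CHAR('k) \<Longrightarrow> g n = g' n) \<Longrightarrow> g = g'"
  unfolding Zspace_def by (intro ext) (metis (mono_tags, lifting) mem_Collect_eq not_le)

lemma delta_in_Zspace: "m < 2 * CHAR('k) \<Longrightarrow> delta m \<in> Zspace"
  by (simp add: Zspace_def delta_def)

lemma Zspace_decomp: "g \<in> Zspace \<Longrightarrow> g = (\<Sum>m<2 * CHAR('k). app (scal (g m)) (delta m))"
proof (rule ext)
  fix n assume g: "g \<in> Zspace"
  have s: "(\<Sum>m\<in>A. f m) n = (\<Sum>m\<in>A. f m n)" for A and f :: "nat \<Rightarrow> nat \<Rightarrow> 'k"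
    by (induction A rule: infinite_finite_induct) simp_all
  have "(\<Sum>m<2 * CHAR('k). g m * delta m n) = (\<Sum>m<2 * CHAR('k). if m = n then g m else 0)"
    by (intro sum.cong refl) (simp add: delta_def)
  also have "\<dots> = g n" using g by (simp add: Zspace_def)
  finally show "g n = (\<Sum>m<2 * CHAR('k). app (scal (g m)) (delta m)) n" by (simp add: s)
qed

lemma verma_op_Zspace:
  assumes g: "g \<in> Zspace" shows "app (verma_op l b) g \<in> Zspace"
proof -
  have E: "app (verma_E l) g \<in> Zspace" if "g \<in> Zspace" for g
    using that by (simp add: Zspace_def)
  have F: "app verma_F g \<in> Zspace" if "g \<in> Zspace" for g
  proof -
    have "g (n - 1) = 0" if "2 * CHAR('k) \<le> n" "\<not> 2 * CHAR('k) dvd n" for n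
    proof -
      have "n \<noteq> 2 * CHAR('k)" using that by auto
      then show ?thesis using that \<open>g \<in> Zspace\<close> by (simp add: Zspace_def)
    qed
    then show ?thesis by (simp add: Zspace_def)
  qed
  have H: "app (verma_H l) g \<in> Zspace" using g by (simp add: Zspace_def)
  show ?thesis using E[OF E[OF g]] E[OF g] F[OF g] Zspace_uminus[OF F[OF F[OF g]]] H by (cases b) simp_all
qed

lemma verma_rep_Zspace:
  assumes g: "g \<in> Zspace" shows "app (verma_rep l a) g \<in> Zspace"
proof -
  have w: "app (prod_list (map (verma_op l) w)) g \<in> Zspace" for w
    by (induction w) (simp_all add: g verma_op_Zspace)
  have c: "app (scal c * prod_list (map (verma_op l) w)) g \<in> Zspace" for c w
    using w[of w] by (simp add: Zspace_def)
  have sum: "sum f A \<in> Zspace" if "\<And>x. f x \<in> Zspace" for f :: "osp_basis list \<Rightarrow> nat \<Rightarrow> 'k" and A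
    using that by (induction A rule: infinite_finite_induct) (auto intro: Zspace_add)
  show ?thesis unfolding verma.W_def app_sum_left by (rule sum) (rule c)
qed

lemma verma_rep_entries:
  assumes g: "g \<in> Zspace"
  shows "app (verma_rep l a) g n = (\<Sum>m<2 * CHAR('k). g m * entry a l m n)"
proof -
  have s: "(\<Sum>m\<in>A. f m) n = (\<Sum>m\<in>A. f m n)" for A and f :: "nat \<Rightarrow> nat \<Rightarrow> 'k"
    by (induction A rule: infinite_finite_induct) simp_all
  have c: "app (verma_rep l a) (app (scal c) g) = app (scal c) (app (verma_rep l a) g)" for c g
  proof -
    have "verma_rep l a * scal c = scal c * verma_rep l a"
      using scalar_word_commute[of a c] by (metis verma.W_mult verma.W_scalar_word)
    then show ?thesis by (metis app_ring(6))
  qed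
  have "app (verma_rep l a) g n = app (verma_rep l a) (\<Sum>m<2 * CHAR('k). app (scal (g m)) (delta m)) n"
    using Zspace_decomp[OF g] by simp
  also have "\<dots> = (\<Sum>m<2 * CHAR('k). g m * entry a l m n)"
    by (simp only: app_sum c s app_scal entry_def)
  finally show ?thesis .
qed

lemma entry_mult:
  assumes "m < 2 * CHAR('k)"
  shows "entry (a * b) l m n = (\<Sum>r<2 * CHAR('k). entry b l m r * entry a l r n)"
proof -
  have "app (verma_rep l b) (delta m) \<in> Zspace"
    by (rule verma_rep_Zspace[OF delta_in_Zspace[OF assms]])
  from verma_rep_entries[OF this, of l a n] show ?thesis by (simp add: entry_def verma.W_mult)
qed

lemma entry_1: "entry 1 l m n = (if n = m then 1 else 0)"
  by (simp add: entry_def delta_def)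

section \<open>The matrix decomposition\<close>

definition entry_mat :: "'k words \<Rightarrow> 'k \<Rightarrow> 'k mat" where
  "entry_mat a l = mat (2 * CHAR('k)) (2 * CHAR('k)) (\<lambda>(i, j). entry a l j i)"

lemma entry_mat_eq_iff:
  "entry_mat a l = entry_mat b l \<longleftrightarrow> (\<forall>m<2 * CHAR('k). \<forall>n<2 * CHAR('k). entry a l m n = entry b l m n)"
proof
  assume eq: "entry_mat a l = entry_mat b l"
  show "\<forall>m<2 * CHAR('k). \<forall>n<2 * CHAR('k). entry a l m n = entry b l m n"
  proof (intro allI impI)
    fix m n assume "m < 2 * CHAR('k)" "n < 2 * CHAR('k)"
    moreover have "entry_mat a l $$ (n, m) = entry_mat b l $$ (n, m)" using eq by simp
    ultimately show "entry a l m n = entry b l m n" by (simp add: entry_mat_def)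
  qed
qed (auto simp: entry_mat_def intro!: cong_mat)

lemma entry_mat_mult: "entry_mat (a * b) l = entry_mat a l * entry_mat b l"
  by (rule eq_matI) (auto simp: entry_mat_def entry_mult scalar_prod_def atLeast0LessThan mult.commute intro!: sum.cong)

lemma cl_entry_mat:
  "cl a = cl b \<longleftrightarrow> (\<forall>l\<in>weights \<chi>. entry_mat a l = entry_mat b l)"
  by (auto simp: cl_eq_iff eqv_iff_entries entry_mat_eq_iff)

text \<open>\<open>the_elem\<close> is justified because congruent elements have equal matrices at
  every weight.\<close>

definition to_matrices :: "'k words set \<Rightarrow> 'k \<Rightarrow> 'k mat" where
  "to_matrices X = (\<lambda>l\<in>weights \<chi>. the_elem ((\<lambda>a. entry_mat a l) ` X))"

lemma to_matrices_cl: "to_matrices (cl a) = (\<lambda>l\<in>weights \<chi>. entry_mat a l)"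
proof (rule ext)
  fix l
  have "(\<lambda>b. entry_mat b l) ` cl a = {entry_mat a l}" if "l \<in> weights \<chi>"
    using that mem_cl[of a] cl_eqI[of _ a] cl_entry_mat by blast
  then show "to_matrices (cl a) l = (\<lambda>l\<in>weights \<chi>. entry_mat a l) l"
    by (simp add: to_matrices_def)
qed

lemma U_matrices:
  "algebra_isomorphic U (direct_sum_algebra (weights \<chi>)
    (\<lambda>_. module_mat TYPE('k) (2 * CHAR('k)) (2 * CHAR('k))))" (is "algebra_isomorphic U ?D")
  unfolding algebra_isomorphic_def
proof (intro bexI[of _ to_matrices] conjI allI ballI)
  show "to_matrices \<in> ring_iso U ?D"
  proof (rule ring_iso_memI)
    fix X assume "X \<in> carrier U"
    then obtain a where a: "X = cl a" by (rule U_cases)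
    show "to_matrices X \<in> carrier ?D"
      by (auto simp: a to_matrices_cl direct_sum_algebra_def module_mat_simps entry_mat_def)
    fix Y assume "Y \<in> carrier U"
    then obtain b where b: "Y = cl b" by (rule U_cases)
    show "to_matrices (X \<otimes>\<^bsub>U\<^esub> Y) = to_matrices X \<otimes>\<^bsub>?D\<^esub> to_matrices Y"
      by (auto simp: a b to_matrices_cl direct_sum_algebra_def module_mat_simps entry_mat_mult restrict_def)
    show "to_matrices (X \<oplus>\<^bsub>U\<^esub> Y) = to_matrices X \<oplus>\<^bsub>?D\<^esub> to_matrices Y"
      by (auto simp: a b to_matrices_cl direct_sum_algebra_def module_mat_simps entry_mat_def
          entry_add restrict_def fun_eq_iff intro!: eq_matI)
  next
    show "to_matrices \<one>\<^bsub>U\<^esub> = \<one>\<^bsub>?D\<^esub>"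
      by (auto simp: U_one to_matrices_cl direct_sum_algebra_def module_mat_simps entry_mat_def
          entry_1 restrict_def fun_eq_iff intro!: eq_matI)
    show "bij_betw to_matrices (carrier U) (carrier ?D)"
    proof (rule bij_betw_imageI)
      show "inj_on to_matrices (carrier U)"
      proof (rule inj_onI)
        fix X Y assume "X \<in> carrier U" "Y \<in> carrier U" and eq: "to_matrices X = to_matrices Y"
        then obtain a b where ab: "X = cl a" "Y = cl b" by (auto elim!: U_cases)
        have "entry_mat a l = entry_mat b l" if "l \<in> weights \<chi>" for l
          using fun_cong[OF eq, of l] that by (simp add: ab to_matrices_cl)
        then show "X = Y" by (simp add: ab cl_entry_mat)
      qed
      show "to_matrices ` carrier U = carrier ?D"
      proof
        show "to_matrices ` carrier U \<subseteq> carrier ?D"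
          by (auto elim!: U_cases simp: to_matrices_cl direct_sum_algebra_def module_mat_simps entry_mat_def)
        show "carrier ?D \<subseteq> to_matrices ` carrier U"
        proof
          fix M assume M: "M \<in> carrier ?D"
          then have M': "M l \<in> carrier_mat (2 * CHAR('k)) (2 * CHAR('k))" if "l \<in> weights \<chi>" for l
            using that by (auto simp: direct_sum_algebra_def module_mat_simps)
          obtain a where a: "\<forall>l\<in>weights \<chi>. \<forall>m<2 * CHAR('k). \<forall>n<2 * CHAR('k). entry a l m n = M l $$ (n, m)"
            using entries_surjective[of "\<lambda>l m n. M l $$ (n, m)"] by blast
          have "to_matrices (cl a) = M"
          proof (rule ext)
            fix l
            show "to_matrices (cl a) l = M l"
            proof (cases "l \<in> weights \<chi>")
              case True
              have "entry_mat a l = M l"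
                by (rule eq_matI) (use M'[OF True] a True in \<open>auto simp: entry_mat_def\<close>)
              then show ?thesis using True by (simp add: to_matrices_cl)
            next
              case False
              then show ?thesis using M by (auto simp: to_matrices_cl direct_sum_algebra_def PiE_def extensional_def)
            qed
          qed
          then show "M \<in> to_matrices ` carrier U" by (metis cl_in_U imageI)
        qed
      qed
    qed
  qed
  fix c X assume "X \<in> carrier U"
  then obtain a where a: "X = cl a" by (rule U_cases)
  show "to_matrices (c \<odot>\<^bsub>U\<^esub> X) = c \<odot>\<^bsub>?D\<^esub> to_matrices X"
    by (auto simp: a to_matrices_cl direct_sum_algebra_def module_mat_simps entry_mat_def
        entry_scalar restrict_def fun_eq_iff intro!: eq_matI)
qed

section \<open>Semisimplicity\<close>

lemma regular_module_simps [simp]: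
  "carrier (regular_module A) = carrier A" "add (regular_module A) = add A" "ring.zero (regular_module A) = ring.zero A"
  "module.smult (regular_module A) = monoid.mult A" "homog (regular_module A) = homog A"
  by (simp_all add: regular_module_def)

lemma regular_module_a_inv: "inv\<^bsub>add_monoid (regular_module A)\<^esub> x = \<ominus>\<^bsub>A\<^esub> x"
  by (simp add: a_inv_def m_inv_def)

lemma submodule_regularI:
  assumes "N \<subseteq> carrier U" "cl 0 \<in> N" "\<And>a b. cl a \<in> N \<Longrightarrow> cl b \<in> N \<Longrightarrow> cl (a + b) \<in> N"
    "\<And>a b. cl b \<in> N \<Longrightarrow> cl (a * b) \<in> N"
  shows "submodule N U (regular_module U)"
proof (intro submodule.intro subgroup.intro submodule_axioms.intro)
  fix X assume X: "X \<in> N"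
  then obtain a where a: "X = cl a" using assms(1) by (auto elim!: U_cases)
  have "cl (- 1 * a) \<in> N" using assms(4)[of a "-1"] X a by simp
  then have "\<ominus>\<^bsub>U\<^esub> X \<in> N" by (simp add: a U_a_inv)
  then show "inv\<^bsub>add_monoid (regular_module U)\<^esub> X \<in> N" by (simp only: regular_module_a_inv)
  fix Y assume Y: "Y \<in> N"
  then obtain b where b: "Y = cl b" using assms(1) by (auto elim!: U_cases)
  show "X \<otimes>\<^bsub>add_monoid (regular_module U)\<^esub> Y \<in> N" using assms(3)[of a b] X Y a b by simp
next
  fix X Y assume "X \<in> carrier U" "Y \<in> N"
  then show "X \<odot>\<^bsub>regular_module U\<^esub> Y \<in> N" using assms(1,4) by (auto elim!: U_cases)
qed (use assms in \<open>auto simp: U_zero\<close>)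

lemma submodule_regularD:
  assumes "submodule N U (regular_module U)"
  shows "N \<subseteq> carrier U" "cl 0 \<in> N" "cl a \<in> N \<Longrightarrow> cl b \<in> N \<Longrightarrow> cl (a + b) \<in> N"
    "cl b \<in> N \<Longrightarrow> cl (a * b) \<in> N"
proof -
  interpret submodule N U "regular_module U" by fact
  show "N \<subseteq> carrier U" using subset by simp
  show "cl 0 \<in> N" using one_closed by (simp add: U_zero)
  show "cl (a + b) \<in> N" if "cl a \<in> N" "cl b \<in> N" using m_closed[OF that] by simp
  show "cl (a * b) \<in> N" if "cl b \<in> N" using smult_closed[OF cl_in_U that, of a] by simp
qed

text \<open>A matrix whose only nonzero column sits at a coordinate where g does not vanish can send
  g to any vector. The same matrix is prescribed in all blocks, so one \<open>a\<close> serves every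
  weight.\<close>

lemma verma_transitive:
  assumes g: "g \<in> Zspace" "g \<noteq> 0" and g': "g' \<in> Zspace"
  obtains a where "\<And>l. l \<in> weights \<chi> \<Longrightarrow> app (verma_rep l a) g = g'"
proof -
  obtain m0 where m0: "g m0 \<noteq> 0" using g(2) by (auto simp: fun_eq_iff)
  then have m0N: "m0 < 2 * CHAR('k)" using g(1) by (auto simp: Zspace_def not_le[symmetric])
  obtain a where a: "\<forall>l\<in>weights \<chi>. \<forall>m<2 * CHAR('k). \<forall>n<2 * CHAR('k). entry a l m n = (if m = m0 then g' n / g m0 else 0)"
    using entries_surjective[of "\<lambda>l m n. if m = m0 then g' n / g m0 else 0"] by blast
  have "app (verma_rep l a) g = g'" if l: "l \<in> weights \<chi>" for l
  proof (rule Zspace_eqI[OF verma_rep_Zspace[OF g(1)] g'])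
    fix n assume n: "n < 2 * CHAR('k)"
    have "app (verma_rep l a) g n = (\<Sum>m<2 * CHAR('k). if m = m0 then g' n else 0)"
      unfolding verma_rep_entries[OF g(1)] by (intro sum.cong refl) (use a l n m0 in auto)
    then show "app (verma_rep l a) g n = g' n" using m0N by simp
  qed
  then show ?thesis using that by blast
qed

definition columns :: "('k \<times> nat) set" where
  "columns = weights \<chi> \<times> {..<2 * CHAR('k)}"

text \<open>The elements supported in the columns of \<open>J\<close>: under the matrix isomorphism,
  a sum of minimal left ideals.\<close>

definition column_ideal :: "('k \<times> nat) set \<Rightarrow> 'k words set set" where
  "column_ideal J = {cl a | a. \<forall>l m. (l, m) \<in> columns \<longrightarrow> (l, m) \<notin> J \<longrightarrow>
    app (verma_rep l a) (delta m) = 0}"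

lemma cl_in_column_ideal:
  "cl a \<in> column_ideal J \<longleftrightarrow>
    (\<forall>l m. (l, m) \<in> columns \<longrightarrow> (l, m) \<notin> J \<longrightarrow> app (verma_rep l a) (delta m) = 0)"
proof
  assume "cl a \<in> column_ideal J"
  then obtain b where b: "a \<sim>\<^sub>I b"
    "\<forall>l m. (l, m) \<in> columns \<longrightarrow> (l, m) \<notin> J \<longrightarrow> app (verma_rep l b) (delta m) = 0"
    by (auto simp: column_ideal_def cl_eq_iff)
  have "verma_rep l a = verma_rep l b" if "(l, m) \<in> columns" for l m
    using that eqv_verma_rep[OF b(1)] by (auto simp: columns_def)
  then show "\<forall>l m. (l, m) \<in> columns \<longrightarrow> (l, m) \<notin> J \<longrightarrow> app (verma_rep l a) (delta m) = 0"
    using b(2) by metis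
qed (auto simp: column_ideal_def)

lemma submodule_column_ideal: "submodule (column_ideal J) U (regular_module U)"
proof (rule submodule_regularI)
  show "column_ideal J \<subseteq> carrier U" by (auto simp: column_ideal_def)
qed (auto simp: cl_in_column_ideal verma.W_add verma.W_mult)

lemma delta_parity: "(delta m :: nat \<Rightarrow> 'k) \<in> parity_space (of_nat m)"
  by (auto simp: parity_space_def delta_def)

lemma parity_space_disjoint:
  assumes "g0 \<in> parity_space q" "g1 \<in> parity_space (q + 1)" "g0 + g1 = (0 :: nat \<Rightarrow> 'k)"
  shows "g0 = 0" "g1 = 0"
proof -
  have *: "g0 n = 0 \<and> g1 n = 0" for n
  proof -
    have "q \<noteq> q + 1" by (cases q) simp_all
    then have "g0 n = 0 \<or> g1 n = 0" using assms(1,2) by (force simp: parity_space_def)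
    then show ?thesis using fun_cong[OF assms(3), of n] by auto
  qed
  then show "g0 = 0" "g1 = 0" by (auto simp: fun_eq_iff)
qed

text \<open>v_m is homogeneous, so an element killing it has parity components that kill it
  separately.\<close>

lemma graded_column_ideal: "graded_subset U (column_ideal J)"
  unfolding graded_subset_def
proof
  fix X assume X: "X \<in> column_ideal J"
  then obtain a where a: "X = cl a" by (auto simp: column_ideal_def)
  obtain a0 a1 where a01: "a0 \<in> tensor_part UNIV 0" "a1 \<in> tensor_part UNIV 1" "a = a0 + a1"
    by (rule parity_part_decomp)
  have "app (verma_rep l a0) (delta m) = 0 \<and> app (verma_rep l a1) (delta m) = 0" if "(l, m) \<in> columns" "(l, m) \<notin> J" for l m
  proof -
    have "app (verma_rep l a0) (delta m) + app (verma_rep l a1) (delta m) = 0"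
      using X that by (auto simp: a a01(3) cl_in_column_ideal verma.W_add)
    moreover have "app (verma_rep l a0) (delta m) \<in> parity_space (of_nat m)"
      using verma_rep_parity[OF a01(1) delta_parity, of l m] by (simp only: add_0_right)
    ultimately show ?thesis
      using parity_space_disjoint verma_rep_parity[OF a01(2) delta_parity, of l m] by blast
  qed
  then have "cl a0 \<in> column_ideal J" "cl a1 \<in> column_ideal J" by (auto simp: cl_in_column_ideal)
  then show "\<exists>v0\<in>column_ideal J \<inter> homog U 0. \<exists>v1\<in>column_ideal J \<inter> homog U 1. X = v0 \<oplus>\<^bsub>U\<^esub> v1"
    using a01 a by (intro bexI[of _ "cl a0"] bexI[of _ "cl a1"]) (auto simp: U_homog)
qed

text \<open>\<open>J\<close> is maximal among the sets of columns whose ideal meets \<open>N\<close>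
  trivially. Adding a column c yields an element of \<open>N\<close> with nonzero column c; by
  transitivity a multiple of it has any prescribed column c, so everything supported in c lies in
  the sum. Column ideals are graded, hence the same complement also serves graded
  semisimplicity.\<close>

lemma column_complement:
  assumes N: "submodule N U (regular_module U)"
  obtains J where "N \<inter> column_ideal J = {\<zero>\<^bsub>U\<^esub>}" "N <+>\<^bsub>U\<^esub> column_ideal J = carrier U"
proof -
  note N = submodule_regularD[OF N]
  note C = submodule_regularD[OF submodule_column_ideal]
  define P where "P J \<longleftrightarrow> J \<subseteq> columns \<and> N \<inter> column_ideal J = {cl 0}" for J
  have fin: "finite columns" by (simp add: columns_def finite_weights)
  have "P {}"
  proof -
    have "cl a = cl 0" if "cl a \<in> column_ideal {}" for a
      using that unfolding cl_in_column_ideal cl_eq_iff eqv_iff_entries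
      by (auto simp: columns_def entry_def)
    then have "column_ideal {} = {cl 0}" using C(2) by (auto simp: column_ideal_def)
    then show ?thesis using N(2) by (auto simp: P_def)
  qed
  moreover have "finite {J. P J}"
    by (rule finite_subset[of _ "Pow columns"]) (use fin in \<open>auto simp: P_def\<close>)
  ultimately obtain J where J: "P J" "\<And>J'. P J' \<Longrightarrow> J \<subseteq> J' \<Longrightarrow> J = J'"
    using finite_has_maximal[of "{J. P J}"] by auto
  define S where "S = {a. \<exists>b c. cl b \<in> N \<and> cl c \<in> column_ideal J \<and> a = b + c}"
  have S_add: "a + b \<in> S" if "a \<in> S" "b \<in> S" for a b
  proof -
    from that obtain b1 c1 b2 c2 where *: "cl b1 \<in> N" "cl c1 \<in> column_ideal J" "a = b1 + c1"
      "cl b2 \<in> N" "cl c2 \<in> column_ideal J" "b = b2 + c2" by (auto simp: S_def)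
    then show ?thesis unfolding S_def
      by (intro CollectI exI[of _ "b1 + b2"] exI[of _ "c1 + c2"]) (auto intro: N(3) C(3))
  qed
  have step: "u \<in> S" if b: "(l, m) \<in> columns" and u: "cl u \<in> column_ideal {(l, m)}" for l m u
  proof (cases "(l, m) \<in> J")
    case True
    then have "cl u \<in> column_ideal J" using u by (auto simp: cl_in_column_ideal)
    then show ?thesis unfolding S_def using N(2) by (intro CollectI exI[of _ 0] exI[of _ u]) auto
  next
    case False
    let ?J = "insert (l, m) J"
    have lm: "l \<in> weights \<chi>" "m < 2 * CHAR('k)" using b by (auto simp: columns_def)
    have "\<not> P ?J" using J(2)[of ?J] False by auto
    then obtain X where X: "X \<in> N" "X \<in> column_ideal ?J" "X \<noteq> cl 0"
      using J(1) b N(2) C(2)[of ?J] by (auto simp: P_def)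
    then obtain n where n: "X = cl n" using N(1) by (auto elim!: U_cases)
    have "app (verma_rep l n) (delta m) \<noteq> 0"
    proof
      assume "app (verma_rep l n) (delta m) = 0"
      then have "X \<in> column_ideal J" using X(2) unfolding n cl_in_column_ideal by auto
      then show False using X J(1) by (auto simp: P_def)
    qed
    then obtain a where al: "app (verma_rep l a) (app (verma_rep l n) (delta m)) = app (verma_rep l u) (delta m)"
      using verma_transitive[OF verma_rep_Zspace[OF delta_in_Zspace[OF lm(2)]] _ verma_rep_Zspace[OF delta_in_Zspace[OF lm(2)]]] lm(1)
      by blast
    have "cl (u - a * n) \<in> column_ideal J"
      unfolding cl_in_column_ideal
    proof (intro allI impI)
      fix l' m' assume lm': "(l', m') \<in> columns" "(l', m') \<notin> J"
      show "app (verma_rep l' (u - a * n)) (delta m') = 0"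
      proof (cases "(l', m') = (l, m)")
        case True
        then show ?thesis using al by (simp add: verma.W_diff verma.W_mult)
      next
        case False
        then have "app (verma_rep l' u) (delta m') = 0" "app (verma_rep l' n) (delta m') = 0"
          using u X(2) lm' unfolding n cl_in_column_ideal by auto
        then show ?thesis by (simp add: verma.W_diff verma.W_mult)
      qed
    qed
    moreover have "cl (a * n) \<in> N" using N(4) X(1) n by blast
    ultimately show ?thesis unfolding S_def by (intro CollectI exI[of _ "a * n"] exI[of _ "u - a * n"]) auto
  qed
  have S_sum: "(\<Sum>x\<in>A. f x) \<in> S" if "\<And>x. x \<in> A \<Longrightarrow> f x \<in> S" for A and f :: "'k \<times> nat \<Rightarrow> 'k words"
  proof -
    have "0 \<in> S" unfolding S_def using N(2) C(2) by force
    then show ?thesis using that by (induction A rule: infinite_finite_induct) (auto intro: S_add)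
  qed
  have all: "\<exists>b\<in>S. a \<sim>\<^sub>I b" for a
  proof -
    \<comment> \<open>Cuts \<open>a\<close> into columns: \<open>u c\<close> agrees with
      \<open>a\<close> in column \<open>c\<close> and has zero entries elsewhere.\<close>
    have "\<forall>c. \<exists>u. \<forall>l\<in>weights \<chi>. \<forall>m<2 * CHAR('k). \<forall>n<2 * CHAR('k). entry u l m n = (if (l, m) = c then entry a l m n else 0)"
      by (intro allI entries_surjective)
    from choice[OF this] obtain u where "\<forall>c. \<forall>l\<in>weights \<chi>. \<forall>m<2 * CHAR('k). \<forall>n<2 * CHAR('k).
        entry (u c) l m n = (if (l, m) = c then entry a l m n else 0)" ..
    then have u: "entry (u c) l m n = (if (l, m) = c then entry a l m n else 0)"
      if "l \<in> weights \<chi>" "m < 2 * CHAR('k)" "n < 2 * CHAR('k)" for c l m n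
      using that by blast
    have "u c \<in> S" if c: "c \<in> columns" for c
    proof -
      obtain l m where lm: "c = (l, m)" by (cases c)
      have "cl (u c) \<in> column_ideal {(l, m)}"
        unfolding cl_in_column_ideal
      proof (intro allI impI)
        fix l' m' assume *: "(l', m') \<in> columns" "(l', m') \<notin> {(l, m)}"
        then have m': "l' \<in> weights \<chi>" "m' < 2 * CHAR('k)" by (auto simp: columns_def)
        show "app (verma_rep l' (u c)) (delta m') = 0"
          by (rule Zspace_eqI[OF verma_rep_Zspace[OF delta_in_Zspace[OF m'(2)]] Zspace_0])
            (use u[OF m', of _ c] * lm in \<open>auto simp: entry_def\<close>)
      qed
      then show ?thesis using step c lm by blast
    qed
    then have "(\<Sum>c\<in>columns. u c) \<in> S" by (rule S_sum)
    moreover have "a \<sim>\<^sub>I (\<Sum>c\<in>columns. u c)"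
      unfolding eqv_iff_entries
    proof (intro ballI allI impI)
      fix l m n assume l: "l \<in> weights \<chi>" and mn: "m < 2 * CHAR('k)" "n < 2 * CHAR('k)"
      have "entry (\<Sum>c\<in>columns. u c) l m n = (\<Sum>c\<in>columns. if c = (l, m) then entry a l m n else 0)"
        unfolding entry_sum by (intro sum.cong refl) (auto simp: u[OF l mn])
      also have "\<dots> = entry a l m n" using fin l mn by (simp add: columns_def)
      finally show "entry a l m n = entry (\<Sum>c\<in>columns. u c) l m n" by simp
    qed
    ultimately show ?thesis by blast
  qed
  show ?thesis
  proof (rule that[of J])
    show "N \<inter> column_ideal J = {\<zero>\<^bsub>U\<^esub>}" using J(1) by (simp add: P_def U_zero)
    show "N <+>\<^bsub>U\<^esub> column_ideal J = carrier U"
    proof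
      have "X \<oplus>\<^bsub>U\<^esub> Y \<in> carrier U" if "X \<in> carrier U" "Y \<in> carrier U" for X Y
        using that by (auto elim!: U_cases)
      then show "N <+>\<^bsub>U\<^esub> column_ideal J \<subseteq> carrier U"
        using N(1) C(1)[of J] by (auto simp: set_add_def set_mult_def)
      show "carrier U \<subseteq> N <+>\<^bsub>U\<^esub> column_ideal J"
      proof
        fix X assume "X \<in> carrier U"
        then obtain a where a: "X = cl a" by (rule U_cases)
        obtain b c where bc: "cl b \<in> N" "cl c \<in> column_ideal J" "a \<sim>\<^sub>I b + c"
          using all[of a] by (auto simp: S_def)
        then have "X = cl b \<oplus>\<^bsub>U\<^esub> cl c" by (simp add: a cl_eq_iff)
        then have "X \<in> (\<Union>h\<in>N. \<Union>k\<in>column_ideal J. {h \<oplus>\<^bsub>U\<^esub> k})" using bc(1,2) by blast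
        then show "X \<in> N <+>\<^bsub>U\<^esub> column_ideal J" by (simp add: set_add_def set_mult_def)
      qed
    qed
  qed
qed

lemma semisimple_U: "semisimple_algebra U"
  unfolding semisimple_algebra_def
proof (intro conjI allI impI ring_U)
  fix N assume "submodule N U (regular_module U)"
  then obtain J where "N \<inter> column_ideal J = {\<zero>\<^bsub>U\<^esub>}" "N <+>\<^bsub>U\<^esub> column_ideal J = carrier U"
    by (rule column_complement)
  then show "\<exists>N'. submodule N' U (regular_module U) \<and> N \<inter> N' = {\<zero>\<^bsub>U\<^esub>} \<and> N <+>\<^bsub>U\<^esub> N' = carrier U"
    using submodule_column_ideal by blast
qed

end

text \<open>Evaluates a one-term sum straight from the fold, for use in \<open>super_End\<close>
  without first making it an abelian group.\<close>

lemma finsum_singleton: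
  assumes "\<zero>\<^bsub>G\<^esub> \<in> carrier G" "f b \<in> carrier G" "f b \<oplus>\<^bsub>G\<^esub> \<zero>\<^bsub>G\<^esub> = f b"
  shows "finsum G f {b} = f b"
proof -
  let ?D = "carrier G" and ?g = "\<lambda>x y. f x \<oplus>\<^bsub>G\<^esub> y"
  have 1: "({b}, f b) \<in> foldSetD ?D ?g \<zero>\<^bsub>G\<^esub>"
    using foldSetD.insertI[OF _ _ foldSetD.emptyI[OF assms(1)], of b ?g] assms by simp
  have "y = f b" if "({b}, y) \<in> foldSetD ?D ?g \<zero>\<^bsub>G\<^esub>" for y
    using that
  proof (cases rule: foldSetD.cases)
    case (insertI x A z)
    then have x: "x = b" "A = {}" by auto
    from insertI(5)[unfolded x] have "z = \<zero>\<^bsub>G\<^esub>" by (cases rule: foldSetD.cases) auto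
    then show ?thesis using insertI x assms(3) by simp
  qed simp
  then have "(THE y. ({b}, y) \<in> foldSetD ?D ?g \<zero>\<^bsub>G\<^esub>) = f b"
    using 1 by (intro the_equality)
  then show ?thesis
    by (simp add: finsum_def finprod_def foldD_def comp_def)
qed

lemma bit_of_nat: "(of_nat n :: bit) = (if odd n then 1 else 0)"
  by (induction n) auto

lemma parity_space_0: "0 \<in> (parity_space q :: (nat \<Rightarrow> 'r::zero) set)"
  by (simp add: parity_space_def)

lemma parity_space_add:
  assumes "g \<in> parity_space q" "h \<in> parity_space q"
  shows "g + h \<in> (parity_space q :: (nat \<Rightarrow> 'r::ab_group_add) set)"
  unfolding parity_space_def
proof (intro CollectI allI impI)
  fix n assume "(g + h) n \<noteq> 0"
  then have "g n \<noteq> 0 \<or> h n \<noteq> 0" by auto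
  then show "of_nat n = q" using assms by (auto simp: parity_space_def)
qed

lemma parity_space_diff:
  assumes "g \<in> parity_space q" "h \<in> parity_space q"
  shows "g - h \<in> (parity_space q :: (nat \<Rightarrow> 'r::ab_group_add) set)"
  unfolding parity_space_def
proof (intro CollectI allI impI)
  fix n assume "(g - h) n \<noteq> 0"
  then have "g n \<noteq> 0 \<or> h n \<noteq> 0" by auto
  then show "of_nat n = q" using assms by (auto simp: parity_space_def)
qed

context osp_regular
begin

section \<open>Graded modules isomorphic to a baby Verma module\<close>

text \<open>The matrix unit sending v_m to v_n in the block of weight \<open>l\<close>, represented
  by a homogeneous element of the tensor algebra. Any choice will do, since the entries determine
  the class modulo \<open>I\<close>.\<close>

definition unit :: "'k \<Rightarrow> nat \<Rightarrow> nat \<Rightarrow> 'k words" where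
  "unit l m n = (SOME a. a \<in> tensor_part UNIV (of_nat m + of_nat n) \<and>
    (\<forall>l'\<in>weights \<chi>. \<forall>m'<2 * CHAR('k). \<forall>n'<2 * CHAR('k).
      entry a l' m' n' = (if l' = l \<and> m' = m \<and> n' = n then 1 else 0)))"

lemma unit_part: "unit l m n \<in> tensor_part UNIV (of_nat m + of_nat n)"
  and entry_unit: "l' \<in> weights \<chi> \<Longrightarrow> m' < 2 * CHAR('k) \<Longrightarrow> n' < 2 * CHAR('k) \<Longrightarrow>
    entry (unit l m n) l' m' n' = (if l' = l \<and> m' = m \<and> n' = n then 1 else 0)"
proof -
  have "\<exists>a\<in>tensor_part UNIV (of_nat m + of_nat n). \<forall>l'\<in>weights \<chi>. \<forall>m'<2 * CHAR('k). \<forall>n'<2 * CHAR('k).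
      entry a l' m' n' = (if l' = l \<and> m' = m \<and> n' = n then 1 else 0)"
    by (rule entries_surjective_homog) (auto split: if_splits)
  then have "\<exists>a. a \<in> tensor_part UNIV (of_nat m + of_nat n) \<and> (\<forall>l'\<in>weights \<chi>. \<forall>m'<2 * CHAR('k). \<forall>n'<2 * CHAR('k).
      entry a l' m' n' = (if l' = l \<and> m' = m \<and> n' = n then 1 else 0))"
    by blast
  from someI_ex[OF this, folded unit_def]
  show "unit l m n \<in> tensor_part UNIV (of_nat m + of_nat n)"
    "l' \<in> weights \<chi> \<Longrightarrow> m' < 2 * CHAR('k) \<Longrightarrow> n' < 2 * CHAR('k) \<Longrightarrow>
      entry (unit l m n) l' m' n' = (if l' = l \<and> m' = m \<and> n' = n then 1 else 0)"
    by auto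
qed

lemma unit_mult:
  assumes "m < 2 * CHAR('k)" "r < 2 * CHAR('k)" "n < 2 * CHAR('k)"
  shows "unit l r n * unit l m r \<sim>\<^sub>I unit l m n"
  unfolding eqv_iff_entries
proof (intro ballI allI impI)
  fix l' m' n' assume *: "l' \<in> weights \<chi>" "m' < 2 * CHAR('k)" "n' < 2 * CHAR('k)"
  have "entry (unit l r n * unit l m r) l' m' n' =
      (\<Sum>i<2 * CHAR('k). if i = r then (if l' = l \<and> m' = m \<and> n' = n then 1 else 0) else 0)"
    unfolding entry_mult[OF *(2)] by (intro sum.cong refl) (use * in \<open>auto simp: entry_unit\<close>)
  then show "entry (unit l r n * unit l m r) l' m' n' = entry (unit l m n) l' m' n'"
    using assms by (simp add: entry_unit *)
qed

lemma one_eqv_units: "1 \<sim>\<^sub>I (\<Sum>(l, m)\<in>columns. unit l m m)"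
  unfolding eqv_iff_entries
proof (intro ballI allI impI)
  fix l m n assume *: "l \<in> weights \<chi>" "m < 2 * CHAR('k)" "n < 2 * CHAR('k)"
  have "entry (\<Sum>(l, m)\<in>columns. unit l m m) l m n = (\<Sum>c\<in>columns. if c = (l, m) then (if m = n then 1 else 0) else 0)"
    unfolding entry_sum by (intro sum.cong refl) (auto simp: entry_unit * split: if_splits)
  then show "entry 1 l m n = entry (\<Sum>(l, m)\<in>columns. unit l m m) l m n"
    using * finite_weights by (auto simp: entry_1 columns_def)
qed

text \<open>The sign automorphism of \<open>Zspace\<close>, which turns odd homomorphisms into linear maps.\<close>

definition sign_map :: "(nat \<Rightarrow> 'k) \<Rightarrow> nat \<Rightarrow> 'k" where
  "sign_map g = (\<lambda>n. (- 1) ^ n * g n)"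

lemma sign_map_Zspace [simp]: "sign_map g \<in> Zspace \<longleftrightarrow> g \<in> Zspace"
  by (simp add: sign_map_def Zspace_def)

lemma sign_map_add: "sign_map (g + h) = sign_map g + sign_map h"
  by (simp add: sign_map_def fun_eq_iff distrib_left)

lemma sign_map_invol [simp]: "sign_map (sign_map g) = g"
proof -
  have "(- 1 :: 'k) ^ n * (- 1) ^ n = 1" for n by (simp flip: power_add mult_2)
  then show ?thesis by (simp add: sign_map_def fun_eq_iff mult.assoc[symmetric])
qed

lemma sign_map_parity [simp]: "sign_map g \<in> parity_space q \<longleftrightarrow> g \<in> parity_space q"
  by (simp add: sign_map_def parity_space_def)

text \<open>An element of parity j has nonzero entries only where m + n has parity j, so conjugation
  by the signs multiplies it by (-1)^j, which is the sign rule for odd homomorphisms.\<close>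

lemma sign_map_rep:
  assumes b: "b \<in> tensor_part UNIV j" and g: "g \<in> Zspace"
  shows "sign_map (app (verma_rep l b) g) = (if j = 1 then - app (verma_rep l b) (sign_map g) else app (verma_rep l b) (sign_map g))"
proof (rule ext)
  fix n
  have s: "(- 1) ^ n * (g m * entry b l m n) = (if j = 1 then - 1 else 1) * ((- 1) ^ m * g m * entry b l m n)" for m
  proof (cases "entry b l m n = 0")
    case False
    then have "of_nat m + of_nat n = j" using entry_parity[OF b] by blast
    then have "of_nat (m + n) = j" by (simp only: of_nat_add)
    then have "j = (if odd (m + n) then 1 else 0)" by (simp only: bit_of_nat)
    then have "j = 1 \<longleftrightarrow> odd (m + n)" by simp
    then show ?thesis by (cases "even m"; cases "even n") auto
  qed simp
  have "sign_map (app (verma_rep l b) g) n = (\<Sum>m<2 * CHAR('k). (- 1) ^ n * (g m * entry b l m n))"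
    by (simp add: sign_map_def verma_rep_entries[OF g] sum_distrib_left)
  also have "\<dots> = (if j = 1 then - 1 else 1) * app (verma_rep l b) (sign_map g) n"
    unfolding s sum_distrib_left[symmetric] using g by (simp add: verma_rep_entries) (simp add: sign_map_def)
  finally show "sign_map (app (verma_rep l b) g) n =
      (if j = 1 then - app (verma_rep l b) (sign_map g) else app (verma_rep l b) (sign_map g)) n"
    by simp
qed

end

text \<open>Describes a baby Verma module by transport along \<open>f\<close>; the supermodule
  axioms are then pulled back from the operators on \<open>Zspace\<close>. The grading is the one in
  which v_0 is even.\<close>

locale verma_like = osp_regular \<chi> for \<chi> :: "'k::alg_closed_field osp \<Rightarrow> 'k" +
  fixes l :: 'k and V :: "('k words set, 'v, 'y) supermodule_scheme" (structure) and f :: "'v \<Rightarrow> nat \<Rightarrow> 'k"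
  assumes weight: "l \<in> weights \<chi>"
    and bij: "bij_betw f (carrier V) Zspace"
    and add_closed: "v \<in> carrier V \<Longrightarrow> w \<in> carrier V \<Longrightarrow> v \<oplus> w \<in> carrier V"
    and f_add: "v \<in> carrier V \<Longrightarrow> w \<in> carrier V \<Longrightarrow> f (v \<oplus> w) = f v + f w"
    and zero: "\<zero> \<in> carrier V" "f \<zero> = 0"
    and act_closed: "v \<in> carrier V \<Longrightarrow> cl a \<odot> v \<in> carrier V"
    and f_act: "v \<in> carrier V \<Longrightarrow> f (cl a \<odot> v) = app (verma_rep l a) (f v)"
    and homog: "homog V i = {v \<in> carrier V. f v \<in> parity_space i}"
begin

lemma f_Z: "v \<in> carrier V \<Longrightarrow> f v \<in> Zspace"
  using bij by (auto simp: bij_betw_def)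

lemma V_eqI: "v \<in> carrier V \<Longrightarrow> w \<in> carrier V \<Longrightarrow> f v = f w \<Longrightarrow> v = w"
  using bij by (auto simp: bij_betw_def inj_on_def)

lemma V_ex: "g \<in> Zspace \<Longrightarrow> \<exists>v\<in>carrier V. f v = g"
  using bij unfolding bij_betw_def by (metis imageE)

lemma abelian_group_V: "abelian_group V"
proof (rule abelian_groupI)
  fix x assume x: "x \<in> carrier V"
  obtain y where y: "y \<in> carrier V" "f y = - f x" using V_ex Zspace_uminus[OF f_Z[OF x]] by blast
  show "\<exists>y\<in>carrier V. y \<oplus> x = \<zero>"
    by (intro bexI[OF _ y(1)] V_eqI) (simp_all add: x y add_closed f_add zero)
  show "\<zero> \<oplus> x = x" by (intro V_eqI) (simp_all add: x add_closed f_add zero)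
  fix y assume y: "y \<in> carrier V"
  show "x \<oplus> y = y \<oplus> x" by (intro V_eqI) (simp_all add: x y add_closed f_add add.commute)
  fix z assume z: "z \<in> carrier V"
  show "(x \<oplus> y) \<oplus> z = x \<oplus> (y \<oplus> z)" by (intro V_eqI) (simp_all add: x y z add_closed f_add add.assoc)
qed (auto intro: add_closed zero)

lemma minus_closed: "v \<in> carrier V \<Longrightarrow> \<ominus> v \<in> carrier V"
  by (rule abelian_group.a_inv_closed[OF abelian_group_V])

lemma f_minus:
  assumes v: "v \<in> carrier V" shows "f (\<ominus> v) = - f v"
proof -
  have "f (v \<oplus> \<ominus> v) = 0" using abelian_group.r_neg[OF abelian_group_V v] zero by simp
  then show ?thesis using v minus_closed[OF v] by (simp add: f_add eq_neg_iff_add_eq_0 add.commute)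
qed

lemma supermodule_V: "supermodule U V"
proof (intro supermodule.intro ring_U abelian_group_V supermodule_axioms.intro)
  fix X Y v w
  assume "X \<in> carrier U" "Y \<in> carrier U" and v: "v \<in> carrier V"
  then obtain a b where [simp]: "X = cl a" "Y = cl b" by (auto elim!: U_cases)
  show "(X \<oplus>\<^bsub>U\<^esub> Y) \<odot> v = X \<odot> v \<oplus> Y \<odot> v" "(X \<otimes>\<^bsub>U\<^esub> Y) \<odot> v = X \<odot> (Y \<odot> v)"
    by (intro V_eqI; simp add: v add_closed act_closed f_add f_act verma.W_add verma.W_mult)+
next
  fix X v w assume "X \<in> carrier U" and v: "v \<in> carrier V" "w \<in> carrier V"
  then obtain a where [simp]: "X = cl a" by (auto elim!: U_cases)
  show "X \<odot> (v \<oplus> w) = X \<odot> v \<oplus> X \<odot> w"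
    by (intro V_eqI) (simp_all add: v add_closed act_closed f_add f_act app_add)
next
  fix X v assume "X \<in> carrier U" "v \<in> carrier V"
  then show "X \<odot> v \<in> carrier V" by (auto elim!: U_cases intro: act_closed)
next
  fix v assume v: "v \<in> carrier V"
  show "\<one>\<^bsub>U\<^esub> \<odot> v = v" by (intro V_eqI) (simp_all add: U_one v act_closed f_act)
next
  fix i
  show "additive_subgroup (homog V i) V"
  proof (intro additive_subgroup.intro subgroup.intro)
    fix x assume "x \<in> homog V i"
    then have "\<ominus> x \<in> homog V i" by (auto simp: homog minus_closed f_minus parity_space_def)
    then show "inv\<^bsub>add_monoid V\<^esub> x \<in> homog V i" by (simp add: a_inv_def)
  qed (auto simp: homog add_closed f_add zero parity_space_add parity_space_0)
next
  fix v assume v: "v \<in> carrier V"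
  define g where "g q = (\<lambda>n. if of_nat n = (q::bit) then f v n else 0)" for q
  have g: "g q \<in> parity_space q" "g q \<in> Zspace" for q
    using f_Z[OF v] by (auto simp: g_def parity_space_def Zspace_def)
  have fv: "f v = g 0 + g 1"
  proof
    fix n show "f v n = (g 0 + g 1) n" by (cases "of_nat n :: bit") (simp_all add: g_def)
  qed
  obtain v0 where v0: "v0 \<in> carrier V" "f v0 = g 0" using V_ex[OF g(2)] by blast
  obtain v1 where v1: "v1 \<in> carrier V" "f v1 = g 1" using V_ex[OF g(2)] by blast
  show "\<exists>!v0. v0 \<in> homog V 0 \<and> (\<exists>v1\<in>homog V 1. v = v0 \<oplus> v1)"
  proof (rule ex1I[of _ v0])
    have "f v = f (v0 \<oplus> v1)" by (simp only: fv f_add[OF v0(1) v1(1)] v0 v1)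
    then have "v = v0 \<oplus> v1" by (rule V_eqI[OF v add_closed[OF v0(1) v1(1)]])
    moreover have "v0 \<in> homog V 0" "v1 \<in> homog V 1" using v0 v1 g(1) by (simp_all add: homog)
    ultimately show "v0 \<in> homog V 0 \<and> (\<exists>v1\<in>homog V 1. v = v0 \<oplus> v1)" by blast
    fix w0 assume "w0 \<in> homog V 0 \<and> (\<exists>w1\<in>homog V 1. v = w0 \<oplus> w1)"
    then obtain w1 where w: "w0 \<in> homog V 0" "w1 \<in> homog V 1" "v = w0 \<oplus> w1" by blast
    then have wc: "w0 \<in> carrier V" "w1 \<in> carrier V" by (simp_all add: homog)
    have e: "g 0 + g 1 = f w0 + f w1" unfolding fv[symmetric] w(3) by (rule f_add[OF wc])
    have "(g 0 - f w0) + (g 1 - f w1) = (g 0 + g 1) - (f w0 + f w1)" by (simp add: algebra_simps)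
    then have "(g 0 - f w0) + (g 1 - f w1) = 0" unfolding e by simp
    moreover have w01: "f w0 \<in> parity_space 0" "f w1 \<in> parity_space 1" using w by (simp_all add: homog)
    moreover have "g 1 - f w1 \<in> parity_space (0 + 1)"
      unfolding add_0_left by (rule parity_space_diff[OF g(1) w01(2)])
    ultimately have "g 0 - f w0 = 0"
      by (intro parity_space_disjoint(1)[OF parity_space_diff[OF g(1)[of 0] w01(1)]])
    then have "f w0 = f v0" using v0(2) by simp
    then show "w0 = v0" by (rule V_eqI[OF wc(1) v0(1)])
  qed
next
  fix X i v j assume "X \<in> homog U i" and v: "v \<in> homog V j"
  then obtain a where a: "X = cl a" "a \<in> tensor_part UNIV i" by (auto simp: U_homog)
  have vc: "v \<in> carrier V" "f v \<in> parity_space j" using v by (simp_all add: homog)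
  have "f (X \<odot> v) \<in> parity_space (j + i)" unfolding a(1) f_act[OF vc(1)] by (rule verma_rep_parity[OF a(2) vc(2)])
  moreover have "j + i = i + j" by (rule add.commute)
  ultimately have "f (X \<odot> v) \<in> parity_space (i + j)" by (rule back_subst[of "\<lambda>q. f (X \<odot> v) \<in> parity_space q"])
  then show "X \<odot> v \<in> homog V (i + j)"
    unfolding homog mem_Collect_eq a(1) by (rule conjI[OF act_closed[OF vc(1)]])
qed

lemma V_transitive:
  assumes "v \<in> carrier V" "v \<noteq> \<zero>" "w \<in> carrier V"
  obtains a where "cl a \<odot> v = w"
proof -
  have "f v \<noteq> 0" using assms V_eqI zero by metis
  then obtain a where "\<And>l. l \<in> weights \<chi> \<Longrightarrow> app (verma_rep l a) (f v) = f w"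
    using verma_transitive f_Z assms by metis
  then have "cl a \<odot> v = w" using weight assms by (intro V_eqI) (simp_all add: act_closed f_act)
  then show ?thesis by (rule that)
qed

lemma two_p_pos: "0 < 2 * CHAR('k)"
  using CHAR_gt_2 by simp

definition v0 :: 'v where
  "v0 = (SOME v. v \<in> carrier V \<and> f v = delta 0)"

lemma v0: "v0 \<in> carrier V" "f v0 = delta 0"
  using someI_ex[of "\<lambda>v. v \<in> carrier V \<and> f v = delta 0"] V_ex[OF delta_in_Zspace[OF two_p_pos]]
  by (auto simp: v0_def)

lemma v0_nz: "v0 \<noteq> \<zero>"
proof
  assume "v0 = \<zero>"
  then have "delta 0 0 = (0 :: 'k)" using v0(2) zero by simp
  then show False by (simp add: delta_def)
qed

lemma irreducible_V: "irreducible_supermodule U V"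
  unfolding irreducible_supermodule_def
proof (intro conjI allI impI supermodule_V)
  show "carrier V \<noteq> {\<zero>}" using v0(1) v0_nz by blast
  fix N assume "submodule N U V \<and> graded_subset V N"
  then interpret N: submodule N U V by blast
  have sub: "N \<subseteq> carrier V" using N.subset by simp
  have z: "\<zero> \<in> N" using N.one_closed by simp
  show "N = {\<zero>} \<or> N = carrier V"
  proof (cases "N = {\<zero>}")
    case False
    then obtain v where v: "v \<in> N" "v \<noteq> \<zero>" using z by blast
    have "w \<in> N" if w: "w \<in> carrier V" for w
    proof -
      obtain a where "cl a \<odot> v = w" using V_transitive v w sub by blast
      then show ?thesis using N.smult_closed[of "cl a" v] v by auto
    qed
    then show ?thesis using sub by blast
  qed simp
qed

lemma unit_v0: "cl (unit l 0 0) \<odot> v0 = v0"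
proof (rule V_eqI)
  show "f (cl (unit l 0 0) \<odot> v0) = f v0"
  proof (rule Zspace_eqI)
    show "f (cl (unit l 0 0) \<odot> v0) \<in> Zspace" "f v0 \<in> Zspace"
      by (rule f_Z, simp add: act_closed v0)+
    fix n assume n: "n < 2 * CHAR('k)"
    have "f (cl (unit l 0 0) \<odot> v0) n = entry (unit l 0 0) l 0 n" by (simp add: f_act v0 entry_def)
    also have "\<dots> = f v0 n" using entry_unit[OF weight two_p_pos n, of l 0 0] by (simp add: v0 delta_def)
    finally show "f (cl (unit l 0 0) \<odot> v0) n = f v0 n" .
  qed
qed (simp_all add: act_closed v0)

lemma unit_in_homog: "cl (unit l' 0 0) \<in> homog U 0"
  using unit_part[of l' 0 0] by (auto simp: U_homog)

lemma unit_projects: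
  assumes v: "v \<in> carrier V" shows "f (cl (unit l 0 0) \<odot> v) = app (scal (f v 0)) (delta 0)"
proof (rule Zspace_eqI)
  show "f (cl (unit l 0 0) \<odot> v) \<in> Zspace" using v by (simp add: f_Z act_closed)
  show "app (scal (f v 0)) (delta 0) \<in> Zspace" using two_p_pos by (simp add: Zspace_def delta_def)
  fix n assume n: "n < 2 * CHAR('k)"
  have "f (cl (unit l 0 0) \<odot> v) n = (\<Sum>m<2 * CHAR('k). f v m * entry (unit l 0 0) l m n)"
    using v by (simp add: f_act verma_rep_entries[OF f_Z[OF v]])
  also have "\<dots> = (\<Sum>m<2 * CHAR('k). if m = 0 then f v 0 * delta 0 n else 0)"
    by (intro sum.cong refl) (use n weight in \<open>auto simp: entry_unit delta_def\<close>)
  also have "\<dots> = f v 0 * delta 0 n" using two_p_pos by simp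
  finally show "f (cl (unit l 0 0) \<odot> v) n = app (scal (f v 0)) (delta 0) n" by simp
qed

text \<open>A form of Schur's lemma. The even element \<open>unit l 0 0\<close> projects onto the
  line of v_0, so a homomorphism commuting with it multiplies v_0 by a scalar, and v_0 generates the
  module. An odd homomorphism sends v_0 into the odd part, so its scalar is 0.\<close>

lemma super_hom_scalar:
  assumes \<phi>: "\<phi> \<in> super_hom U V V i"
  obtains c where "\<And>v. v \<in> carrier V \<Longrightarrow> f (\<phi> v) = app (scal c) (f v)" "i = 1 \<Longrightarrow> c = 0"
proof -
  have closed: "\<phi> v \<in> carrier V" if "v \<in> carrier V" for v
    using \<phi> that by (auto simp: super_hom_def)
  have add: "\<phi> (v \<oplus> w) = \<phi> v \<oplus> \<phi> w" if "v \<in> carrier V" "w \<in> carrier V" for v w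
    using \<phi> that by (auto simp: super_hom_def)
  have act: "\<phi> (cl a \<odot> v) = (if i = 1 \<and> j = 1 then \<ominus> (cl a \<odot> \<phi> v) else cl a \<odot> \<phi> v)"
    if "a \<in> tensor_part UNIV j" "v \<in> carrier V" for a j v
    using \<phi> that unfolding super_hom_def U_homog by blast
  have par: "\<phi> v \<in> homog V (j + i)" if "v \<in> homog V j" for v j
    using \<phi> that unfolding super_hom_def by blast
  define c where "c = f (\<phi> v0) 0"
  have "\<phi> v0 = cl (unit l 0 0) \<odot> \<phi> v0"
    using act[of "unit l 0 0" 0 v0] unit_part[of l 0 0] v0(1) unit_v0 by simp
  then have c: "f (\<phi> v0) = app (scal c) (delta 0)"
    using unit_projects[OF closed[OF v0(1)]] by (simp add: c_def)
  have c0: "c = 0" if i: "i = 1"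
  proof -
    have "v0 \<in> homog V 0" by (auto simp: homog v0 delta_def parity_space_def)
    then have "\<phi> v0 \<in> homog V 1" using par[of v0 0] i by simp
    then have "f (\<phi> v0) 0 \<noteq> 0 \<longrightarrow> of_nat 0 = (1 :: bit)" unfolding homog parity_space_def by blast
    then show ?thesis by (simp add: c delta_def)
  qed
  have "f (\<phi> v) = app (scal c) (f v)" if v: "v \<in> carrier V" for v
  proof -
    obtain a where a: "cl a \<odot> v0 = v" using V_transitive[OF v0(1) v0_nz v] .
    obtain a0 a1 where a01: "a0 \<in> tensor_part UNIV 0" "a1 \<in> tensor_part UNIV 1" "a = a0 + a1"
      by (rule parity_part_decomp)
    have comm: "app (verma_rep l b) (app (scal c) g) = app (scal c) (app (verma_rep l b) g)" for b g
    proof -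
      have "verma_rep l b * scal c = scal c * verma_rep l b"
        using scalar_word_commute[of b c] by (metis verma.W_mult verma.W_scalar_word)
      then show ?thesis by (metis app_ring(6))
    qed
    have v_eq: "v = (cl a0 \<odot> v0) \<oplus> (cl a1 \<odot> v0)"
      using a by (intro V_eqI) (simp_all add: v v0 add_closed act_closed f_add f_act a01(3) verma.W_add flip: a)
    have "f (\<phi> v) = f (\<phi> (cl a0 \<odot> v0)) + f (\<phi> (cl a1 \<odot> v0))"
      unfolding v_eq using add closed by (simp add: f_add act_closed v0)
    also have "f (\<phi> (cl a0 \<odot> v0)) = app (scal c) (f (cl a0 \<odot> v0))"
      using act[OF a01(1) v0(1)] closed[OF v0(1)] by (simp add: f_act c comm v0)
    also have "f (\<phi> (cl a1 \<odot> v0)) = app (scal c) (f (cl a1 \<odot> v0))"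
    proof (cases "i = 1")
      case True
      then have z: "f (\<phi> v0) = 0" using c0 c by (simp add: scal_hom(1))
      show ?thesis using act[OF a01(2) v0(1)] closed[OF v0(1)] c0[OF True]
        by (simp add: f_act f_minus act_closed v0 True z scal_hom(1))
    next
      case False
      then show ?thesis using act[OF a01(2) v0(1)] closed[OF v0(1)] by (simp add: f_act c comm v0)
    qed
    also have "app (scal c) (f (cl a0 \<odot> v0)) + app (scal c) (f (cl a1 \<odot> v0)) = app (scal c) (f v)"
      by (simp add: v_eq app_add f_add act_closed v0)
    finally show ?thesis .
  qed
  then show ?thesis using c0 that by blast
qed

text \<open>Even endomorphisms are scalars and odd ones vanish, so \<open>super_End\<close> is
  spanned by the identity, which appears as \<open>scalar 1\<close>.\<close>

lemma type_M_V: "type_M U V"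
  unfolding type_M_def
proof (intro conjI irreducible_V)
  let ?S = "super_End U V"
  define scalar where "scalar c = (\<lambda>v\<in>carrier V. cl (scalar_word c) \<odot> v)" for c
  have f_scalar: "f (scalar c v) = app (scal c) (f v)" if "v \<in> carrier V" for c v
    using that by (simp add: scalar_def f_act verma.W_scalar_word)
  have scalar_closed: "scalar c v \<in> carrier V" if "v \<in> carrier V" for c v
    using that by (simp add: scalar_def act_closed)
  have carrier_S: "carrier ?S = range scalar"
  proof (intro equalityI subsetI)
    fix h assume "h \<in> carrier ?S"
    then obtain h0 h1 where h: "h \<in> extensional (carrier V)" "h0 \<in> super_hom U V V 0" "h1 \<in> super_hom U V V 1"
      "\<And>v. v \<in> carrier V \<Longrightarrow> h v = h0 v \<oplus> h1 v" by (auto simp: super_End_def)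
    obtain c0 where c0: "\<And>v. v \<in> carrier V \<Longrightarrow> f (h0 v) = app (scal c0) (f v)" using super_hom_scalar[OF h(2)] by blast
    obtain c1 where c1: "\<And>v. v \<in> carrier V \<Longrightarrow> f (h1 v) = app (scal c1) (f v)" "c1 = 0"
      using super_hom_scalar[OF h(3)] by blast
    have h01: "h0 v \<in> carrier V" "h1 v \<in> carrier V" if "v \<in> carrier V" for v
      using h(2,3) that by (auto simp: super_hom_def)
    have "h = scalar c0"
    proof (rule extensionalityI[OF h(1)])
      show "scalar c0 \<in> extensional (carrier V)" by (simp add: scalar_def)
      fix v assume v: "v \<in> carrier V"
      show "h v = scalar c0 v"
        by (intro V_eqI) (simp_all add: v h(4) h01 add_closed f_add scalar_closed f_scalar c0 c1 scal_hom(1))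
    qed
    then show "h \<in> range scalar" by simp
  next
    fix h assume "h \<in> range scalar"
    then obtain c where c: "h = scalar c" by blast
    have hom0: "scalar c \<in> super_hom U V V 0"
      unfolding super_hom_def
    proof (intro CollectI conjI ballI allI)
      show "scalar c \<in> carrier V \<rightarrow> carrier V" by (simp add: scalar_closed)
      fix v w assume "v \<in> carrier V" "w \<in> carrier V"
      then show "scalar c (v \<oplus> w) = scalar c v \<oplus> scalar c w"
        by (intro V_eqI) (simp_all add: scalar_closed add_closed f_scalar f_add app_add)
    next
      fix j X v assume "X \<in> homog U j" and v: "v \<in> carrier V"
      then obtain a where a: "X = cl a" by (auto simp: U_homog)
      have "app (scal c) (app (verma_rep l a) g) = app (verma_rep l a) (app (scal c) g)" for g
      proof -
        have "verma_rep l a * scal c = scal c * verma_rep l a"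
          using scalar_word_commute[of a c] by (metis verma.W_mult verma.W_scalar_word)
        then show ?thesis by (metis app_ring(6))
      qed
      then have "scalar c (X \<odot> v) = X \<odot> scalar c v"
        using v by (intro V_eqI) (simp_all add: a scalar_closed act_closed f_scalar f_act)
      then show "scalar c (X \<odot> v) = (if (0::bit) = 1 \<and> j = 1 then \<ominus> (X \<odot> scalar c v) else X \<odot> scalar c v)"
        by simp
    next
      fix j v assume "v \<in> homog V j"
      then show "scalar c v \<in> homog V (j + 0)" by (auto simp: homog scalar_closed f_scalar parity_space_def)
    qed
    \<comment> \<open>A member of \<open>super_End\<close> needs an odd summand too; the zero map
      supplies it.\<close>
    have hom1: "(\<lambda>v. \<zero>) \<in> super_hom U V V 1"
    proof -
      have "cl a \<odot> \<zero> = \<zero>" for a by (intro V_eqI) (simp_all add: zero act_closed f_act)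
      moreover have "\<zero> \<oplus> \<zero> = \<zero>" by (intro V_eqI) (simp_all add: zero add_closed f_add)
      moreover have "\<ominus> \<zero> = \<zero>" by (intro V_eqI) (simp_all add: zero minus_closed f_minus)
      ultimately show ?thesis by (auto simp: super_hom_def U_homog zero homog parity_space_def)
    qed
    have decomp: "scalar c v = scalar c v \<oplus> \<zero>" if "v \<in> carrier V" for v
      using that by (intro V_eqI) (simp_all add: scalar_closed zero add_closed f_add)
    have "\<exists>h0\<in>super_hom U V V 0. \<exists>h1\<in>super_hom U V V 1. \<forall>v\<in>carrier V. scalar c v = h0 v \<oplus> h1 v"
      by (rule bexI[OF _ hom0], rule bexI[OF _ hom1], rule ballI, rule decomp)
    moreover have "scalar c \<in> extensional (carrier V)" by (simp add: scalar_def)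
    ultimately show "h \<in> carrier ?S"
      by (simp add: c super_End_def)
  qed
  have scalar_1: "scalar 1 \<in> carrier ?S" by (simp add: carrier_S)
  have smult: "c \<odot>\<^bsub>?S\<^esub> scalar 1 = scalar c" for c
  proof (rule extensionalityI)
    show "c \<odot>\<^bsub>?S\<^esub> scalar 1 \<in> extensional (carrier V)" by (simp add: super_End_def)
    show "scalar c \<in> extensional (carrier V)" by (simp add: scalar_def)
    fix v assume v: "v \<in> carrier V"
    show "(c \<odot>\<^bsub>?S\<^esub> scalar 1) v = scalar c v"
      using v scalar_closed[OF v, of 1] scalar_closed[OF v, of c]
      by (intro V_eqI) (simp_all add: super_End_def U_one act_closed f_act f_scalar verma.W_scalar_word scal_hom)
  qed
  have sum: "(\<Oplus>\<^bsub>?S\<^esub>b\<in>{scalar 1}. c b \<odot>\<^bsub>?S\<^esub> b) = scalar (c (scalar 1))" for c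
  proof -
    have zS: "\<zero>\<^bsub>?S\<^esub> = scalar 0"
    proof -
      have "\<zero> = scalar 0 v" if "v \<in> carrier V" for v
        using that by (intro V_eqI) (simp_all add: zero scalar_closed f_scalar scal_hom)
      then show ?thesis by (auto simp: super_End_def scalar_def fun_eq_iff)
    qed
    have "scalar d \<oplus>\<^bsub>?S\<^esub> scalar 0 = scalar d" for d
    proof (rule extensionalityI)
      show "scalar d \<oplus>\<^bsub>?S\<^esub> scalar 0 \<in> extensional (carrier V)" by (simp add: super_End_def)
      show "scalar d \<in> extensional (carrier V)" by (simp add: scalar_def)
      fix v assume v: "v \<in> carrier V"
      show "(scalar d \<oplus>\<^bsub>?S\<^esub> scalar 0) v = scalar d v"
        using v scalar_closed[OF v] by (intro V_eqI) (simp_all add: super_End_def add_closed f_add f_scalar scal_hom)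
    qed
    then have "finsum ?S (\<lambda>b. c b \<odot>\<^bsub>?S\<^esub> b) {scalar 1} = c (scalar 1) \<odot>\<^bsub>?S\<^esub> scalar 1"
      by (intro finsum_singleton) (simp_all add: smult zS carrier_S)
    then show ?thesis by (simp add: smult)
  qed
  have inj: "c = d" if "scalar c = scalar d" for c d
  proof -
    have "f (scalar e v0) 0 = e" for e by (simp add: f_scalar[OF v0(1)] v0(2) delta_def)
    then show ?thesis using that by metis
  qed
  show "has_dimension ?S 1"
    unfolding has_dimension_def
  proof (intro exI[of _ "{scalar 1}"] conjI ballI)
    fix h assume "h \<in> carrier ?S"
    then obtain c where c: "h = scalar c" by (auto simp: carrier_S)
    show "\<exists>!d. d \<in> {scalar 1} \<rightarrow>\<^sub>E UNIV \<and> h = (\<Oplus>\<^bsub>?S\<^esub>b\<in>{scalar 1}. d b \<odot>\<^bsub>?S\<^esub> b)"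
    proof (rule ex1I[of _ "\<lambda>b\<in>{scalar 1}. c"])
      show "(\<lambda>b\<in>{scalar 1}. c) \<in> {scalar 1} \<rightarrow>\<^sub>E UNIV \<and>
          h = (\<Oplus>\<^bsub>?S\<^esub>b\<in>{scalar 1}. (\<lambda>b\<in>{scalar 1}. c) b \<odot>\<^bsub>?S\<^esub> b)"
        unfolding sum by (simp add: c)
      fix d assume d: "d \<in> {scalar 1} \<rightarrow>\<^sub>E UNIV \<and> h = (\<Oplus>\<^bsub>?S\<^esub>b\<in>{scalar 1}. d b \<odot>\<^bsub>?S\<^esub> b)"
      then have "d (scalar 1) = c" unfolding sum c using inj by metis
      moreover have "d b = undefined" if "b \<noteq> scalar 1" for b
        using d that by (auto simp: PiE_def extensional_def)
      ultimately show "d = (\<lambda>b\<in>{scalar 1}. c)" by (intro ext) (simp add: restrict_def)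
    qed
  qed (use scalar_1 in auto)
qed

end

context osp_regular
begin

lemma highest_weight_orbit:
  assumes l: "l \<in> weights \<chi>" and g: "g \<in> Zspace"
  obtains a where "app (verma_rep l a) (delta 0) = g"
proof -
  have d0: "(delta 0 :: nat \<Rightarrow> 'k) \<in> Zspace" using CHAR_gt_2 by (simp add: delta_in_Zspace)
  have "(delta 0 :: nat \<Rightarrow> 'k) \<noteq> 0" by (auto simp: delta_def fun_eq_iff)
  from verma_transitive[OF d0 this g] l that show ?thesis by blast
qed

lemma highest_weight_orbit_homog:
  assumes l: "l \<in> weights \<chi>" and g: "g \<in> Zspace" "g \<in> parity_space j"
  obtains a where "a \<in> tensor_part UNIV j" "app (verma_rep l a) (delta 0) = g"
proof -
  have d0: "(delta 0 :: nat \<Rightarrow> 'k) \<in> Zspace" using CHAR_gt_2 by (simp add: delta_in_Zspace)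
  have "\<exists>a\<in>tensor_part UNIV j. \<forall>l\<in>weights \<chi>. \<forall>m<2 * CHAR('k). \<forall>n<2 * CHAR('k).
      entry a l m n = (if m = 0 then g n else 0)"
    by (rule entries_surjective_homog) (use g in \<open>auto simp: parity_space_def split: if_splits\<close>)
  then obtain a where a: "a \<in> tensor_part UNIV j" "\<And>n. n < 2 * CHAR('k) \<Longrightarrow> entry a l 0 n = g n"
    using l CHAR_gt_2 by auto
  have "app (verma_rep l a) (delta 0) = g"
    by (rule Zspace_eqI[OF verma_rep_Zspace[OF d0] g(1)]) (use a in \<open>simp add: entry_def\<close>)
  then show ?thesis using a that by blast
qed

text \<open>\<open>unit l 0 0\<close> fixes a nonzero vector in weight l and acts by zero in any
  other weight. Being even, it commutes with homomorphisms of either parity.\<close>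

lemma verma_like_not_isomorphic:
  assumes V: "verma_like \<chi> l V f" and W: "verma_like \<chi> m W f'"
    and iso: "super_isomorphic U V W"
  shows "l = m"
proof (rule ccontr)
  assume lm: "l \<noteq> m"
  interpret V: verma_like \<chi> l V f by (rule V)
  interpret W: verma_like \<chi> m W f' by (rule W)
  obtain i \<phi> where \<phi>: "\<phi> \<in> super_hom U V W i" and bij: "bij_betw \<phi> (carrier V) (carrier W)"
    using iso by (auto simp: super_isomorphic_def)
  have closed: "\<phi> v \<in> carrier W" if "v \<in> carrier V" for v
    using \<phi> that by (auto simp: super_hom_def)
  have act: "\<phi> (cl (unit l 0 0) \<odot>\<^bsub>V\<^esub> v) = cl (unit l 0 0) \<odot>\<^bsub>W\<^esub> \<phi> v" if "v \<in> carrier V" for v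
    using \<phi> that V.unit_in_homog[of l] unfolding super_hom_def by force
  have zero: "cl (unit l 0 0) \<odot>\<^bsub>W\<^esub> w = \<zero>\<^bsub>W\<^esub>" if w: "w \<in> carrier W" for w
  proof (rule W.V_eqI)
    have "app (verma_rep m (unit l 0 0)) (f' w) = 0"
    proof (rule Zspace_eqI)
      fix n assume n: "n < 2 * CHAR('k)"
      show "app (verma_rep m (unit l 0 0)) (f' w) n = 0 n"
        unfolding verma_rep_entries[OF W.f_Z[OF w]]
        by (simp, intro sum.neutral) (use lm n W.weight in \<open>auto simp: entry_unit\<close>)
    qed (simp_all add: verma_rep_Zspace W.f_Z w)
    then show "f' (cl (unit l 0 0) \<odot>\<^bsub>W\<^esub> w) = f' \<zero>\<^bsub>W\<^esub>" using w by (simp add: W.f_act W.zero)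
  qed (simp_all add: w W.act_closed W.zero)
  have "\<phi> V.v0 = \<zero>\<^bsub>W\<^esub>"
    using act[OF V.v0(1)] zero[OF closed[OF V.v0(1)]] V.unit_v0 by simp
  moreover have "\<phi> \<zero>\<^bsub>V\<^esub> = \<zero>\<^bsub>W\<^esub>"
  proof -
    have "cl (unit l 0 0) \<odot>\<^bsub>V\<^esub> \<zero>\<^bsub>V\<^esub> = \<zero>\<^bsub>V\<^esub>" by (intro V.V_eqI) (simp_all add: V.zero V.act_closed V.f_act)
    then show ?thesis using act[OF V.zero(1)] zero[OF closed[OF V.zero(1)]] by simp
  qed
  ultimately have "V.v0 = \<zero>\<^bsub>V\<^esub>"
    using bij V.v0(1) V.zero(1) by (auto simp: bij_betw_def inj_on_def)
  then show False using V.v0_nz by simp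
qed

end

section \<open>Classification of the irreducible supermodules\<close>

locale U_supermodule = osp_regular \<chi> for \<chi> :: "'k::alg_closed_field osp \<Rightarrow> 'k" +
  fixes W :: "('k words set, 'w, 'y) supermodule_scheme" (structure)
  assumes supermodule_W: "supermodule U W"
begin

interpretation W: supermodule U W by (rule supermodule_W)

lemma act_closed: "w \<in> carrier W \<Longrightarrow> cl a \<odot> w \<in> carrier W"
  by (rule W.smult_closed) simp_all

lemma act_add: "w \<in> carrier W \<Longrightarrow> cl (a + b) \<odot> w = cl a \<odot> w \<oplus> cl b \<odot> w"
  using W.smult_l_distr[of "cl a" "cl b" w] by simp

lemma act_mult: "w \<in> carrier W \<Longrightarrow> cl (a * b) \<odot> w = cl a \<odot> (cl b \<odot> w)"
  using W.smult_assoc[of "cl a" "cl b" w] by simp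

lemma act_one: "w \<in> carrier W \<Longrightarrow> cl 1 \<odot> w = w"
  using W.smult_one[of w] by (simp add: U_one)

lemma act_zero_left: "w \<in> carrier W \<Longrightarrow> cl 0 \<odot> w = \<zero>"
proof -
  assume w: "w \<in> carrier W"
  have "cl 0 \<odot> w \<oplus> cl 0 \<odot> w = cl 0 \<odot> w" using act_add[OF w, of 0 0] by simp
  then show ?thesis using W.V.add.l_cancel_one[of "cl 0 \<odot> w" "cl 0 \<odot> w"] act_closed[OF w] by simp
qed

lemma act_minus: "w \<in> carrier W \<Longrightarrow> cl (- a) \<odot> w = \<ominus> (cl a \<odot> w)"
proof -
  assume w: "w \<in> carrier W"
  have "cl (- a) \<odot> w \<oplus> cl a \<odot> w = \<zero>" using act_add[OF w, of "- a" a] act_zero_left[OF w] by simp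
  from W.V.minus_equality[OF this act_closed[OF w] act_closed[OF w]] show ?thesis by simp
qed

lemma act_zero_right: "cl a \<odot> \<zero> = \<zero>"
proof -
  have "cl a \<odot> \<zero> = cl a \<odot> (cl 0 \<odot> \<zero>)" by (simp add: act_zero_left)
  also have "\<dots> = cl (a * 0) \<odot> \<zero>" by (subst act_mult) simp_all
  finally show ?thesis by (simp add: act_zero_left)
qed

lemma homog_closed: "homog W i \<subseteq> carrier W"
  using additive_subgroup.a_subset[OF W.homog_subgroup] .

lemma homog_act: "a \<in> tensor_part UNIV i \<Longrightarrow> w \<in> homog W j \<Longrightarrow> cl a \<odot> w \<in> homog W (i + j)"
  by (rule W.homog_smult) (auto simp: U_homog)

lemma homogeneous_vector:
  assumes "carrier W \<noteq> {\<zero>}"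
  obtains w q where "w \<in> homog W q" "w \<noteq> \<zero>"
proof -
  obtain x where x: "x \<in> carrier W" "x \<noteq> \<zero>" using assms W.V.zero_closed by blast
  obtain x0 x1 where x01: "x0 \<in> homog W 0" "x1 \<in> homog W 1" "x = x0 \<oplus> x1"
    using W.homog_decomp[OF x(1)] by blast
  have "x0 \<noteq> \<zero> \<or> x1 \<noteq> \<zero>" using x x01 by auto
  then show ?thesis using that x01 by blast
qed

text \<open>As 1 is the sum of the diagonal matrix units, one of them does not kill a given
  homogeneous nonzero vector. All matrix units are homogeneous, so moving the result to index 0
  keeps it homogeneous.\<close>

lemma highest_weight_vector:
  assumes "carrier W \<noteq> {\<zero>}"
  obtains l v q where "l \<in> weights \<chi>" "v \<in> homog W q" "v \<noteq> \<zero>" "cl (unit l 0 0) \<odot> v = v"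
proof -
  obtain w q where w: "w \<in> homog W q" "w \<noteq> \<zero>" using homogeneous_vector[OF assms] .
  have wc: "w \<in> carrier W" using w(1) homog_closed by blast
  have "\<exists>(l, m)\<in>columns. cl (unit l m m) \<odot> w \<noteq> \<zero>"
  proof (rule ccontr)
    assume "\<not> (\<exists>(l, m)\<in>columns. cl (unit l m m) \<odot> w \<noteq> \<zero>)"
    then have 0: "cl (unit l m m) \<odot> w = \<zero>" if "(l, m) \<in> columns" for l m using that by auto
    have "cl (\<Sum>(l, m)\<in>A. unit l m m) \<odot> w = \<zero>" if "A \<subseteq> columns" for A
      using that
    proof (induction A rule: infinite_finite_induct)
      case (insert x A)
      then show ?case by (cases x) (simp add: act_add wc 0)
    qed (simp_all add: act_zero_left wc)
    from this[of columns] have "cl 1 \<odot> w = \<zero>"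
      using one_eqv_units unfolding cl_eq_iff[symmetric] by simp
    then show False using w(2) wc by (simp add: act_one)
  qed
  then obtain l m where lm: "(l, m) \<in> columns" "cl (unit l m m) \<odot> w \<noteq> \<zero>" by auto
  then have l: "l \<in> weights \<chi>" and m: "m < 2 * CHAR('k)" "0 < 2 * CHAR('k)"
    by (auto simp: columns_def)
  \<comment> \<open>\<open>unit l 0 m\<close> leads back from v to the vector known to be nonzero,
    so v is nonzero.\<close>
  define v where "v = cl (unit l m 0) \<odot> w"
  have "cl (unit l 0 m) \<odot> v = cl (unit l 0 m * unit l m 0) \<odot> w" by (simp add: v_def act_mult[OF wc])
  also have "cl (unit l 0 m * unit l m 0) = cl (unit l m m)" unfolding cl_eq_iff by (rule unit_mult[OF m(1,2,1)])
  finally have nz: "v \<noteq> \<zero>" using lm(2) act_zero_right[of "unit l 0 m"] by auto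
  have "cl (unit l 0 0) \<odot> v = cl (unit l 0 0 * unit l m 0) \<odot> w" by (simp add: v_def act_mult[OF wc])
  also have "cl (unit l 0 0 * unit l m 0) = cl (unit l m 0)" unfolding cl_eq_iff by (rule unit_mult[OF m(1,2,2)])
  finally have "cl (unit l 0 0) \<odot> v = v" by (simp only: v_def)
  moreover have "v \<in> homog W (of_nat m + of_nat 0 + q)"
    unfolding v_def by (rule homog_act[OF unit_part w(1)])
  ultimately show ?thesis using that l nz by blast
qed

text \<open>A highest weight vector v yields the map a v_0 to a v from \<open>Zspace\<close> to
  \<open>W\<close>. It is injective since any nonzero vector of \<open>Zspace\<close> can be moved
  to v_0, and surjective since its image is a graded submodule containing v. For odd v the
  isomorphism is odd and needs a correction of signs.\<close>

lemma irreducible_is_verma: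
  assumes irr: "irreducible_supermodule U W"
  obtains l where "l \<in> weights \<chi>"
    "\<And>(V :: ('k words set, 'v, 'z) supermodule_scheme) f. verma_like \<chi> l V f \<Longrightarrow> super_isomorphic U V W"
proof -
  have ne: "carrier W \<noteq> {\<zero>}" using irr by (simp add: irreducible_supermodule_def)
  obtain l v q where l: "l \<in> weights \<chi>" and v: "v \<in> homog W q" "v \<noteq> \<zero>" "cl (unit l 0 0) \<odot> v = v"
    using highest_weight_vector[OF ne] .
  have vc: "v \<in> carrier W" using v(1) homog_closed by blast
  have p0: "0 < 2 * CHAR('k)" using CHAR_gt_2 by simp
  have d0: "(delta 0 :: nat \<Rightarrow> 'k) \<in> Zspace" by (rule delta_in_Zspace[OF p0])
  \<comment> \<open>Right multiplication by \<open>unit l 0 0\<close> retains only column 0 of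
    weight l, which is a v_0, while v is fixed by this unit.\<close>
  have key: "cl a \<odot> v = cl b \<odot> v" if eq: "app (verma_rep l a) (delta 0) = app (verma_rep l b) (delta 0)" for a b
  proof -
    have "a * unit l 0 0 \<sim>\<^sub>I b * unit l 0 0"
      unfolding eqv_iff_entries
    proof (intro ballI allI impI)
      fix l' m n assume *: "l' \<in> weights \<chi>" "m < 2 * CHAR('k)" "n < 2 * CHAR('k)"
      have "entry (c * unit l 0 0) l' m n = (if l' = l \<and> m = 0 then entry c l 0 n else 0)" for c
      proof -
        have "entry (c * unit l 0 0) l' m n = (\<Sum>r<2 * CHAR('k). if r = 0 then (if l' = l \<and> m = 0 then entry c l 0 n else 0) else 0)"
          unfolding entry_mult[OF *(2)] by (intro sum.cong refl) (use * in \<open>auto simp: entry_unit\<close>)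
        then show ?thesis using p0 by simp
      qed
      then show "entry (a * unit l 0 0) l' m n = entry (b * unit l 0 0) l' m n"
        using eq by (simp add: entry_def)
    qed
    then have "cl (a * unit l 0 0) \<odot> v = cl (b * unit l 0 0) \<odot> v" by (simp add: cl_eq_iff[symmetric])
    then show ?thesis by (simp add: act_mult vc v(3))
  qed
  have ex: "\<exists>a. app (verma_rep l a) (delta 0) = g" if "g \<in> Zspace" for g
    using highest_weight_orbit[OF l that] by blast
  \<comment> \<open>By \<open>key\<close> the chosen representative is immaterial.\<close>
  define \<psi> where "\<psi> g = cl (SOME a. app (verma_rep l a) (delta 0) = g) \<odot> v" for g
  have \<psi>: "\<psi> (app (verma_rep l a) (delta 0)) = cl a \<odot> v" for a
    unfolding \<psi>_def by (rule key) (rule someI[of _ a], rule refl)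
  have \<psi>_closed: "\<psi> g \<in> carrier W" for g by (simp add: \<psi>_def act_closed vc)
  have \<psi>_add: "\<psi> (g + h) = \<psi> g \<oplus> \<psi> h" if gh: "g \<in> Zspace" "h \<in> Zspace" for g h
  proof -
    obtain a b where [symmetric, simp]: "app (verma_rep l a) (delta 0) = g" "app (verma_rep l b) (delta 0) = h"
      using ex gh by metis
    show ?thesis using \<psi>[of "a + b"] by (simp add: \<psi> verma.W_add act_add vc)
  qed
  have \<psi>_act: "\<psi> (app (verma_rep l a) g) = cl a \<odot> \<psi> g" if g: "g \<in> Zspace" for a g
  proof -
    obtain b where [symmetric, simp]: "app (verma_rep l b) (delta 0) = g" using ex g by metis
    show ?thesis using \<psi>[of "a * b"] by (simp add: \<psi> verma.W_mult act_mult vc)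
  qed
  have \<psi>_minus: "\<psi> (- g) = \<ominus> \<psi> g" if g: "g \<in> Zspace" for g
    using \<psi>_act[OF g, of "- 1"] act_minus[OF \<psi>_closed, of 1 g] by (simp add: verma.W_minus act_one \<psi>_closed)
  have \<psi>_0: "\<psi> 0 = \<zero>" using \<psi>[of 0] by (simp add: act_zero_left vc)
  have \<psi>_homog: "\<psi> g \<in> homog W (j + q)" if "g \<in> Zspace" "g \<in> parity_space j" for g j
    using highest_weight_orbit_homog[OF l that] \<psi> homog_act[OF _ v(1)] by metis
  have \<psi>_inj: "g = 0" if g: "g \<in> Zspace" "\<psi> g = \<zero>" for g
  proof (rule ccontr)
    assume "g \<noteq> 0"
    then obtain a where "app (verma_rep l a) g = delta 0" using verma_transitive[OF g(1) _ d0] l by blast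
    then have "\<psi> (delta 0) = \<zero>" using \<psi>_act[OF g(1), of a] g(2) act_zero_right by simp
    moreover have "\<psi> (delta 0) = v" using \<psi>[of 1] by (simp add: act_one vc)
    ultimately show False using v(2) by simp
  qed
  have \<psi>_surj: "\<psi> ` Zspace = carrier W"
  proof -
    have "submodule (\<psi> ` Zspace) U W"
    proof (intro submodule.intro subgroup.intro submodule_axioms.intro)
      fix x assume "x \<in> \<psi> ` Zspace"
      then obtain g where g: "g \<in> Zspace" "x = \<psi> g" by blast
      have "\<ominus> x = \<psi> (- g)" using \<psi>_minus g by simp
      then show "inv\<^bsub>add_monoid W\<^esub> x \<in> \<psi> ` Zspace" using g(1) Zspace_uminus by (auto simp: a_inv_def)
      fix y assume "y \<in> \<psi> ` Zspace"
      then obtain h where h: "h \<in> Zspace" "y = \<psi> h" by blast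
      have "x \<oplus> y = \<psi> (g + h)" using \<psi>_add g h by simp
      then show "x \<otimes>\<^bsub>add_monoid W\<^esub> y \<in> \<psi> ` Zspace" using g(1) h(1) Zspace_add by auto
    next
      have "\<psi> 0 \<in> \<psi> ` Zspace" by (rule imageI[OF Zspace_0])
      then show "\<one>\<^bsub>add_monoid W\<^esub> \<in> \<psi> ` Zspace" by (simp add: \<psi>_0)
      fix X y assume "X \<in> carrier U" "y \<in> \<psi> ` Zspace"
      then obtain a g where "X = cl a" "g \<in> Zspace" "y = \<psi> g" by (auto elim!: U_cases)
      then show "X \<odot> y \<in> \<psi> ` Zspace" using \<psi>_act verma_rep_Zspace by (metis imageI)
    qed (auto simp: \<psi>_closed)
    moreover have "graded_subset W (\<psi> ` Zspace)"
      unfolding graded_subset_def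
    proof
      fix x assume "x \<in> \<psi> ` Zspace"
      then obtain g where g: "g \<in> Zspace" "x = \<psi> g" by blast
      define gp where "gp j = (\<lambda>n. if of_nat n = (j::bit) then g n else 0)" for j
      have gp: "gp j \<in> Zspace" "gp j \<in> parity_space j" for j
        using g(1) by (auto simp: gp_def Zspace_def parity_space_def)
      have "g = gp 0 + gp 1"
      proof
        fix n show "g n = (gp 0 + gp 1) n" by (cases "of_nat n :: bit") (simp_all add: gp_def)
      qed
      then have x: "x = \<psi> (gp 0) \<oplus> \<psi> (gp 1)" "x = \<psi> (gp 1) \<oplus> \<psi> (gp 0)"
        using \<psi>_add gp g(2) by (metis, metis add.commute)
      have im: "\<psi> (gp j) \<in> \<psi> ` Zspace" for j using gp by blast
      have h: "\<psi> (gp 0) \<in> homog W (0 + q)" "\<psi> (gp 1) \<in> homog W (1 + q)"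
        by (rule \<psi>_homog[OF gp])+
      show "\<exists>x0\<in>\<psi> ` Zspace \<inter> homog W 0. \<exists>x1\<in>\<psi> ` Zspace \<inter> homog W 1. x = x0 \<oplus> x1"
      \<comment> \<open>\<psi> shifts parities by q, so for odd v the two components change
        places.\<close>
      proof (cases q)
        case zero
        then show ?thesis using h[unfolded zero] im x(1) by (intro bexI[of _ "\<psi> (gp 0)"] bexI[of _ "\<psi> (gp 1)"]) auto
      next
        case one
        then show ?thesis using h[unfolded one] im x(2) by (intro bexI[of _ "\<psi> (gp 1)"] bexI[of _ "\<psi> (gp 0)"]) auto
      qed
    qed
    moreover have "v \<in> \<psi> ` Zspace" using \<psi>[of 1] d0 by (metis act_one vc app_ring(2) imageI verma.W_1)
    ultimately show ?thesis using irr v(2) unfolding irreducible_supermodule_def by blast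
  qed
  have \<psi>_bij: "bij_betw \<psi> Zspace (carrier W)"
  proof (rule bij_betw_imageI[OF inj_onI \<psi>_surj])
    fix g h assume gh: "g \<in> Zspace" "h \<in> Zspace" "\<psi> g = \<psi> h"
    have "\<psi> (g + - h) = \<psi> h \<oplus> \<ominus> \<psi> h" using \<psi>_add[OF gh(1) Zspace_uminus[OF gh(2)]] \<psi>_minus gh by simp
    then have "\<psi> (g + - h) = \<zero>" using \<psi>_closed by (simp add: W.V.r_neg)
    then have "g + - h = 0" using \<psi>_inj Zspace_add[OF gh(1) Zspace_uminus[OF gh(2)]] by blast
    then show "g = h" by simp
  qed
  have "super_isomorphic U V W" if V: "verma_like \<chi> l V f"
    for V :: "('k words set, 'v, 'z) supermodule_scheme" and f
  proof -
    interpret V: verma_like \<chi> l V f by (rule V)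
    \<comment> \<open>For odd v the sign automorphism provides the minus sign that the sign rule
      demands for odd elements of the algebra.\<close>
    define \<sigma> where "\<sigma> g = (if q = 1 then sign_map g else g)" for g
    have \<sigma>_Z: "\<sigma> g \<in> Zspace \<longleftrightarrow> g \<in> Zspace" for g by (simp add: \<sigma>_def)
    have \<sigma>\<sigma>: "\<sigma> (\<sigma> g) = g" for g by (simp add: \<sigma>_def)
    have \<sigma>_bij: "bij_betw \<sigma> Zspace Zspace"
      by (rule bij_betw_byWitness[of _ \<sigma>]) (auto simp: \<sigma>\<sigma> \<sigma>_Z)
    define \<phi> where "\<phi> x = \<psi> (\<sigma> (f x))" for x
    have "bij_betw \<phi> (carrier V) (carrier W)"
      using bij_betw_trans[OF bij_betw_trans[OF V.bij \<sigma>_bij] \<psi>_bij] by (simp add: \<phi>_def comp_def cong: bij_betw_cong)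
    moreover have "\<phi> \<in> super_hom U V W q"
      unfolding super_hom_def
    proof (intro CollectI conjI ballI allI)
      show "\<phi> \<in> carrier V \<rightarrow> carrier W" by (simp add: \<phi>_def \<psi>_closed)
      fix x y assume x: "x \<in> carrier V" and y: "y \<in> carrier V"
      have "\<sigma> (f (x \<oplus>\<^bsub>V\<^esub> y)) = \<sigma> (f x) + \<sigma> (f y)"
        using x y by (simp add: \<sigma>_def V.f_add sign_map_add)
      then show "\<phi> (x \<oplus>\<^bsub>V\<^esub> y) = \<phi> x \<oplus> \<phi> y"
        using x y by (simp add: \<phi>_def \<psi>_add \<sigma>_Z V.f_Z)
    next
      fix j X x assume "X \<in> homog U j" and x: "x \<in> carrier V"
      then obtain a where a: "X = cl a" "a \<in> tensor_part UNIV j" by (auto simp: U_homog)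
      have fx: "f x \<in> Zspace" using x by (rule V.f_Z)
      have "\<sigma> (app (verma_rep l a) (f x)) =
          (if q = 1 \<and> j = 1 then - app (verma_rep l a) (\<sigma> (f x)) else app (verma_rep l a) (\<sigma> (f x)))"
        by (simp add: \<sigma>_def sign_map_rep[OF a(2) fx])
      then show "\<phi> (X \<odot>\<^bsub>V\<^esub> x) = (if q = 1 \<and> j = 1 then \<ominus> (X \<odot> \<phi> x) else X \<odot> \<phi> x)"
        using x fx by (simp add: \<phi>_def a V.f_act \<psi>_minus \<psi>_act \<sigma>_Z verma_rep_Zspace)
    next
      fix j x assume "x \<in> homog V j"
      then have "\<sigma> (f x) \<in> Zspace" "\<sigma> (f x) \<in> parity_space j"
        by (auto simp: V.homog \<sigma>_Z V.f_Z) (simp add: \<sigma>_def)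
      then show "\<phi> x \<in> homog W (j + q)" unfolding \<phi>_def by (rule \<psi>_homog)
    qed
    ultimately show ?thesis unfolding super_isomorphic_def by blast
  qed
  then show ?thesis using that l by blast
qed

end

section \<open>The regular supermodule and graded semisimplicity\<close>

context osp_regular
begin

text \<open>Even and odd elements have nonzero entries at disjoint positions; this makes the grading
  of the quotient a direct sum.\<close>

lemma homog_U_unique:
  assumes "a \<in> tensor_part UNIV 0" "b \<in> tensor_part UNIV 1" "a \<sim>\<^sub>I b"
  shows "a \<sim>\<^sub>I 0"
  unfolding eqv_iff_entries
proof (intro ballI allI impI)
  fix l m n assume l: "l \<in> weights \<chi>"
  have "entry a l m n = entry b l m n" by (rule entry_eqv[OF assms(3) l])
  then have "entry a l m n = 0"
    using entry_parity[OF assms(1), of l m n] entry_parity[OF assms(2), of l m n] by force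
  then show "entry a l m n = entry 0 l m n" by (simp only: entry_0)
qed

lemma supermodule_regular: "supermodule U (regular_module U)"
proof (intro supermodule.intro ring_U supermodule_axioms.intro)
  show "abelian_group (regular_module U)"
  proof (rule abelian_groupI)
    fix X assume "X \<in> carrier (regular_module U)"
    then obtain a where a: "X = cl a" by (auto elim!: U_cases)
    show "\<exists>Y\<in>carrier (regular_module U). Y \<oplus>\<^bsub>regular_module U\<^esub> X = \<zero>\<^bsub>regular_module U\<^esub>"
      by (intro bexI[of _ "cl (- a)"]) (simp_all add: a U_zero)
  qed (auto elim!: U_cases simp: U_zero algebra_simps)
next
  fix i
  show "additive_subgroup (homog (regular_module U) i) (regular_module U)"
  proof (intro additive_subgroup.intro subgroup.intro)
    fix X assume "X \<in> homog (regular_module U) i"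
    then obtain a where "X = cl a" "a \<in> tensor_part UNIV i" by (auto simp: U_homog)
    then have "\<ominus>\<^bsub>U\<^esub> X \<in> homog (regular_module U) i" by (auto simp: U_a_inv U_homog tensor_part_minus)
    then show "inv\<^bsub>add_monoid (regular_module U)\<^esub> X \<in> homog (regular_module U) i"
      by (simp only: regular_module_a_inv)
  qed (auto simp: U_homog U_zero tensor_part_add tensor_part_zero)
next
  fix X assume "X \<in> carrier (regular_module U)"
  then obtain a where a: "X = cl a" by (auto elim!: U_cases)
  obtain a0 a1 where a01: "a0 \<in> tensor_part UNIV 0" "a1 \<in> tensor_part UNIV 1" "a = a0 + a1"
    by (rule parity_part_decomp)
  show "\<exists>!X0. X0 \<in> homog (regular_module U) 0 \<and> (\<exists>X1\<in>homog (regular_module U) 1. X = X0 \<oplus>\<^bsub>regular_module U\<^esub> X1)"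
  proof (rule ex1I[of _ "cl a0"])
    show "cl a0 \<in> homog (regular_module U) 0 \<and> (\<exists>X1\<in>homog (regular_module U) 1. X = cl a0 \<oplus>\<^bsub>regular_module U\<^esub> X1)"
      using a01 by (auto simp: U_homog a intro!: bexI[of _ a1])
    fix X0 assume "X0 \<in> homog (regular_module U) 0 \<and> (\<exists>X1\<in>homog (regular_module U) 1. X = X0 \<oplus>\<^bsub>regular_module U\<^esub> X1)"
    then obtain b0 b1 where b: "X0 = cl b0" "b0 \<in> tensor_part UNIV 0" "b1 \<in> tensor_part UNIV 1" "cl a = cl (b0 + b1)"
      by (auto simp: U_homog a)
    then have "a0 + a1 \<sim>\<^sub>I b0 + b1" by (simp only: cl_eq_iff a01(3))
    then have "(a0 + - b0) \<sim>\<^sub>I b1 + - a1" by (simp add: eqv_def algebra_simps)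
    then have "a0 + - b0 \<sim>\<^sub>I 0"
      by (intro homog_U_unique[of _ "b1 + - a1"] tensor_part_add tensor_part_minus a01 b)
    then show "X0 = cl a0" by (simp add: b(1) cl_eq_iff eqv_sym eqv_def[of a0] eqv_def[of "a0 - b0"])
  qed
next
  fix X i Y j assume "X \<in> homog U i" "Y \<in> homog (regular_module U) j"
  then obtain a b where ab: "X = cl a" "Y = cl b" "a \<in> tensor_part UNIV i" "b \<in> tensor_part UNIV j"
    by (auto simp: U_homog)
  have "X \<odot>\<^bsub>regular_module U\<^esub> Y = cl (a * b)" by (simp add: ab)
  then show "X \<odot>\<^bsub>regular_module U\<^esub> Y \<in> homog (regular_module U) (i + j)"
    unfolding regular_module_simps U_homog using tensor_part_mult[OF ab(3,4)] by (metis imageI)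
qed (auto elim!: U_cases simp: U_one distrib_left distrib_right mult.assoc)

lemma semisimple_super_U: "semisimple_superalgebra U"
  unfolding semisimple_superalgebra_def
proof (intro conjI allI impI supermodule_regular)
  fix N assume "submodule N U (regular_module U) \<and> graded_subset U N"
  then obtain J where "N \<inter> column_ideal J = {\<zero>\<^bsub>U\<^esub>}" "N <+>\<^bsub>U\<^esub> column_ideal J = carrier U"
    using column_complement by blast
  then show "\<exists>N'. submodule N' U (regular_module U) \<and> graded_subset U N' \<and> N \<inter> N' = {\<zero>\<^bsub>U\<^esub>} \<and> N <+>\<^bsub>U\<^esub> N' = carrier U"
    using submodule_column_ideal graded_column_ideal by blast
qed

end

section \<open>The Borel subalgebra\<close>

abbreviation borel :: "osp_basis set" where
  "borel \<equiv> {e_b, h_b, E_b}"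

interpretation borel: word_rep "\<lambda>c. c" "\<lambda>b. if b = h_b then l else 0" for l :: "'k::field"
  by unfold_locales (simp_all add: mult.commute)

lemma borel_character_eq: "borel_character l = borel.W l"
  by (simp add: borel_character_def borel.W_def fun_eq_iff)

lemma embed_in_tensor':
  assumes "\<And>b. x b \<noteq> 0 \<Longrightarrow> b \<in> S" shows "embed x \<in> carrier (tensor_algebra S)"
proof -
  have "Poly_Mapping.single [b] (x b) \<in> carrier (tensor_algebra S)" for b
    using assms[of b] by (cases "x b = 0") (auto simp: carrier_tensor_algebra)
  then show ?thesis unfolding embed_def sum_osp_basis by (intro tensor_closed)
qed

lemma tensor_diff_closed:
  assumes "a \<in> carrier (tensor_algebra S)" "b \<in> carrier (tensor_algebra S)"
  shows "a - b \<in> carrier (tensor_algebra S)"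
  using tensor_closed(1)[OF assms(1) tensor_closed(3)[OF assms(2)]] by simp

lemma tensor_power_closed: "a \<in> carrier (tensor_algebra S) \<Longrightarrow> a ^ n \<in> carrier (tensor_algebra S)"
  by (induction n) simp_all

lemma scalar_word_in_tensor: "scalar_word c \<in> carrier (tensor_algebra S)"
  by (auto simp: carrier_tensor_algebra scalar_word_def)

lemma borel_part_coords: "x \<in> osp_part borel i \<Longrightarrow> x f_b = 0 \<and> x F_b = 0"
  by (auto simp: osp_part_def)

lemma bracket_borel:
  assumes "x \<in> osp_part borel i" "y \<in> osp_part borel j" "bracket x y b \<noteq> 0"
  shows "b \<in> borel"
  using borel_part_coords[OF assms(1)] borel_part_coords[OF assms(2)] assms(3)
  by (cases b) (auto simp: bracket_coords)

lemma borel_relations_closed: "reduced_relations \<chi> borel \<subseteq> carrier (tensor_algebra borel)"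
proof
  fix r assume "r \<in> reduced_relations \<chi> borel"
  then consider x y i j where "r = embed x * embed y - (if i = 1 \<and> j = 1 then - 1 else 1) * (embed y * embed x) -
      embed (bracket x y)" "x \<in> osp_part borel i" "y \<in> osp_part borel j"
    | x where "r = embed x ^ CHAR('a) - embed (p_map x) - scalar_word (\<chi> x ^ CHAR('a))" "x \<in> osp_part borel 0"
    unfolding reduced_relations_def by blast
  then show "r \<in> carrier (tensor_algebra borel)"
  proof cases
    case 1
    have "embed (bracket x y) \<in> carrier (tensor_algebra borel)"
      by (rule embed_in_tensor') (use bracket_borel 1 in blast)
    then show ?thesis
      using embed_in_tensor[OF 1(2)] embed_in_tensor[OF 1(3)] unfolding 1(1)
      by (auto intro!: tensor_diff_closed)
  next
    case 2
    have "embed (p_map x) \<in> carrier (tensor_algebra borel)"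
      by (rule embed_in_tensor') (use 2(2) in \<open>auto simp: p_map_def scale_def osp_part_def\<close>)
    then show ?thesis
      using embed_in_tensor[OF 2(2)] unfolding 2(1)
      by (intro tensor_diff_closed tensor_power_closed scalar_word_in_tensor)
  qed
qed

text \<open>Intersecting the large ideal with the tensor algebra of the Borel subalgebra gives an
  ideal there that contains the smaller set of relations.\<close>

lemma reduced_ideal_borel_subset: "reduced_ideal \<chi> borel \<subseteq> reduced_ideal \<chi> UNIV"
proof -
  let ?I = "reduced_ideal \<chi> UNIV" and ?T = "tensor_algebra borel"
  have inv: "inv\<^bsub>add_monoid ?T\<^esub> x = - x" if "x \<in> carrier ?T" for x
  proof -
    have "\<ominus>\<^bsub>?T\<^esub> x = - x"
      by (rule abelian_group.minus_equality[OF ring.is_abelian_group[OF ring_tensor_algebra]]) (use that in simp_all)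
    then show ?thesis by (simp only: a_inv_def)
  qed
  have "ideal (?I \<inter> carrier ?T) ?T"
  proof (intro idealI ring_tensor_algebra subgroup.intro)
    fix x assume x: "x \<in> ?I \<inter> carrier ?T"
    then show "inv\<^bsub>add_monoid ?T\<^esub> x \<in> ?I \<inter> carrier ?T"
      using inv[of x] reduced_ideal_closed(4)[of x \<chi>] by (simp only: Int_iff) simp
  qed (auto intro: reduced_ideal_closed zero_in_reduced_ideal)
  moreover have "reduced_relations \<chi> borel \<subseteq> ?I \<inter> carrier ?T"
    using borel_relations_closed[of \<chi>] reduced_relations_mono[of borel UNIV \<chi>] relations_in_reduced_ideal by blast
  ultimately show ?thesis using reduced_ideal_minimal by blast
qed

context osp_regular
begin

text \<open>Brackets of the Borel subalgebra lie in the span of e and E, where the character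
  vanishes. Without an f-coordinate the p-map multiplies x by x_h^(p-1), so the p-th power relation
  becomes x_h^p times l^p - l = \<chi>(h)^p.\<close>

lemma borel_character_ideal:
  assumes l: "l \<in> weights \<chi>" and a: "a \<in> reduced_ideal \<chi> borel"
  shows "borel_character l a = 0"
  unfolding borel_character_eq
proof (rule borel.W_reduced_ideal[OF _ borel_relations_closed a])
  fix r assume "r \<in> reduced_relations \<chi> borel"
  then consider x y i j where "r = embed x * embed y - (if i = 1 \<and> j = 1 then - 1 else 1) * (embed y * embed x) -
      embed (bracket x y)" "x \<in> osp_part borel i" "y \<in> osp_part borel j"
    | x where "r = embed x ^ CHAR('k) - embed (p_map x) - scalar_word (\<chi> x ^ CHAR('k))" "x \<in> osp_part borel 0"
    unfolding reduced_relations_def by blast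
  then show "borel.W l r = 0"
  proof cases
    case 1
    show ?thesis unfolding 1(1)
      by (rule borel.W_bracket_relation[OF _ 1(2,3)])
        (auto simp: sum_osp_basis basis_vec_def scale_def)
  next
    case 2
    have x0: "x f_b = 0" "x \<in> osp_even" using 2(2) by (auto simp: osp_part_def)
    have s: "(\<Sum>b\<in>UNIV. z b * (if b = h_b then l else 0)) = z h_b * l" for z
      by (simp add: sum_osp_basis)
    have "(x h_b ^ 2) ^ ((CHAR('k) - 1) div 2) * x h_b = x h_b ^ CHAR('k)"
      using odd_CHAR by (simp flip: power_mult power_Suc2)
    then have "p_map x h_b = x h_b ^ CHAR('k)" by (simp add: p_map_def scale_def x0)
    moreover have "l ^ CHAR('k) = l + \<chi> (basis_vec h_b) ^ CHAR('k)" using l by (simp add: weights_def algebra_simps)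
    ultimately show ?thesis
      unfolding 2(1) borel.W_diff borel.W_power borel.W_scalar_word borel.W_embed s
      by (simp add: power_mult_distrib even_dual_coords[OF dual x0(2) chi_e chi_f] algebra_simps)
  qed
qed

definition borel_cl :: "'k words \<Rightarrow> 'k words set" where
  "borel_cl w = reduced_ideal \<chi> borel +>\<^bsub>tensor_algebra borel\<^esub> w"

lemma borel_cl_eq: "borel_cl w = {i + w | i. i \<in> reduced_ideal \<chi> borel}"
  by (auto simp: borel_cl_def a_r_coset_def r_coset_def)

lemma carrier_U_borel: "carrier (U_borel \<chi>) = borel_cl ` carrier (tensor_algebra borel)"
  by (auto simp: reduced_enveloping_def Let_def FactRing_def A_RCOSETS_def' borel_cl_def)

lemma borel_inclusion_cl: "borel_inclusion \<chi> (borel_cl w) = cl w"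
proof -
  have "borel_inclusion \<chi> (borel_cl w) = {i + (j + w) | i j. i \<in> I \<and> j \<in> reduced_ideal \<chi> borel}"
    by (auto simp: borel_inclusion_def set_add_def set_mult_def borel_cl_eq)
  also have "\<dots> = {i + w | i. i \<in> I}"
  proof (intro equalityI subsetI)
    fix x assume "x \<in> {i + (j + w) | i j. i \<in> I \<and> j \<in> reduced_ideal \<chi> borel}"
    then obtain i j where ij: "x = (i + j) + w" "i \<in> I" "j \<in> reduced_ideal \<chi> borel" by (auto simp: add.assoc)
    then have "i + j \<in> I" using reduced_ideal_borel_subset reduced_ideal_closed(1) by blast
    then show "x \<in> {i + w | i. i \<in> I}" using ij(1) by blast
  next
    fix x assume "x \<in> {i + w | i. i \<in> I}"
    then obtain i where "x = i + (0 + w)" "i \<in> I" by auto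
    then show "x \<in> {i + (j + w) | i j. i \<in> I \<and> j \<in> reduced_ideal \<chi> borel}"
      using zero_in_reduced_ideal by blast
  qed
  also have "\<dots> = cl w"
  proof -
    have "\<exists>i. x = i + w \<and> i \<in> I" if "x - w \<in> I" for x using that by (intro exI[of _ "x - w"]) simp
    then show ?thesis by (auto simp: cl_def eqv_def)
  qed
  finally show ?thesis .
qed

lemma K_module_simps [simp]:
  "carrier (K_module l) = UNIV" "m \<oplus>\<^bsub>K_module l\<^esub> n = m + n"
  "homog (K_module l) i = (if i = 0 then UNIV else {0})"
  by (simp_all add: K_module_def)

lemma K_module_act:
  assumes l: "l \<in> weights \<chi>"
  shows "borel_cl w \<odot>\<^bsub>K_module l\<^esub> m = borel_character l w * m"
proof -
  have "borel_character l ` borel_cl w = {borel_character l w}"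
    using borel_character_ideal[OF l] zero_in_reduced_ideal[of \<chi> borel]
    by (auto simp: borel_cl_eq borel_character_eq borel.W_add image_iff)
  then show ?thesis by (simp add: K_module_def)
qed

text \<open>e and E kill v_0 and h acts on it by l, so v_0 spans a copy of
  \<open>K_module l\<close>; this is what makes \<open>Psi\<close> respect the balancing
  relations.\<close>

lemma borel_acts_by_character:
  assumes w: "w \<in> carrier (tensor_algebra borel)"
  shows "app (verma_rep l w) (delta 0) = app (scal (borel_character l w)) (delta 0)"
proof -
  have word: "app (prod_list (map (verma_op l) u)) (delta 0) =
      app (scal (prod_list (map (\<lambda>b. if b = h_b then l else 0) u))) (delta 0)" if "set u \<subseteq> borel" for u
    using that
  proof (induction u)
    case (Cons b u)
    define c where "c = prod_list (map (\<lambda>b. if b = h_b then l else 0) u)"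
    have u: "app (prod_list (map (verma_op l) (b # u))) (delta 0) = app (verma_op l b) (app (scal c) (delta 0))"
      using Cons by (simp only: list.map prod_list.Cons app_ring c_def set_simps insert_subset)
    have E: "app (verma_E l) (app (scal c) (delta 0)) = 0"
      by (auto simp: fun_eq_iff delta_def)
    have H: "app (verma_H l) (app (scal c) (delta 0)) = app (scal (l * c)) (delta 0)"
      by (auto simp: fun_eq_iff delta_def)
    have c: "prod_list (map (\<lambda>b. if b = h_b then l else 0) (b # u)) = (if b = h_b then l * c else 0)"
      by (simp add: c_def)
    from Cons.prems consider "b = e_b" | "b = h_b" | "b = E_b" by auto
    then show ?case
    proof cases
      case 1
      then show ?thesis unfolding u c by (simp only: verma_op.simps app_ring E app_0 scal_hom(1)) simp
    next
      case 2
      then show ?thesis unfolding u c by (simp only: verma_op.simps H if_True refl)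
    next
      case 3
      then show ?thesis unfolding u c by (simp only: verma_op.simps app_ring E app_0 scal_hom(1)) simp
    qed
  qed (simp add: scal_hom)
  have "app (verma_rep l w) (delta 0) = (\<Sum>u\<in>Poly_Mapping.keys w. app (scal (Poly_Mapping.lookup w u))
      (app (prod_list (map (verma_op l) u)) (delta 0)))"
    by (simp add: verma.W_def app_sum_left)
  also have "\<dots> = (\<Sum>u\<in>Poly_Mapping.keys w. app (scal (Poly_Mapping.lookup w u *
      prod_list (map (\<lambda>b. if b = h_b then l else 0) u))) (delta 0))"
    by (intro sum.cong refl) (use w word in \<open>simp add: carrier_tensor_algebra scal_hom(6)\<close>)
  also have "\<dots> = app (scal (borel_character l w)) (delta 0)"
    unfolding borel_character_def app_sum_left[symmetric] verma.s_sum ..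
  finally show ?thesis .
qed

end

section \<open>Baby Verma modules\<close>

locale baby_verma_module = osp_regular \<chi> for \<chi> :: "'k::alg_closed_field osp \<Rightarrow> 'k" +
  fixes l :: 'k
  assumes weight: "l \<in> weights \<chi>"
begin

definition G where "G = free_Abelian_group (carrier U \<times> (UNIV :: 'k set))"
definition R where "R = tensor_relations U (U_borel \<chi>) (borel_inclusion \<chi>) (K_module l)"
definition H where "H = generate G R"

lemma comm_group_G: "comm_group G"
  by (simp add: G_def abelian_free_Abelian_group)

lemma G_simps [simp]:
  "x \<in> carrier G \<longleftrightarrow> Poly_Mapping.keys x \<subseteq> carrier U \<times> UNIV" "\<one>\<^bsub>G\<^esub> = 0" "x \<otimes>\<^bsub>G\<^esub> y = x + y"
  by (simp_all add: G_def)

lemma G_inv: "x \<in> carrier G \<Longrightarrow> inv\<^bsub>G\<^esub> x = - x"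
  by (simp add: G_def)

lemma G_closed:
  "x \<in> carrier G \<Longrightarrow> y \<in> carrier G \<Longrightarrow> x + y \<in> carrier G"
  "x \<in> carrier G \<Longrightarrow> y \<in> carrier G \<Longrightarrow> x - y \<in> carrier G"
  "x \<in> carrier G \<Longrightarrow> - x \<in> carrier G" "0 \<in> carrier G" "frag_of (cl a, c) \<in> carrier G"
  using keys_add[of x y] keys_diff[of x y] by (auto simp: keys_frag_of)

lemma G_frag_cases:
  assumes "x \<in> carrier G" "P 0" "\<And>x y. x \<in> carrier G \<Longrightarrow> y \<in> carrier G \<Longrightarrow> P x \<Longrightarrow> P y \<Longrightarrow> P (x - y)"
    "\<And>a c. P (frag_of (cl a, c))"
  shows "P x"
proof (rule free_Abelian_group_induct[of x "carrier U \<times> UNIV"])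
  show "P (frag_of z)" if "z \<in> carrier U \<times> UNIV" for z
    using that assms(4) by (auto elim!: U_cases)
qed (use assms in auto)

text \<open>The map \<open>X \<otimes> c \<mapsto> c X v\<^sub>0\<close>.\<close>

definition rv :: "'k words set \<Rightarrow> nat \<Rightarrow> 'k" where
  "rv X = app (the_elem (verma_rep l ` X)) (delta 0)"

lemma rv_cl [simp]: "rv (cl a) = app (verma_rep l a) (delta 0)"
proof -
  have "verma_rep l ` cl a = (\<lambda>_. verma_rep l a) ` cl a"
    by (intro image_cong refl eqv_verma_rep weight) (simp add: cl_def)
  also have "\<dots> = {verma_rep l a}" using mem_cl[of a] by blast
  finally show ?thesis by (simp add: rv_def)
qed

definition Psi :: "('k words set \<times> 'k \<Rightarrow>\<^sub>0 int) \<Rightarrow> nat \<Rightarrow> 'k" where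
  "Psi x = (\<Sum>k\<in>Poly_Mapping.keys x. app (scal (of_int (Poly_Mapping.lookup x k) * snd k)) (rv (fst k)))"

lemma Psi_superset:
  assumes "finite A" "Poly_Mapping.keys x \<subseteq> A"
  shows "Psi x = (\<Sum>k\<in>A. app (scal (of_int (Poly_Mapping.lookup x k) * snd k)) (rv (fst k)))"
  unfolding Psi_def using assms
  by (intro sum.mono_neutral_left) (auto simp: in_keys_iff scal_hom(1))

lemma Psi_add: "Psi (x + y) = Psi x + Psi y"
proof -
  let ?A = "Poly_Mapping.keys x \<union> Poly_Mapping.keys y"
  have "Psi (x + y) = (\<Sum>k\<in>?A. app (scal (of_int (Poly_Mapping.lookup (x + y) k) * snd k)) (rv (fst k)))"
    by (rule Psi_superset) (use keys_add[of x y] in auto)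
  then show ?thesis
    using Psi_superset[of ?A x] Psi_superset[of ?A y]
    by (simp add: lookup_add scal_hom(3) distrib_right sum.distrib)
qed

lemma Psi_0 [simp]: "Psi 0 = 0"
  by (simp add: Psi_def)

lemma Psi_minus: "Psi (- x) = - Psi x"
  using Psi_add[of x "- x"] by (simp add: eq_neg_iff_add_eq_0 add.commute)

lemma Psi_diff: "Psi (x - y) = Psi x - Psi y"
  using Psi_add[of x "- y"] by (simp add: Psi_minus)

lemma Psi_frag [simp]: "Psi (frag_of (X, c)) = app (scal c) (rv X)"
  by (simp add: Psi_def keys_frag_of)

lemma Psi_Zspace: "x \<in> carrier G \<Longrightarrow> Psi x \<in> Zspace"
proof (erule G_frag_cases)
  fix x y assume "Psi x \<in> Zspace" "Psi y \<in> Zspace"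
  then show "Psi (x - y) \<in> Zspace" by (simp add: Psi_diff Zspace_def)
next
  have "delta 0 \<in> Zspace" using CHAR_gt_2 by (simp add: delta_in_Zspace)
  from verma_rep_Zspace[OF this] show "Psi (frag_of (cl a, c)) \<in> Zspace" for a c
    by (simp add: Zspace_def)
qed (simp only: Psi_0 Zspace_0)

lemma relation_cases:
  assumes "r \<in> R"
  obtains a b c where "r = frag_of (cl (a + b), c) - frag_of (cl a, c) - frag_of (cl b, c)"
  | a c d where "r = frag_of (cl a, c + d) - frag_of (cl a, c) - frag_of (cl a, d)"
  | a w c where "w \<in> carrier (tensor_algebra borel)"
      "r = frag_of (cl (a * w), c) - frag_of (cl a, borel_character l w * c)"
  using assms unfolding R_def tensor_relations_def carrier_U_borel
  by (auto elim!: U_cases simp: borel_inclusion_cl K_module_act[OF weight])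

lemma relationI:
  "frag_of (cl (a + b), c) - frag_of (cl a, c) - frag_of (cl b, c) \<in> R"
  "frag_of (cl a, c + d) - frag_of (cl a, c) - frag_of (cl a, d) \<in> R"
  "w \<in> carrier (tensor_algebra borel) \<Longrightarrow> frag_of (cl (a * w), c) - frag_of (cl a, borel_character l w * c) \<in> R"
proof -
  show "frag_of (cl (a + b), c) - frag_of (cl a, c) - frag_of (cl b, c) \<in> R"
    unfolding R_def tensor_relations_def
    by (intro UnI1 CollectI exI[of _ "cl a"] exI[of _ "cl b"] exI[of _ c]) simp
  show "frag_of (cl a, c + d) - frag_of (cl a, c) - frag_of (cl a, d) \<in> R"
    unfolding R_def tensor_relations_def
    by (rule UnI1, rule UnI2, intro CollectI exI[of _ "cl a"] exI[of _ c] exI[of _ d]) simp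
  assume "w \<in> carrier (tensor_algebra borel)"
  then show "frag_of (cl (a * w), c) - frag_of (cl a, borel_character l w * c) \<in> R"
    unfolding R_def tensor_relations_def
    by (intro UnI2 CollectI exI[of _ "cl a"] exI[of _ "borel_cl w"] exI[of _ c])
      (simp add: carrier_U_borel borel_inclusion_cl K_module_act[OF weight])
qed

lemma R_carrier: "r \<in> R \<Longrightarrow> r \<in> carrier G"
  by (erule relation_cases) (auto intro!: G_closed simp del: G_simps)

lemma R_Psi: "r \<in> R \<Longrightarrow> Psi r = 0"
proof (erule relation_cases)
  fix a w c assume w: "w \<in> carrier (tensor_algebra borel)"
    and r: "r = frag_of (cl (a * w), c) - frag_of (cl a, borel_character l w * c)"
  have comm: "app (verma_rep l a) (app (scal d) g) = app (scal d) (app (verma_rep l a) g)" for d g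
  proof -
    have "verma_rep l a * scal d = scal d * verma_rep l a"
      using scalar_word_commute[of a d] by (metis verma.W_mult verma.W_scalar_word)
    then show ?thesis by (metis app_ring(6))
  qed
  show "Psi r = 0"
    unfolding r Psi_diff
    by (simp add: verma.W_mult borel_acts_by_character[OF w] comm fun_eq_iff)
next
  fix a b c assume r: "r = frag_of (cl (a + b), c) - frag_of (cl a, c) - frag_of (cl b, c)"
  show "Psi r = 0" unfolding r Psi_diff Psi_frag rv_cl verma.W_add app_ring app_add by simp
next
  fix a c d assume r: "r = frag_of (cl a, c + d) - frag_of (cl a, c) - frag_of (cl a, d)"
  show "Psi r = 0" unfolding r Psi_diff Psi_frag scal_hom(3) app_ring by simp
qed

lemma subgroup_H: "subgroup H G"
  unfolding H_def by (rule group.generate_is_subgroup) (use comm_group_G R_carrier in \<open>auto simp: comm_group_def simp del: G_simps\<close>)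

lemma H_closed:
  "x \<in> H \<Longrightarrow> x \<in> carrier G" "x \<in> H \<Longrightarrow> y \<in> H \<Longrightarrow> x + y \<in> H" "x \<in> H \<Longrightarrow> - x \<in> H" "0 \<in> H"
  "x \<in> H \<Longrightarrow> y \<in> H \<Longrightarrow> x - y \<in> H"
proof -
  interpret subgroup H G by (rule subgroup_H)
  show c: "x \<in> carrier G" if "x \<in> H" for x using that by (rule mem_carrier)
  show a: "x + y \<in> H" if "x \<in> H" "y \<in> H" for x y using m_closed[OF that] by simp
  show n: "- x \<in> H" if "x \<in> H" for x using m_inv_closed[OF that] G_inv[OF c[OF that]] by simp
  show "0 \<in> H" using one_closed by simp
  show "x - y \<in> H" if "x \<in> H" "y \<in> H" using a[OF that(1) n[OF that(2)]] by simp
qed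

lemma R_in_H: "r \<in> R \<Longrightarrow> r \<in> H"
  unfolding H_def by (rule generate.incl)

lemma H_Psi: "x \<in> H \<Longrightarrow> Psi x = 0"
proof -
  have "x \<in> carrier G \<and> Psi x = 0" if "x \<in> generate G R" for x
    using that
  proof (induction rule: generate.induct)
    case one
    then show ?case using G_closed(4) by (simp only: G_simps(2) Psi_0 simp_thms)
  next
    case (incl r)
    then show ?case using R_carrier R_Psi by blast
  next
    case (inv r)
    have "- r \<in> carrier G" "Psi (- r) = 0"
      using G_closed(3)[OF R_carrier[OF inv]] R_Psi[OF inv] by (simp_all only: Psi_minus) simp
    then show ?case unfolding G_inv[OF R_carrier[OF inv]] by blast
  next
    case (eng x y)
    then show ?case using G_closed(1)[of x y] by (simp only: G_simps(3) Psi_add simp_thms) simp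
  qed
  then show "x \<in> H \<Longrightarrow> Psi x = 0" by (simp add: H_def)
qed

lemma frag_zero: "frag_of (cl 0, c) \<in> H" "frag_of (cl a, 0) \<in> H"
proof -
  have "- frag_of (cl 0, c) \<in> H" using R_in_H[OF relationI(1)[of 0 0 c]] by simp
  from H_closed(3)[OF this] show "frag_of (cl 0, c) \<in> H" by simp
  have "- frag_of (cl a, 0) \<in> H" using R_in_H[OF relationI(2)[of a 0 0]] by simp
  from H_closed(3)[OF this] show "frag_of (cl a, 0) \<in> H" by simp
qed

lemma frag_add: "frag_of (cl (a + b), c) - frag_of (cl a, c) - frag_of (cl b, c) \<in> H"
  by (rule R_in_H[OF relationI(1)])

text \<open>Scalars cross the tensor sign because scalar words belong to the tensor algebra of the
  Borel subalgebra; so every class is a pure tensor with second factor 1.\<close>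

lemma frag_normal_form: "x \<in> carrier G \<Longrightarrow> \<exists>a. x - frag_of (cl a, 1) \<in> H"
proof (erule G_frag_cases)
  show "\<exists>a. 0 - frag_of (cl a, 1) \<in> H"
    using H_closed(3)[OF frag_zero(1)] by (intro exI[of _ 0]) simp
next
  fix x y assume "\<exists>a. x - frag_of (cl a, 1) \<in> H" "\<exists>a. y - frag_of (cl a, 1) \<in> H"
  then obtain a b where ab: "x - frag_of (cl a, 1) \<in> H" "y - frag_of (cl b, 1) \<in> H" by blast
  have "frag_of (cl a, 1) - frag_of (cl (a - b), 1) - frag_of (cl b, 1) \<in> H"
    using frag_add[of "a - b" b 1] by simp
  from H_closed(2)[OF H_closed(5)[OF ab] this]
  show "\<exists>a. (x - y) - frag_of (cl a, 1) \<in> H" by (intro exI[of _ "a - b"]) (simp add: algebra_simps)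
next
  fix a c
  have "frag_of (cl (a * scalar_word c), 1) - frag_of (cl a, c) \<in> H"
    using R_in_H[OF relationI(3)[OF scalar_word_in_tensor, of a c 1]]
    by (simp add: borel_character_eq borel.W_scalar_word)
  from H_closed(3)[OF this] show "\<exists>b. frag_of (cl a, c) - frag_of (cl b, 1) \<in> H"
    by (intro exI[of _ "a * scalar_word c"]) simp
qed

text \<open>In normal form the element is a tensor of a and 1 with a v_0 = 0. Then a lies in the
  left ideal generated by E and h - l modulo \<open>I\<close>, and these two cross the tensor sign,
  where the character sends them to 0.\<close>

lemma Psi_kernel:
  assumes x: "x \<in> carrier G" and 0: "Psi x = 0" shows "x \<in> H"
proof -
  obtain a where a: "x - frag_of (cl a, 1) \<in> H" using frag_normal_form[OF x] by blast
  have "Psi (frag_of (cl a, 1)) = 0" using H_Psi[OF a] 0 by (simp only: Psi_diff) simp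
  then have "entry a l 0 n = 0" for n by (simp add: entry_def scal_hom(2))
  then obtain u v where uv: "a \<sim>\<^sub>I u * gen E_b + v * (gen h_b - scalar_word l)"
    using annihilator_highest_weight[OF weight] by blast
  have "frag_of (cl (u * w), 1) \<in> H" if w: "w \<in> carrier (tensor_algebra borel)" "borel_character l w = 0" for u w
    using H_closed(2)[OF R_in_H[OF relationI(3)[OF w(1), of u 1]] frag_zero(2)[of u]] by (simp add: w)
  moreover have E: "gen E_b \<in> carrier (tensor_algebra borel)" and h: "gen h_b \<in> carrier (tensor_algebra borel)"
    by (simp_all add: gen_def carrier_tensor_algebra)
  moreover have "gen h_b - scalar_word l \<in> carrier (tensor_algebra borel)"
    by (rule tensor_diff_closed[OF h scalar_word_in_tensor])
  moreover have "borel_character l (gen E_b) = 0" "borel_character l (gen h_b - scalar_word l) = 0"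
    by (simp_all add: borel_character_eq borel.W_diff borel.W_scalar_word gen_def borel.W_single)
  ultimately have "frag_of (cl (u * gen E_b), 1) \<in> H" "frag_of (cl (v * (gen h_b - scalar_word l)), 1) \<in> H"
    by blast+
  from H_closed(2)[OF H_closed(2)[OF this] frag_add[of "u * gen E_b" "v * (gen h_b - scalar_word l)" 1]]
  have "frag_of (cl a, 1) \<in> H" using uv by (simp add: cl_eq_iff[symmetric])
  from H_closed(2)[OF a this] show ?thesis by simp
qed

text \<open>The cosets of \<open>H\<close> are the fibres of \<open>Psi\<close>, so an element of
  the tensor product is named by its value in \<open>Zspace\<close>.\<close>

definition fib :: "(nat \<Rightarrow> 'k) \<Rightarrow> ('k words set \<times> 'k \<Rightarrow>\<^sub>0 int) set" where
  "fib g = {x \<in> carrier G. Psi x = g}"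

lemma coset_fib: "x \<in> carrier G \<Longrightarrow> H #>\<^bsub>G\<^esub> x = fib (Psi x)"
proof (intro equalityI subsetI)
  fix y assume x: "x \<in> carrier G" and "y \<in> H #>\<^bsub>G\<^esub> x"
  then obtain h where "h \<in> H" "y = h + x" by (auto simp: r_coset_def)
  then show "y \<in> fib (Psi x)"
    using H_closed(1)[of h] G_closed(1)[of h x] x by (simp add: fib_def Psi_add H_Psi del: G_simps(1))
next
  fix y assume x: "x \<in> carrier G" and "y \<in> fib (Psi x)"
  then have "y - x \<in> H" by (intro Psi_kernel) (auto simp: fib_def Psi_diff intro: G_closed simp del: G_simps(1))
  then show "y \<in> H #>\<^bsub>G\<^esub> x" by (force simp: r_coset_def)
qed

lemma fib_0: "fib 0 = H"
  using H_Psi H_closed(1) Psi_kernel by (auto simp: fib_def simp del: G_simps(1))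

lemma fib_nonempty:
  assumes "g \<in> Zspace" obtains a where "frag_of (cl a, 1) \<in> fib g"
proof -
  obtain a where "app (verma_rep l a) (delta 0) = g" using highest_weight_orbit[OF weight assms] .
  then have "frag_of (cl a, 1) \<in> fib g" using G_closed(5) by (simp add: fib_def scal_hom(2) del: G_simps(1))
  then show ?thesis by (rule that)
qed

definition value_of :: "('k words set \<times> 'k \<Rightarrow>\<^sub>0 int) set \<Rightarrow> nat \<Rightarrow> 'k" where
  "value_of C = the_elem (Psi ` C)"

lemma value_of_fib: "g \<in> Zspace \<Longrightarrow> value_of (fib g) = g"
proof -
  assume "g \<in> Zspace"
  then obtain a where "frag_of (cl a, 1) \<in> fib g" by (rule fib_nonempty)
  then have "Psi ` fib g \<noteq> {}" by blast
  moreover have "Psi ` fib g \<subseteq> {g}" unfolding fib_def by blast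
  ultimately have "Psi ` fib g = {g}" by blast
  then show ?thesis by (simp add: value_of_def)
qed

abbreviation "Z \<equiv> baby_verma \<chi> l"

lemma Z_def: "Z = tensor_module U (U_borel \<chi>) (borel_inclusion \<chi>) (K_module l)"
  by (simp add: baby_verma_def)

lemma carrier_Z: "carrier Z = fib ` Zspace"
proof -
  have "carrier Z = (\<lambda>x. H #>\<^bsub>G\<^esub> x) ` carrier G"
    by (simp add: Z_def tensor_module_def Let_def carrier_FactGroup H_def R_def G_def)
  also have "\<dots> = (\<lambda>x. fib (Psi x)) ` carrier G" by (intro image_cong refl coset_fib)
  also have "\<dots> = fib ` Zspace"
  proof (intro equalityI subsetI)
    fix C assume "C \<in> fib ` Zspace"
    then obtain g where g: "g \<in> Zspace" "C = fib g" by blast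
    obtain x where "x \<in> fib g" using fib_nonempty[OF g(1)] by blast
    then have "x \<in> carrier G" "Psi x = g" unfolding fib_def by blast+
    then show "C \<in> (\<lambda>x. fib (Psi x)) ` carrier G" unfolding g(2) by blast
  qed (auto simp: Psi_Zspace simp del: G_simps(1))
  finally show ?thesis .
qed

lemma Z_add:
  assumes "g \<in> Zspace" "h \<in> Zspace" shows "fib g \<oplus>\<^bsub>Z\<^esub> fib h = fib (g + h)"
proof -
  interpret G: comm_group G by (rule comm_group_G)
  have N: "H \<lhd> G" by (rule G.subgroup_imp_normal[OF subgroup_H])
  obtain a b where ab: "frag_of (cl a, 1) \<in> fib g" "frag_of (cl b, 1) \<in> fib h"
    using fib_nonempty assms by metis
  let ?x = "frag_of (cl a, 1)" and ?y = "frag_of (cl b, 1)"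
  have xy: "?x \<in> carrier G" "?y \<in> carrier G" by (rule G_closed)+
  have "fib g \<oplus>\<^bsub>Z\<^esub> fib h = fib g <#>\<^bsub>G\<^esub> fib h"
    by (simp add: Z_def tensor_module_def Let_def G_def)
  also have "\<dots> = (H #>\<^bsub>G\<^esub> ?x) <#>\<^bsub>G\<^esub> (H #>\<^bsub>G\<^esub> ?y)"
    using ab by (simp only: coset_fib xy fib_def mem_Collect_eq)
  also have "\<dots> = H #>\<^bsub>G\<^esub> (?x + ?y)" using normal.rcos_sum[OF N xy] by simp
  also have "\<dots> = fib (g + h)" using ab G_closed(1)[OF xy] by (simp only: coset_fib Psi_add fib_def mem_Collect_eq)
  finally show ?thesis .
qed

lemma Z_zero: "\<zero>\<^bsub>Z\<^esub> = fib 0"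
  by (simp add: Z_def tensor_module_def Let_def fib_0 H_def R_def G_def)

definition frag_act :: "'k words \<Rightarrow> ('k words set \<times> 'k \<Rightarrow>\<^sub>0 int) \<Rightarrow> ('k words set \<times> 'k \<Rightarrow>\<^sub>0 int)" where
  "frag_act a = frag_extend (\<lambda>(X, m). frag_of (cl a \<otimes>\<^bsub>U\<^esub> X, m))"

lemma frag_act:
  assumes "x \<in> carrier G"
  shows "frag_act a x \<in> carrier G \<and> Psi (frag_act a x) = app (verma_rep l a) (Psi x)"
  using assms
proof (rule G_frag_cases)
  fix x y assume "frag_act a x \<in> carrier G \<and> Psi (frag_act a x) = app (verma_rep l a) (Psi x)"
    "frag_act a y \<in> carrier G \<and> Psi (frag_act a y) = app (verma_rep l a) (Psi y)"
  then show "frag_act a (x - y) \<in> carrier G \<and> Psi (frag_act a (x - y)) = app (verma_rep l a) (Psi (x - y))"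
    using G_closed(2)[of "frag_act a x" "frag_act a y"]
    by (simp add: frag_act_def frag_extend_diff Psi_diff app_diff del: G_simps(1))
next
  fix b c
  have "app (verma_rep l a) (app (scal d) g) = app (scal d) (app (verma_rep l a) g)" for d g
  proof -
    have "verma_rep l a * scal d = scal d * verma_rep l a"
      using scalar_word_commute[of a d] by (metis verma.W_mult verma.W_scalar_word)
    then show ?thesis by (metis app_ring(6))
  qed
  then show "frag_act a (frag_of (cl b, c)) \<in> carrier G \<and>
      Psi (frag_act a (frag_of (cl b, c))) = app (verma_rep l a) (Psi (frag_of (cl b, c)))"
    using G_closed(5) by (simp add: frag_act_def verma.W_mult del: G_simps(1))
next
  show "frag_act a 0 \<in> carrier G \<and> Psi (frag_act a 0) = app (verma_rep l a) (Psi 0)"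
    using G_closed(4) by (simp only: frag_act_def frag_extend_0 Psi_0 app_0 simp_thms)
qed

lemma Z_act:
  assumes g: "g \<in> Zspace" shows "cl a \<odot>\<^bsub>Z\<^esub> fib g = fib (app (verma_rep l a) g)"
proof -
  have "cl a \<odot>\<^bsub>Z\<^esub> fib g = (\<Union>c\<in>fib g. H #>\<^bsub>G\<^esub> frag_act a c)"
    by (simp add: Z_def tensor_module_def Let_def frag_act_def H_def R_def G_def)
  \<comment> \<open>Every member of the union is the same fibre, so the action does not depend on
    the representative.\<close>
  also have "\<dots> = (\<Union>c\<in>fib g. fib (app (verma_rep l a) g))"
    by (intro SUP_cong refl) (use frag_act in \<open>auto simp: coset_fib fib_def simp del: G_simps(1)\<close>)
  also have "\<dots> = fib (app (verma_rep l a) g)" using fib_nonempty[OF g] by auto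
  finally show ?thesis .
qed

text \<open>\<open>K_module l\<close> is purely even, so the generating tensors of parity k are
  those with first factor of parity k, or with second factor 0. Conversely, a function of parity k
  is reached from v_0 by an element of parity k.\<close>

lemma Z_homog: "homog Z k = fib ` (Zspace \<inter> parity_space k)"
proof -
  define B where "B = {frag_of (X, m) | X (m :: 'k). \<exists>i j. X \<in> homog U i \<and> m \<in> homog (K_module l) j \<and> i + j = k}"
  have H: "homog Z k = {H #>\<^bsub>G\<^esub> c | c. c \<in> generate G B}"
    by (simp add: Z_def tensor_module_def Let_def H_def R_def G_def B_def)
  have d0: "(delta 0 :: nat \<Rightarrow> 'k) \<in> parity_space 0" by (auto simp: parity_space_def delta_def)
  have B: "b \<in> carrier G \<and> Psi b \<in> parity_space k" if "b \<in> B" for b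
  proof -
    from that obtain X m i j where *: "b = frag_of (X, m)" "X \<in> homog U i" "m \<in> homog (K_module l) j" "i + j = k"
      by (auto simp: B_def)
    then obtain a where a: "X = cl a" "a \<in> tensor_part UNIV i" by (auto simp: U_homog)
    have "Psi b \<in> parity_space k"
    proof (cases j)
      case zero
      then have "app (verma_rep l a) (delta 0) \<in> parity_space k"
        using verma_rep_parity[OF a(2) d0, of l] *(4) by simp
      then show ?thesis by (auto simp: * a parity_space_def)
    next
      case one
      then have "m = 0" using *(3) by simp
      then show ?thesis by (simp add: * scal_hom(1) parity_space_def)
    qed
    then show ?thesis using G_closed(5) by (simp add: * a del: G_simps(1))
  qed
  have gen: "c \<in> carrier G \<and> Psi c \<in> parity_space k" if "c \<in> generate G B" for c
    using that
  proof (induction rule: generate.induct)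
    case one
    then show ?case by (simp add: parity_space_def)
  next
    case (incl b)
    then show ?case by (rule B)
  next
    case (inv b)
    then show ?case using B[OF inv] G_closed(3)[of b]
      by (simp add: G_inv Psi_minus parity_space_def del: G_simps(1))
  next
    case (eng x y)
    then have "Psi (x + y) \<in> parity_space k" unfolding Psi_add by (intro parity_space_add) blast+
    then show ?case using eng G_closed(1)[of x y] by (simp only: G_simps(3) simp_thms)
  qed
  show ?thesis
  proof (intro equalityI subsetI)
    fix C assume "C \<in> homog Z k"
    then obtain c where c: "C = H #>\<^bsub>G\<^esub> c" "c \<in> generate G B" by (auto simp: H)
    then have "C = fib (Psi c)" "Psi c \<in> Zspace \<inter> parity_space k"
      using gen[OF c(2)] coset_fib Psi_Zspace by auto
    then show "C \<in> fib ` (Zspace \<inter> parity_space k)" by blast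
  next
    fix C assume "C \<in> fib ` (Zspace \<inter> parity_space k)"
    then obtain g where g: "C = fib g" "g \<in> Zspace" "g \<in> parity_space k" by blast
    obtain a where a: "a \<in> tensor_part UNIV k" "app (verma_rep l a) (delta 0) = g"
      using highest_weight_orbit_homog[OF weight g(2,3)] .
    have "frag_of (cl a, 1) \<in> B" unfolding B_def
      by (intro CollectI exI[of _ "cl a"] exI[of _ 1] exI[of _ k] exI[of _ 0] conjI refl) (use a in \<open>auto simp: U_homog\<close>)
    then have "frag_of (cl a, 1) \<in> generate G B" by (rule generate.incl)
    moreover have "H #>\<^bsub>G\<^esub> frag_of (cl a, 1) = C"
      using coset_fib[OF G_closed(5)[of a 1]] a(2) g(1) by (simp add: scal_hom(2))
    ultimately show "C \<in> homog Z k" unfolding H by blast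
  qed
qed

theorem verma_like_Z: "verma_like \<chi> l Z value_of"
proof (intro verma_like.intro osp_regular_axioms verma_like_axioms.intro weight)
  show "bij_betw value_of (carrier Z) Zspace"
    by (rule bij_betw_byWitness[of _ fib]) (auto simp: carrier_Z value_of_fib)
qed (auto simp: carrier_Z Z_add Z_zero Z_act Z_homog value_of_fib Zspace_add verma_rep_Zspace)

end

theorem proposition6p1:
  fixes \<chi> :: "'k::alg_closed_field osp \<Rightarrow> 'k" and p :: nat
  assumes "CHAR('k) = p" and "p > 2"
    and "\<chi> \<in> even_dual" and "regular_semisimple \<chi>"
    and "\<chi> (basis_vec e_b) = 0" and "\<chi> (basis_vec f_b) = 0"
  shows "(card (weights \<chi>) = p) \<and>
    (semisimple_algebra (U_osp \<chi>)) \<and>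
    (semisimple_superalgebra (U_osp \<chi>)) \<and>
    (algebra_isomorphic (U_osp \<chi>)
      (direct_sum_algebra (weights \<chi>) (\<lambda>_. module_mat TYPE('k) (2 * p) (2 * p)))) \<and>
    (\<forall>l\<in>weights \<chi>. irreducible_supermodule (U_osp \<chi>) (baby_verma \<chi> l)) \<and>
    (\<forall>l\<in>weights \<chi>. \<forall>m\<in>weights \<chi>.
      super_isomorphic (U_osp \<chi>) (baby_verma \<chi> l) (baby_verma \<chi> m) \<longrightarrow> l = m) \<and>
    (\<forall>V :: ('k words set, 'm) supermodule. irreducible_supermodule (U_osp \<chi>) V \<longrightarrow>
      (\<exists>l\<in>weights \<chi>. super_isomorphic (U_osp \<chi>) (baby_verma \<chi> l) V)) \<and>
    (\<forall>l\<in>weights \<chi>. type_M (U_osp \<chi>) (baby_verma \<chi> l))"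
proof -
  have gt: "CHAR('k) > 2" using assms by simp
  interpret osp_regular \<chi>
    using gt assms(3,5,6) regular_semisimple_iff[OF gt assms(3,5,6)] assms(4) by unfold_locales auto
  have verma: "verma_like \<chi> l (baby_verma \<chi> l) (baby_verma_module.value_of l)" if "l \<in> weights \<chi>" for l
    by (rule baby_verma_module.verma_like_Z)
      (intro baby_verma_module.intro osp_regular_axioms baby_verma_module_axioms.intro that)
  have classification: "\<exists>l\<in>weights \<chi>. super_isomorphic U (baby_verma \<chi> l) V"
    if irr: "irreducible_supermodule U V" for V :: "('k words set, 'm) supermodule"
  proof -
    have "supermodule U V" using irr unfolding irreducible_supermodule_def by (rule conjunct1)
    then have V: "U_supermodule \<chi> V"
      by (intro U_supermodule.intro osp_regular_axioms U_supermodule_axioms.intro)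
    show ?thesis
    proof (rule U_supermodule.irreducible_is_verma[OF V irr])
      fix l assume l: "l \<in> weights \<chi>"
        and iso: "\<And>(X :: ('k words set, ('k words set \<times> 'k \<Rightarrow>\<^sub>0 int) set) supermodule) f.
          verma_like \<chi> l X f \<Longrightarrow> super_isomorphic U X V"
      show "\<exists>l\<in>weights \<chi>. super_isomorphic U (baby_verma \<chi> l) V"
        using iso[OF verma[OF l]] l by (rule bexI)
    qed
  qed
  show ?thesis
    unfolding assms(1)[symmetric]
    by (intro conjI ballI allI impI weights_card semisimple_U semisimple_super_U U_matrices classification
        verma_like.irreducible_V[OF verma] verma_like.type_M_V[OF verma]
        verma_like_not_isomorphic[OF verma verma])
qed

end
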